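(* The topology $\kappa(\mathcal{D}_{L^1},\dot{\mathcal{B}}')$ on $\mathcal{D}_{L^1}$ is generated by the family of seminorms $$\mathcal{D}_{L^1}\to\mathbb{R}_+,\quad\varphi\mapsto p_{g,m}(\varphi):=\|g\,(1-\Delta_n)^m\varphi\|_1,\qquad g\in\mathcal{C}_0,\ m\in\mathbb{N}_0,$$ or, equivalently, by the family of seminorms $$\varphi\mapsto\sup_{|\alpha|\le m}\|g\,\partial^\alpha\varphi\|_1,\qquad g\in\mathcal{C}_0,\ m\in\mathbb{N}_0.$$
   Context: All spaces consist of complex-valued functions or distributions on $\mathbb{R}^n$; $\Delta_n$ is the Laplacian on $\mathbb{R}^n$ and $\mathcal{C}_0$ is the space of continuous functions vanishing at infinity. $\mathcal{D}_{L^1}$ is the space of $C^\infty$-functions all of whose derivatives lie in $L^1$, with its usual topology defined by the norms $\varphi\mapsto\sup_{|\alpha|\le m}\|\partial^\alpha\varphi\|_1$, $m\in\mathbb{N}_0$. $\mathcal{B}'=\mathcal{D}'_{L^\infty}$ is the strong dual of $\mathcal{D}_{L^1}$, and $\dot{\mathcal{B}}'$ is the closure in $\mathcal{B}'$ of the space $\mathcal{E}'$ of compactly supported distributions, with the induced topology; one has $(\dot{\mathcal{B}}')'=\mathcal{D}_{L^1}$. $\kappa(E,F)$ denotes the topology on $E$ of uniform convergence on absolutely convex compact subsets of $F$. The space $\mathcal{D}_{L^1}$ with $\kappa(\mathcal{D}_{L^1},\dot{\mathcal{B}}')$ is denoted $\mathcal{D}_{L^1,c}$. *)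

theory Defs
  imports "HOL-Analysis.Analysis"
begin

section \<open>Spaces of complex-valued functions with a family of seminorms\<close>

text \<open>
  Vector spaces occur as sets of complex-valued functions on a type, with the pointwise
  operations. The type \<open>'a\<close> is \<open>real ^ 'n\<close> for function spaces, and a
  type of functions for spaces of linear functionals.
\<close>

definition seminorm_topology ::
    "('a \<Rightarrow> complex) set \<Rightarrow> (('a \<Rightarrow> complex) \<Rightarrow> real) set \<Rightarrow> ('a \<Rightarrow> complex) topology" where
  "seminorm_topology V P =
     topology_generated_by
       {{g \<in> V. p (\<lambda>t. g t - f t) < e} | p f e. p \<in> P \<and> f \<in> V \<and> 0 < (e::real)}"

text \<open>
  Functionals are total functions in HOL. They are normalised to \<open>0\<close> off \<open>V\<close>, so that
  two of them are equal iff they agree on \<open>V\<close>.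
\<close>

definition continuous_dual ::
    "('a \<Rightarrow> complex) set \<Rightarrow> (('a \<Rightarrow> complex) \<Rightarrow> real) set \<Rightarrow> (('a \<Rightarrow> complex) \<Rightarrow> complex) set" where
  "continuous_dual V P =
     {T. (\<forall>f\<in>V. \<forall>g\<in>V. \<forall>a b. T (\<lambda>t. a * f t + b * g t) = a * T f + b * T g) \<and>
         continuous_map (seminorm_topology V P) euclidean T \<and>
         (\<forall>f. f \<notin> V \<longrightarrow> T f = 0)}"

text \<open>
  In the next definition and in \<open>kappa_topology\<close>, empty sets are left out only because the
  supremum of the empty set of reals is a junk value; they would contribute the zero seminorm.
\<close>

definition strong_dual_topology ::
    "('a \<Rightarrow> complex) set \<Rightarrow> (('a \<Rightarrow> complex) \<Rightarrow> real) set \<Rightarrow> (('a \<Rightarrow> complex) \<Rightarrow> complex) topology" where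
  "strong_dual_topology V P =
     seminorm_topology (continuous_dual V P)
       {(\<lambda>T. SUP f\<in>B. norm (T f)) | B. B \<noteq> {} \<and> B \<subseteq> V \<and> (\<forall>p\<in>P. bdd_above (p ` B))}"

definition absolutely_convex :: "('a \<Rightarrow> complex) set \<Rightarrow> bool" where
  "absolutely_convex K \<longleftrightarrow>
     (\<forall>f\<in>K. \<forall>g\<in>K. \<forall>a b. norm a + norm b \<le> 1 \<longrightarrow> (\<lambda>t. a * f t + b * g t) \<in> K)"

text \<open>
  The topology \<open>\<kappa>(E, F)\<close>, for \<open>F\<close> a topological space of functionals paired with \<open>E\<close> by evaluation.
\<close>

definition kappa_topology ::
    "('a \<Rightarrow> complex) set \<Rightarrow> (('a \<Rightarrow> complex) \<Rightarrow> complex) topology \<Rightarrow> ('a \<Rightarrow> complex) topology" where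
  "kappa_topology E F =
     seminorm_topology E
       {(\<lambda>f. SUP T\<in>K. norm (T f)) | K. K \<noteq> {} \<and> absolutely_convex K \<and> compactin F K}"


section \<open>Derivatives\<close>

definition partial :: "'n \<Rightarrow> (real ^ 'n \<Rightarrow> complex) \<Rightarrow> real ^ 'n::finite \<Rightarrow> complex" where
  "partial i f x = vector_derivative (\<lambda>t. f (x + t *\<^sub>R axis i 1)) (at 0)"

text \<open>
  All iterated partial derivatives, in any order, exist and are (totally) differentiable,
  hence continuous.
\<close>

definition smooth :: "(real ^ 'n::finite \<Rightarrow> complex) \<Rightarrow> bool" where
  "smooth f \<longleftrightarrow> (\<forall>is. foldr partial is f differentiable_on UNIV)"

text \<open>
  The index type carries no order, so some enumeration of the coordinates is fixed;
  for smooth functions the choice is irrelevant by the symmetry of mixed derivatives.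
\<close>

definition mpartial :: "('n \<Rightarrow> nat) \<Rightarrow> (real ^ 'n \<Rightarrow> complex) \<Rightarrow> real ^ 'n::finite \<Rightarrow> complex" where
  "mpartial \<alpha> f =
     foldr (\<lambda>i. partial i ^^ \<alpha> i) (SOME is. distinct is \<and> set is = (UNIV :: 'n set)) f"

definition mindex_le :: "nat \<Rightarrow> ('n::finite \<Rightarrow> nat) set" where
  "mindex_le m = {\<alpha>. (\<Sum>i\<in>UNIV. \<alpha> i) \<le> m}"

definition laplacian :: "(real ^ 'n \<Rightarrow> complex) \<Rightarrow> real ^ 'n::finite \<Rightarrow> complex" where
  "laplacian f x = (\<Sum>i\<in>UNIV. partial i (partial i f) x)"

definition one_minus_laplacian :: "(real ^ 'n \<Rightarrow> complex) \<Rightarrow> real ^ 'n::finite \<Rightarrow> complex" where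
  "one_minus_laplacian f x = f x - laplacian f x"


section \<open>The spaces\<close>

definition L1_norm :: "(real ^ 'n::finite \<Rightarrow> complex) \<Rightarrow> real" where
  "L1_norm f = (LINT x|lborel. norm (f x))"

definition C0 :: "(real ^ 'n::finite \<Rightarrow> complex) set" where
  "C0 = {g. continuous_on UNIV g \<and> (g \<longlongrightarrow> 0) at_infinity}"

definition D_L1 :: "(real ^ 'n::finite \<Rightarrow> complex) set" where
  "D_L1 = {f. smooth f \<and> (\<forall>\<alpha>. integrable lborel (mpartial \<alpha> f))}"

definition D_L1_seminorms :: "((real ^ 'n::finite \<Rightarrow> complex) \<Rightarrow> real) set" where
  "D_L1_seminorms = {(\<lambda>f. SUP \<alpha>\<in>mindex_le m. L1_norm (mpartial \<alpha> f)) | m. True}"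

definition B' :: "((real ^ 'n::finite \<Rightarrow> complex) \<Rightarrow> complex) set" where
  "B' = continuous_dual D_L1 D_L1_seminorms"

definition B'_topology :: "((real ^ 'n::finite \<Rightarrow> complex) \<Rightarrow> complex) topology" where
  "B'_topology = strong_dual_topology D_L1 D_L1_seminorms"

definition fun_support :: "(real ^ 'n::finite \<Rightarrow> complex) \<Rightarrow> (real ^ 'n) set" where
  "fun_support f = closure {x. f x \<noteq> 0}"

definition test_functions :: "(real ^ 'n::finite \<Rightarrow> complex) set" where
  "test_functions = {f. smooth f \<and> compact (fun_support f)}"

definition dist_support :: "((real ^ 'n::finite \<Rightarrow> complex) \<Rightarrow> complex) \<Rightarrow> (real ^ 'n) set" where
  "dist_support T =
     - \<Union>{U. open U \<and> (\<forall>f\<in>test_functions. fun_support f \<subseteq> U \<longrightarrow> T f = 0)}"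

text \<open>
  Every compactly supported distribution extends uniquely to a continuous functional on
  \<open>D_L1\<close>; as a subspace of \<open>B'\<close>, the space \<open>\<E>'\<close> thus consists of
  the elements with compact support.
\<close>

definition E' :: "((real ^ 'n::finite \<Rightarrow> complex) \<Rightarrow> complex) set" where
  "E' = {T \<in> B'. compact (dist_support T)}"

definition B'_dot :: "((real ^ 'n::finite \<Rightarrow> complex) \<Rightarrow> complex) set" where
  "B'_dot = B'_topology closure_of E'"

definition B'_dot_topology :: "((real ^ 'n::finite \<Rightarrow> complex) \<Rightarrow> complex) topology" where
  "B'_dot_topology = subtopology B'_topology B'_dot"

end

theory Submission
  imports Defs
begin

text \<open>
  All topologies are compared with the one given by the weighted norms \<open>wnorm g m f\<close>, the maximum of
  \<open>\<parallel>g \<partial>\<^sup>\<alpha> f\<parallel>\<^sub>1\<close> over \<open>|\<alpha>| \<le> m\<close>, for \<open>g\<close> in \<open>C0\<close>.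

  The topology \<open>\<kappa>\<close> is finer than this one. Consider the polar of \<open>wnorm g m\<close>, that is, all functionals \<open>T\<close>
  with \<open>|T f| \<le> wnorm g m f\<close>. It is absolutely convex, and the supremum of \<open>|T f|\<close> over it is \<open>wnorm g m f\<close>,
  as is seen by integrating a derivative of maximal norm against its conjugate phase. It is compact for pointwise
  convergence by Tychonoff. A bounded subset of \<open>D_L1\<close> is totally bounded for \<open>wnorm g m\<close>: mollification
  changes its elements little and makes them uniformly bounded and uniformly Lipschitz, which leaves finitely many
  possibilities, up to a small error, on a ball outside which \<open>g\<close> is small. Hence pointwise convergence on the polar is uniform on
  bounded sets, and the polar is compact in the strong topology. Cutoffs show that it lies in \<open>B'_dot\<close>
  (\<open>polar_of_compactin\<close>, \<open>wnorm_le_sup_polar\<close>).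

  Conversely, let \<open>K\<close> be compact in \<open>B'_dot\<close>. A rescaling argument gives \<open>|T f| \<le> C \<parallel>f\<parallel>\<^sub>m\<close> for all \<open>T\<close> in \<open>K\<close>,
  where \<open>\<parallel>f\<parallel>\<^sub>m\<close> is the norm of order \<open>m\<close> of \<open>D_L1\<close>. Elements of \<open>E'\<close> vanish on functions that live far out;
  by density and compactness, \<open>T ((1 - \<chi>\<^sub>R) f)\<close> tends to \<open>0\<close> for \<open>R \<rightarrow> \<infinity>\<close>, uniformly for \<open>T\<close> in \<open>K\<close> and \<open>f\<close> in a bounded set.
  Mollification writes the unit ball of order \<open>m + 1\<close> as the sum of a bounded set and a set that is small in
  order \<open>m\<close>; so the convergence is even uniform on the unit ball of order \<open>m + 1\<close>. Finally \<open>f\<close> is cut into pieces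
  living on annuli such that the \<open>k\<close>-th piece is seen by \<open>K\<close> only with a factor \<open>4\<^sup>-\<^sup>k\<close>. A weight that is at least
  \<open>2\<^sup>-\<^sup>k\<close> on the \<open>k\<close>-th annulus then dominates \<open>K\<close>, and it can be chosen in \<open>C0\<close> (\<open>compact_dominated\<close>).

  Derivatives are bounded by powers of \<open>1 - \<Delta>\<close> as follows. Each weight is dominated by a slowly varying one,
  \<open>b (x + h) \<le> (1 + |h|) b x\<close>. If \<open>|w| \<le> b\<close>, then \<open>U h = \<integral> w x * f (x + h) dx\<close> is a smooth function with
  \<open>\<partial>\<^sub>i U 0 = \<integral> w \<partial>\<^sub>i f\<close>, and near \<open>0\<close> both \<open>U\<close> and \<open>\<Delta> U\<close> are bounded by constant multiples of \<open>\<parallel>b f\<parallel>\<^sub>1\<close> and \<open>\<parallel>b \<Delta> f\<parallel>\<^sub>1\<close>.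
  So the classical interior gradient estimate for \<open>U\<close>, a consequence of the maximum principle, becomes
  \<open>\<parallel>b \<partial>\<^sub>i f\<parallel>\<^sub>1 \<le> C (\<parallel>b f\<parallel>\<^sub>1 + \<parallel>b \<Delta> f\<parallel>\<^sub>1)\<close>, which is iterated (\<open>weighted_gradient\<close>, \<open>weighted_elliptic\<close>).
\<close>

section \<open>Topologies generated by seminorms\<close>

lemma continuous_dual_add:
  assumes "T \<in> continuous_dual V P" "f \<in> V" "g \<in> V"
  shows "T (\<lambda>t. f t + g t) = T f + T g"
proof -
  have "T (\<lambda>t. 1 * f t + 1 * g t) = 1 * T f + 1 * T g"
    using assms unfolding continuous_dual_def by blast
  then show ?thesis by simp
qed

lemma continuous_dual_diff:
  assumes "T \<in> continuous_dual V P" "f \<in> V" "g \<in> V"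
  shows "T (\<lambda>t. f t - g t) = T f - T g"
proof -
  have "T (\<lambda>t. 1 * f t + (-1) * g t) = 1 * T f + (-1) * T g"
    using assms unfolding continuous_dual_def by blast
  then show ?thesis by simp
qed

lemma continuous_dual_scale:
  assumes "T \<in> continuous_dual V P" "f \<in> V"
  shows "T (\<lambda>t. c * f t) = c * T f"
proof -
  have "T (\<lambda>t. c * f t + 0 * f t) = c * T f + 0 * T f"
    using assms unfolding continuous_dual_def by blast
  then show ?thesis by simp
qed

definition seminorm_on :: "('a \<Rightarrow> complex) set \<Rightarrow> (('a \<Rightarrow> complex) \<Rightarrow> real) \<Rightarrow> bool" where
  "seminorm_on V p \<longleftrightarrow>
     (\<forall>f\<in>V. \<forall>g\<in>V. p (\<lambda>t. f t + g t) \<le> p f + p g) \<and>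
     (\<forall>f\<in>V. \<forall>c. p (\<lambda>t. c * f t) = norm c * p f)"

definition subspace_fun :: "('a \<Rightarrow> complex) set \<Rightarrow> bool" where
  "subspace_fun V \<longleftrightarrow> (\<lambda>t. 0) \<in> V \<and> (\<forall>f\<in>V. \<forall>g\<in>V. \<forall>a b. (\<lambda>t. a * f t + b * g t) \<in> V)"

lemma seminorm_on_add: "seminorm_on V p \<Longrightarrow> f \<in> V \<Longrightarrow> g \<in> V \<Longrightarrow> p (\<lambda>t. f t + g t) \<le> p f + p g"
  unfolding seminorm_on_def by blast

lemma seminorm_on_scale: "seminorm_on V p \<Longrightarrow> f \<in> V \<Longrightarrow> p (\<lambda>t. c * f t) = norm c * p f"
  unfolding seminorm_on_def by blast

lemma subspace_fun_add: "subspace_fun V \<Longrightarrow> f \<in> V \<Longrightarrow> g \<in> V \<Longrightarrow> (\<lambda>t. f t + g t) \<in> V"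
proof -
  assume "subspace_fun V" "f \<in> V" "g \<in> V"
  then have "(\<lambda>t. 1 * f t + 1 * g t) \<in> V" unfolding subspace_fun_def by blast
  then show ?thesis by simp
qed

lemma subspace_fun_scale: "subspace_fun V \<Longrightarrow> f \<in> V \<Longrightarrow> (\<lambda>t. c * f t) \<in> V"
proof -
  assume "subspace_fun V" "f \<in> V"
  then have "(\<lambda>t. c * f t + 0 * f t) \<in> V" unfolding subspace_fun_def by blast
  then show ?thesis by simp
qed

lemma subspace_fun_diff: "subspace_fun V \<Longrightarrow> f \<in> V \<Longrightarrow> g \<in> V \<Longrightarrow> (\<lambda>t. f t - g t) \<in> V"
proof -
  assume "subspace_fun V" "f \<in> V" "g \<in> V"
  then have "(\<lambda>t. 1 * f t + (-1) * g t) \<in> V" unfolding subspace_fun_def by blast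
  then show ?thesis by simp
qed

lemma seminorm_on_0: "subspace_fun V \<Longrightarrow> seminorm_on V p \<Longrightarrow> p (\<lambda>t. 0) = 0"
proof -
  assume "subspace_fun V" "seminorm_on V p"
  then show ?thesis
    using seminorm_on_scale[of V p "\<lambda>t. 0" 0] unfolding subspace_fun_def by simp
qed

lemma seminorm_on_triangle:
  assumes "subspace_fun V" "seminorm_on V p" "f \<in> V" "g \<in> V" "h \<in> V"
  shows "p (\<lambda>t. h t - f t) \<le> p (\<lambda>t. h t - g t) + p (\<lambda>t. g t - f t)"
proof -
  have "p (\<lambda>t. (h t - g t) + (g t - f t)) \<le> p (\<lambda>t. h t - g t) + p (\<lambda>t. g t - f t)"
    by (rule seminorm_on_add[OF assms(2) subspace_fun_diff[OF assms(1,5,4)] subspace_fun_diff[OF assms(1,4,3)]])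
  then show ?thesis by simp
qed

lemma seminorm_on_minus:
  assumes "seminorm_on V p" "f \<in> V"
  shows "p (\<lambda>t. - f t) = p f"
proof -
  have "p (\<lambda>t. (-1) * f t) = norm (-1::complex) * p f"
    using assms unfolding seminorm_on_def by blast
  then show ?thesis by simp
qed

lemma seminorm_on_nonneg:
  assumes "subspace_fun V" "seminorm_on V p" "f \<in> V"
  shows "0 \<le> p f"
proof -
  have "p (\<lambda>t. f t + (-1) * f t) \<le> p f + p (\<lambda>t. (-1) * f t)"
    by (rule seminorm_on_add[OF assms(2,3) subspace_fun_scale[OF assms(1,3)]])
  then show ?thesis using seminorm_on_0[OF assms(1,2)] seminorm_on_minus[OF assms(2,3)] by simp
qed

lemma openin_seminorm_ball:
  assumes "p \<in> P" "f \<in> V" "0 < e"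
  shows "openin (seminorm_topology V P) {g \<in> V. p (\<lambda>t. g t - f t) < e}"
  unfolding seminorm_topology_def
  by (rule topology_generated_by_Basis) (use assms in blast)

lemma topspace_seminorm_topology:
  assumes "P \<noteq> {}" "subspace_fun V" "\<And>p. p \<in> P \<Longrightarrow> seminorm_on V p"
  shows "topspace (seminorm_topology V P) = V"
proof -
  have "f \<in> topspace (seminorm_topology V P)" if "f \<in> V" for f
  proof -
    obtain p where p: "p \<in> P" using assms(1) by blast
    have "f \<in> {g \<in> V. p (\<lambda>t. g t - f t) < 1}"
      using that seminorm_on_0[OF assms(2) assms(3)[OF p]] by simp
    then show ?thesis
      using openin_seminorm_ball[OF p that, of 1] openin_subset by fastforce
  qed
  then show ?thesis unfolding seminorm_topology_def by auto
qed

text \<open>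
  The generating balls may be centred anywhere; by the triangle inequality, a ball contains a smaller one around
  each of its points.
\<close>

lemma openin_seminorm_topology_nhd:
  assumes V: "subspace_fun V" and P: "\<And>p. p \<in> P \<Longrightarrow> seminorm_on V p"
    and U: "openin (seminorm_topology V P) U" "f \<in> U"
  obtains P0 r where "finite P0" "P0 \<subseteq> P" "0 < r" "{g \<in> V. \<forall>p\<in>P0. p (\<lambda>t. g t - f t) < r} \<subseteq> U"
proof -
  define N where "N U f \<longleftrightarrow>
    (\<exists>P0 r. finite P0 \<and> P0 \<subseteq> P \<and> 0 < r \<and> {g \<in> V. \<forall>p\<in>P0. p (\<lambda>t. g t - f t) < r} \<subseteq> U)" for U f
  have NI: "N U f" if "finite P0" "P0 \<subseteq> P" "0 < r" "{g \<in> V. \<forall>p\<in>P0. p (\<lambda>t. g t - f t) < r} \<subseteq> U" for U f P0 r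
    unfolding N_def by (intro exI conjI) (fact that)+
  have "\<forall>f\<in>U. N U f"
    using U(1) unfolding seminorm_topology_def openin_topology_generated_by_iff
  proof (induction rule: generate_topology_on.induct)
    case Empty
    then show ?case by simp
  next
    case (Int A B)
    show ?case
    proof
      fix f assume "f \<in> A \<inter> B"
      then have N: "N A f" "N B f" using Int.IH by auto
      obtain P1 r1 where 1: "finite P1" "P1 \<subseteq> P" "0 < r1" "{g \<in> V. \<forall>p\<in>P1. p (\<lambda>t. g t - f t) < r1} \<subseteq> A"
        using N(1) unfolding N_def by (elim exE conjE)
      obtain P2 r2 where 2: "finite P2" "P2 \<subseteq> P" "0 < r2" "{g \<in> V. \<forall>p\<in>P2. p (\<lambda>t. g t - f t) < r2} \<subseteq> B"
        using N(2) unfolding N_def by (elim exE conjE)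
      have "{g \<in> V. \<forall>p\<in>P1 \<union> P2. p (\<lambda>t. g t - f t) < min r1 r2} \<subseteq> A \<inter> B"
        using 1(4) 2(4) by auto
      then show "N (A \<inter> B) f"
        using 1 2 by (intro NI[of "P1 \<union> P2" "min r1 r2"]) simp_all
    qed
  next
    case (UN K)
    show ?case
    proof
      fix f assume "f \<in> \<Union>K"
      then obtain k where k: "k \<in> K" "f \<in> k" by blast
      obtain P0 r where P0: "finite P0" "P0 \<subseteq> P" "0 < r" "{g \<in> V. \<forall>p\<in>P0. p (\<lambda>t. g t - f t) < r} \<subseteq> k"
        using bspec[OF UN.IH[OF k(1)] k(2)] unfolding N_def by (elim exE conjE)
      show "N (\<Union>K) f"
        by (rule NI[OF P0(1-3) order_trans[OF P0(4)]]) (use k in blast)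
    qed
  next
    case (Basis s)
    then obtain p f0 e where s: "s = {g \<in> V. p (\<lambda>t. g t - f0 t) < e}" "p \<in> P" "f0 \<in> V" "0 < e"
      by blast
    show ?case
    proof
      fix f assume f: "f \<in> s"
      have "{g \<in> V. \<forall>q\<in>{p}. q (\<lambda>t. g t - f t) < e - p (\<lambda>t. f t - f0 t)} \<subseteq> s"
      proof
        fix g assume g: "g \<in> {g \<in> V. \<forall>q\<in>{p}. q (\<lambda>t. g t - f t) < e - p (\<lambda>t. f t - f0 t)}"
        have "p (\<lambda>t. g t - f0 t) \<le> p (\<lambda>t. g t - f t) + p (\<lambda>t. f t - f0 t)"
          using g f s(1) by (intro seminorm_on_triangle[OF V P[OF s(2)] s(3)]) auto
        then show "g \<in> s" using g s(1) by auto
      qed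
      then show "N s f"
        using f s by (intro NI[of "{p}" "e - p (\<lambda>t. f t - f0 t)"]) simp_all
    qed
  qed
  then have "N U f" using U(2) by blast
  then show ?thesis unfolding N_def using that by (elim exE conjE)
qed

lemma openin_seminorm_finite_ball:
  assumes V: "subspace_fun V" and P: "\<And>p. p \<in> P \<Longrightarrow> seminorm_on V p" and "P \<noteq> {}"
    and "finite P0" "P0 \<subseteq> P" "0 < r" "f \<in> V"
  shows "openin (seminorm_topology V P) {g \<in> V. \<forall>p\<in>P0. p (\<lambda>t. g t - f t) < r}"
proof -
  have "{g \<in> V. \<forall>p\<in>P0. p (\<lambda>t. g t - f t) < r} = V \<inter> (\<Inter>p\<in>P0. {g \<in> V. p (\<lambda>t. g t - f t) < r})"
    by auto
  moreover have "openin (seminorm_topology V P) V"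
    using topspace_seminorm_topology[OF assms(3) V P] openin_topspace[of "seminorm_topology V P"] by simp
  moreover have "openin (seminorm_topology V P) (\<Inter>p\<in>P0. {g \<in> V. p (\<lambda>t. g t - f t) < r})" if "P0 \<noteq> {}"
    using assms that by (intro openin_INT2) (auto intro!: openin_seminorm_ball)
  ultimately show ?thesis by (cases "P0 = {}") (simp_all add: openin_Int)
qed

text \<open>
  Bounds by finite sums, rather than by single seminorms, are what the elliptic estimate provides.
\<close>

lemma seminorm_topology_coarser:
  assumes V: "subspace_fun V" and P: "\<And>p. p \<in> P \<Longrightarrow> seminorm_on V p" and Q: "\<And>q. q \<in> Q \<Longrightarrow> seminorm_on V q"
    and "Q \<noteq> {}"
    and dom: "\<And>p. p \<in> P \<Longrightarrow> \<exists>Q0 C. finite Q0 \<and> Q0 \<subseteq> Q \<and> (\<forall>f\<in>V. p f \<le> C * (\<Sum>q\<in>Q0. q f))"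
    and U: "openin (seminorm_topology V P) U"
  shows "openin (seminorm_topology V Q) U"
proof (subst openin_subopen, intro ballI)
  fix f assume f: "f \<in> U"
  have UV: "U \<subseteq> V"
    using openin_subset[OF U] unfolding seminorm_topology_def by auto
  have fV: "f \<in> V" using f UV by auto
  obtain P0 r where P0: "finite P0" "P0 \<subseteq> P" "0 < r" "{g \<in> V. \<forall>p\<in>P0. p (\<lambda>t. g t - f t) < r} \<subseteq> U"
    using openin_seminorm_topology_nhd[OF V P U f] by blast
  obtain QQ C where QC: "\<And>p. p \<in> P \<Longrightarrow> finite (QQ p) \<and> QQ p \<subseteq> Q \<and> (\<forall>f\<in>V. p f \<le> C p * (\<Sum>q\<in>QQ p. q f))"
  proof -
    have "\<forall>p\<in>P. \<exists>z. finite (fst z) \<and> fst z \<subseteq> Q \<and> (\<forall>f\<in>V. p f \<le> snd z * (\<Sum>q\<in>fst z. q f))"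
      using dom by simp
    from bchoice[OF this] obtain z where
      z: "\<forall>p\<in>P. finite (fst (z p)) \<and> fst (z p) \<subseteq> Q \<and> (\<forall>f\<in>V. p f \<le> snd (z p) * (\<Sum>q\<in>fst (z p). q f))" ..
    then show ?thesis using that[of "\<lambda>p. fst (z p)" "\<lambda>p. snd (z p)"] by simp
  qed
  define W where "W p = {g \<in> V. \<forall>q\<in>QQ p. q (\<lambda>t. g t - f t) < r / (\<bar>C p\<bar> * card (QQ p) + 1)}" for p
  have W: "openin (seminorm_topology V Q) (W p)" if "p \<in> P0" for p
  proof -
    have "p \<in> P" using that P0(2) by blast
    then show ?thesis
      unfolding W_def using QC P0(3)
      by (intro openin_seminorm_finite_ball[OF V Q \<open>Q \<noteq> {}\<close> _ _ _ fV])
        (auto intro!: divide_pos_pos add_nonneg_pos)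
  qed
  have fW: "f \<in> W p" if "p \<in> P0" for p
  proof -
    have "q (\<lambda>t. f t - f t) < r / (\<bar>C p\<bar> * card (QQ p) + 1)" if "q \<in> QQ p" for q
    proof -
      have "q (\<lambda>t. f t - f t) = 0"
        using seminorm_on_0[OF V Q, of q] that \<open>p \<in> P0\<close> P0(2) QC by auto
      then show ?thesis using P0(3) by (auto intro!: divide_pos_pos add_nonneg_pos)
    qed
    then show ?thesis unfolding W_def using fV by blast
  qed
  have Wp: "p (\<lambda>t. g t - f t) < r" if "g \<in> W p" "p \<in> P0" for g p
  proof -
    define d where "d = r / (\<bar>C p\<bar> * card (QQ p) + 1)"
    have d: "0 < d" unfolding d_def using P0(3) by (auto intro!: divide_pos_pos add_nonneg_pos)
    have gV: "(\<lambda>t. g t - f t) \<in> V" using that(1) fV subspace_fun_diff[OF V] unfolding W_def by auto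
    have s0: "0 \<le> (\<Sum>q\<in>QQ p. q (\<lambda>t. g t - f t))"
    proof (rule sum_nonneg)
      fix q assume "q \<in> QQ p"
      then have "q \<in> Q" using QC that(2) P0(2) by blast
      then show "0 \<le> q (\<lambda>t. g t - f t)" by (rule seminorm_on_nonneg[OF V Q gV])
    qed
    have "(\<Sum>q\<in>QQ p. q (\<lambda>t. g t - f t)) \<le> (\<Sum>q\<in>QQ p. d)"
      using that(1) unfolding W_def d_def by (intro sum_mono) auto
    then have s1: "(\<Sum>q\<in>QQ p. q (\<lambda>t. g t - f t)) \<le> card (QQ p) * d" by simp
    have "p (\<lambda>t. g t - f t) \<le> C p * (\<Sum>q\<in>QQ p. q (\<lambda>t. g t - f t))"
      using QC that(2) P0(2) gV by blast
    also have "\<dots> \<le> \<bar>C p\<bar> * (\<Sum>q\<in>QQ p. q (\<lambda>t. g t - f t))"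
      using s0 by (intro mult_right_mono) auto
    also have "\<dots> \<le> \<bar>C p\<bar> * (card (QQ p) * d)"
      using s1 by (intro mult_left_mono) auto
    also have "\<dots> < (\<bar>C p\<bar> * card (QQ p) + 1) * d" using d by (simp add: algebra_simps)
    also have "\<dots> = r"
    proof -
      have "\<bar>C p\<bar> * card (QQ p) + 1 \<noteq> 0"
        by (smt (verit) mult_nonneg_nonneg of_nat_0_le_iff)
      then show ?thesis unfolding d_def by simp
    qed
    finally show ?thesis .
  qed
  show "\<exists>S. openin (seminorm_topology V Q) S \<and> f \<in> S \<and> S \<subseteq> U"
  proof (cases "P0 = {}")
    case True
    then have "V \<subseteq> U" using P0(4) by auto
    then have "openin (seminorm_topology V Q) U"
      using topspace_seminorm_topology[OF \<open>Q \<noteq> {}\<close> V Q] openin_topspace[of "seminorm_topology V Q"] UV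
      by simp
    then show ?thesis using f by blast
  next
    case False
    then have "openin (seminorm_topology V Q) (\<Inter>p\<in>P0. W p)"
      using W P0(1) by (intro openin_INT2) auto
    moreover have "(\<Inter>p\<in>P0. W p) \<subseteq> U"
    proof
      fix g assume g: "g \<in> (\<Inter>p\<in>P0. W p)"
      then have "g \<in> V" using False unfolding W_def by blast
      moreover have "\<forall>p\<in>P0. p (\<lambda>t. g t - f t) < r" using g Wp by blast
      ultimately show "g \<in> U" using P0(4) by blast
    qed
    moreover have "f \<in> (\<Inter>p\<in>P0. W p)" using fW by simp
    ultimately show ?thesis by (intro exI conjI)
  qed
qed

lemma seminorm_topology_eqI:
  assumes V: "subspace_fun V" and P: "\<And>p. p \<in> P \<Longrightarrow> seminorm_on V p" and Q: "\<And>q. q \<in> Q \<Longrightarrow> seminorm_on V q"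
    and "P \<noteq> {}" "Q \<noteq> {}"
    and "\<And>p. p \<in> P \<Longrightarrow> \<exists>Q0 C. finite Q0 \<and> Q0 \<subseteq> Q \<and> (\<forall>f\<in>V. p f \<le> C * (\<Sum>q\<in>Q0. q f))"
    and "\<And>q. q \<in> Q \<Longrightarrow> \<exists>P0 C. finite P0 \<and> P0 \<subseteq> P \<and> (\<forall>f\<in>V. q f \<le> C * (\<Sum>p\<in>P0. p f))"
  shows "seminorm_topology V P = seminorm_topology V Q"
  unfolding topology_eq
proof (intro allI iffI)
  fix U
  show "openin (seminorm_topology V Q) U" if "openin (seminorm_topology V P) U"
    using seminorm_topology_coarser[OF V P Q \<open>Q \<noteq> {}\<close> assms(6) that] .
  show "openin (seminorm_topology V P) U" if "openin (seminorm_topology V Q) U"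
    using seminorm_topology_coarser[OF V Q P \<open>P \<noteq> {}\<close> assms(7) that] .
qed

section \<open>Iterated partial derivatives\<close>

type_synonym 'n cfun = "(real, 'n) vec \<Rightarrow> complex"
type_synonym 'n functional = "'n cfun \<Rightarrow> complex"

text \<open>
  Words in the coordinates are used in place of multi-indices: they make the induction over the order structural.
  The two are related by \<open>mpartial_ders\<close> and \<open>ders_mpartial\<close>.
\<close>

abbreviation ders :: "'n list \<Rightarrow> 'n cfun \<Rightarrow> 'n::finite cfun" where
  "ders is f \<equiv> foldr partial is f"

lemma partial_eqI:
  assumes "(f has_derivative f') (at x)"
  shows "partial i f x = f' (axis i 1)"
proof -
  have 1: "((\<lambda>t::real. x + t *\<^sub>R axis i 1) has_derivative (\<lambda>t. t *\<^sub>R axis i 1)) (at 0)"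
    by (auto intro!: derivative_eq_intros)
  have 2: "(f has_derivative f') (at (x + 0 *\<^sub>R axis i 1))" using assms by simp
  have "((\<lambda>t. f (x + t *\<^sub>R axis i 1)) has_derivative (\<lambda>t. f' (t *\<^sub>R axis i 1))) (at 0)"
    by (rule has_derivative_compose[OF 1 2])
  moreover have "(\<lambda>t. f' (t *\<^sub>R axis i 1)) = (\<lambda>t. t *\<^sub>R f' (axis i 1))"
    using has_derivative_bounded_linear[OF assms] by (simp add: linear_simps)
  ultimately show ?thesis
    unfolding partial_def by (intro vector_derivative_at) (simp add: has_vector_derivative_def)
qed

lemma has_derivative_partial:
  assumes "f differentiable (at x)"
  shows "(f has_derivative (\<lambda>h. \<Sum>i\<in>UNIV. (h $ i) *\<^sub>R partial i f x)) (at x)"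
proof -
  obtain f' where f': "(f has_derivative f') (at x)" using assms unfolding differentiable_def by blast
  have lin: "linear f'" using has_derivative_bounded_linear[OF f'] bounded_linear.linear by blast
  have "f' h = (\<Sum>i\<in>UNIV. (h $ i) *\<^sub>R partial i f x)" for h
  proof -
    have "h = (\<Sum>i\<in>UNIV. (h $ i) *\<^sub>R axis i 1)"
      using basis_expansion[of h] by (simp add: scalar_mult_eq_scaleR)
    then have "f' h = f' (\<Sum>i\<in>UNIV. (h $ i) *\<^sub>R axis i 1)" by simp
    also have "\<dots> = (\<Sum>i\<in>UNIV. (h $ i) *\<^sub>R partial i f x)"
      by (simp add: linear_sum[OF lin] linear_scale[OF lin] partial_eqI[OF f'])
    finally show ?thesis .
  qed
  then have "f' = (\<lambda>h. \<Sum>i\<in>UNIV. (h $ i) *\<^sub>R partial i f x)" by blast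
  then show ?thesis using f' by simp
qed

lemma line_derivative:
  assumes "f differentiable (at (x + t *\<^sub>R h))"
  shows "((\<lambda>t. f (x + t *\<^sub>R h)) has_vector_derivative (\<Sum>i\<in>UNIV. (h $ i) *\<^sub>R partial i f (x + t *\<^sub>R h))) (at t)"
proof -
  have 1: "((\<lambda>t::real. x + t *\<^sub>R h) has_derivative (\<lambda>t. t *\<^sub>R h)) (at t)"
    by (auto intro!: derivative_eq_intros)
  show ?thesis
    using has_derivative_compose[OF 1 has_derivative_partial[OF assms]]
    by (simp add: has_vector_derivative_def scaleR_sum_right mult.commute)
qed

lemma axis_line_derivative:
  assumes "f differentiable (at (x + t *\<^sub>R axis i 1))"
  shows "((\<lambda>t. f (x + t *\<^sub>R axis i 1)) has_vector_derivative partial i f (x + t *\<^sub>R axis i 1)) (at t)"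
proof -
  have "(\<Sum>j\<in>UNIV. (axis i 1 $ j) *\<^sub>R partial j f (x + t *\<^sub>R axis i 1)) = partial i f (x + t *\<^sub>R axis i 1)"
    by (subst sum.remove[of _ i]) (auto simp: axis_def intro!: sum.neutral)
  then show ?thesis using line_derivative[OF assms] by simp
qed

lemma smooth_differentiable: "smooth f \<Longrightarrow> f differentiable (at x)"
  unfolding smooth_def
  by (drule spec[of _ "[]"]) (simp add: differentiable_on_def)

lemma smooth_partial: "smooth f \<Longrightarrow> smooth (partial i f)"
proof (unfold smooth_def, intro allI)
  fix "is" assume "\<forall>is. ders is f differentiable_on UNIV"
  then have "ders (is @ [i]) f differentiable_on UNIV" by blast
  then show "ders is (partial i f) differentiable_on UNIV" by simp
qed

lemma smooth_ders: "smooth f \<Longrightarrow> smooth (ders is f)"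
  by (induction "is") (auto intro: smooth_partial)

lemma smooth_continuous: "smooth f \<Longrightarrow> continuous_on UNIV f"
  by (metis smooth_differentiable differentiable_at_imp_differentiable_on differentiable_imp_continuous_on)

lemma smooth_borel: "smooth f \<Longrightarrow> f \<in> borel_measurable borel"
  by (rule borel_measurable_continuous_onI[OF smooth_continuous])

lemma smooth_has_derivative:
  "smooth f \<Longrightarrow> (f has_derivative (\<lambda>h. \<Sum>i\<in>UNIV. (h $ i) *\<^sub>R partial i f x)) (at x)"
  by (rule has_derivative_partial[OF smooth_differentiable])

text \<open>
  Smoothness as a greatest fixed point.
\<close>

lemma smooth_coinduct:
  assumes "f \<in> S" and "\<And>f x. f \<in> S \<Longrightarrow> f differentiable (at x)" and "\<And>f i. f \<in> S \<Longrightarrow> partial i f \<in> S"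
  shows "smooth f"
proof -
  have "ders is f \<in> S" for "is" by (induction "is") (use assms in auto)
  then show ?thesis
    unfolding smooth_def using assms(2) by (auto intro!: differentiable_at_imp_differentiable_on)
qed

lemma partial_add:
  assumes "f differentiable (at x)" "g differentiable (at x)"
  shows "partial i (\<lambda>x. f x + g x) x = partial i f x + partial i g x"
proof -
  have "((\<lambda>x. f x + g x) has_derivative (\<lambda>h. (\<Sum>i\<in>UNIV. (h $ i) *\<^sub>R partial i f x) + (\<Sum>i\<in>UNIV. (h $ i) *\<^sub>R partial i g x))) (at x)"
    by (intro has_derivative_add has_derivative_partial assms)
  from partial_eqI[OF this] partial_eqI[OF has_derivative_partial[OF assms(1)]] partial_eqI[OF has_derivative_partial[OF assms(2)]]
  show ?thesis by metis
qed

lemma partial_mult: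
  assumes "f differentiable (at x)" "g differentiable (at x)"
  shows "partial i (\<lambda>x. f x * g x) x = partial i f x * g x + f x * partial i g x"
proof -
  have "((\<lambda>x. f x * g x) has_derivative (\<lambda>h. f x * (\<Sum>i\<in>UNIV. (h $ i) *\<^sub>R partial i g x) + (\<Sum>i\<in>UNIV. (h $ i) *\<^sub>R partial i f x) * g x)) (at x)"
    by (intro has_derivative_mult has_derivative_partial assms)
  from partial_eqI[OF this] partial_eqI[OF has_derivative_partial[OF assms(1)]] partial_eqI[OF has_derivative_partial[OF assms(2)]]
  show ?thesis by (metis add.commute)
qed

lemma partial_const [simp]: "partial i (\<lambda>x. c) = (\<lambda>x. 0)"
  by (rule ext, rule partial_eqI) (rule has_derivative_const)

text \<open>
  The algebra generated by a set of functions. It is stable under \<open>partial\<close> as soon as the derivatives of the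
  generators lie in it, so that sums and products need no separate treatment in a coinductive proof of smoothness.
\<close>

inductive_set alg :: "'n::finite cfun set \<Rightarrow> 'n cfun set" for S where
  alg_base: "f \<in> S \<Longrightarrow> f \<in> alg S"
| alg_const: "(\<lambda>x. c) \<in> alg S"
| alg_add: "f \<in> alg S \<Longrightarrow> g \<in> alg S \<Longrightarrow> (\<lambda>x. f x + g x) \<in> alg S"
| alg_mult: "f \<in> alg S \<Longrightarrow> g \<in> alg S \<Longrightarrow> (\<lambda>x. f x * g x) \<in> alg S"

lemma smooth_alg:
  fixes S :: "'n::finite cfun set"
  assumes diff: "\<And>f x. f \<in> S \<Longrightarrow> f differentiable (at x)" and part: "\<And>f i. f \<in> S \<Longrightarrow> partial i f \<in> alg S"
    and f: "f \<in> alg S"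
  shows "smooth f"
proof -
  have *: "(\<forall>x. f differentiable (at x)) \<and> (\<forall>i. partial i f \<in> alg S)" if "f \<in> alg S" for f
    using that
  proof induction
    case (alg_base f)
    then show ?case using diff part by blast
  next
    case (alg_const c)
    then show ?case by (simp add: alg.alg_const)
  next
    case (alg_add f g)
    then have "partial i (\<lambda>x. f x + g x) = (\<lambda>x. partial i f x + partial i g x)" for i
      by (intro ext partial_add) auto
    then show ?case using alg_add by (simp add: alg.alg_add)
  next
    case (alg_mult f g)
    then have "partial i (\<lambda>x. f x * g x) = (\<lambda>x. partial i f x * g x + f x * partial i g x)" for i
      by (intro ext partial_mult) auto
    then show ?case using alg_mult by (simp add: alg.alg_add alg.alg_mult)
  qed
  show ?thesis by (rule smooth_coinduct[OF f]) (use * in auto)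
qed

lemma alg_smooth: "f \<in> alg {f. smooth f} \<Longrightarrow> smooth f"
  by (erule smooth_alg[rotated 2]) (auto intro: smooth_differentiable alg_base smooth_partial)

lemma smooth_const: "smooth (\<lambda>x. c)"
  by (rule alg_smooth) (rule alg_const)

lemma smooth_add: "smooth f \<Longrightarrow> smooth g \<Longrightarrow> smooth (\<lambda>x. f x + g x)"
  by (rule alg_smooth) (auto intro: alg_add alg_base)

lemma smooth_mult: "smooth f \<Longrightarrow> smooth g \<Longrightarrow> smooth (\<lambda>x. f x * g x)"
  by (rule alg_smooth) (auto intro: alg_mult alg_base)

lemma smooth_diff: "smooth f \<Longrightarrow> smooth g \<Longrightarrow> smooth (\<lambda>x. f x - g x)"
  using smooth_add[OF _ smooth_mult[OF smooth_const[of "-1"]], of f g] by simp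

lemma partial_sum:
  assumes "finite I" "\<And>k. k \<in> I \<Longrightarrow> smooth (f k)"
  shows "smooth (\<lambda>x. \<Sum>k\<in>I. f k x) \<and> partial i (\<lambda>x. \<Sum>k\<in>I. f k x) = (\<lambda>x. \<Sum>k\<in>I. partial i (f k) x)"
  using assms
proof (induction I rule: finite_induct)
  case (insert k I)
  then show ?case
    using partial_add[of "f k" _ "\<lambda>x. \<Sum>k\<in>I. f k x" i] smooth_differentiable
    by (auto simp: smooth_add fun_eq_iff)
qed (auto simp: smooth_const)

lemma ders_lincomb:
  assumes "smooth f" "smooth g"
  shows "ders is (\<lambda>x. a * f x + b * g x) = (\<lambda>x. a * ders is f x + b * ders is g x)"
proof (induction "is")
  case (Cons i "is")
  have d: "ders is f differentiable (at x)" "ders is g differentiable (at x)"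
    "(\<lambda>x. a * ders is f x) differentiable (at x)" "(\<lambda>x. b * ders is g x) differentiable (at x)" for x
    using assms by (auto intro!: smooth_differentiable smooth_ders smooth_mult smooth_const)
  show ?case
    by (rule ext, simp add: Cons partial_add[OF d(3,4)])
      (simp add: partial_mult[OF _ d(1), of "\<lambda>x. a"] partial_mult[OF _ d(2), of "\<lambda>x. b"])
qed simp

lemma ders_add: "smooth f \<Longrightarrow> smooth g \<Longrightarrow> ders is (\<lambda>x. f x + g x) = (\<lambda>x. ders is f x + ders is g x)"
  using ders_lincomb[of f g "is" 1 1] by simp

lemma ders_diff: "smooth f \<Longrightarrow> smooth g \<Longrightarrow> ders is (\<lambda>x. f x - g x) = (\<lambda>x. ders is f x - ders is g x)"
  using ders_lincomb[of f g "is" 1 "-1"] by simp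

lemma ders_scale: "smooth f \<Longrightarrow> ders is (\<lambda>x. c * f x) = (\<lambda>x. c * ders is f x)"
  using ders_lincomb[of f f "is" c 0] by simp

text \<open>
  Differentiate \<open>f (y + t e\<^sub>j) - f y = \<integral>\<^sub>0\<^sup>t \<partial>\<^sub>j f (y + u e\<^sub>j) du\<close> in direction \<open>e\<^sub>i\<close> under the integral, and then
  in \<open>t\<close> at \<open>0\<close>.
\<close>

lemma partial_commute:
  fixes f :: "'n::finite cfun"
  assumes f: "smooth f"
  shows "partial i (partial j f) = partial j (partial i f)"
proof
  fix x
  define a b where "a = (axis i 1 :: real ^ 'n)" and "b = (axis j 1 :: real ^ 'n)"
  define B where "B u = partial i (partial j f) (x + u *\<^sub>R b)" for u
  have diff: "ders is f differentiable (at x)" for "is" x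
    by (rule smooth_differentiable[OF smooth_ders[OF f]])
  have cont: "continuous_on UNIV (ders is f)" for "is"
    by (rule smooth_continuous[OF smooth_ders[OF f]])
  have contB: "continuous_on UNIV B"
    unfolding B_def by (rule continuous_on_compose2[OF cont[of "[i, j]", simplified]]) (auto intro!: continuous_intros)
  have key: "integral {0..t} B = partial i f (x + t *\<^sub>R b) - partial i f x" if t: "0 \<le> t" for t
  proof -
    have ftc: "((\<lambda>u. partial j f (x + s *\<^sub>R a + u *\<^sub>R b)) has_integral f (x + s *\<^sub>R a + t *\<^sub>R b) - f (x + s *\<^sub>R a)) {0..t}" for s
      using fundamental_theorem_of_calculus[OF t, of "\<lambda>u. f (x + s *\<^sub>R a + u *\<^sub>R b)"]
        has_vector_derivative_at_within[OF axis_line_derivative[OF diff[of "[]", simplified], where x = "x + s *\<^sub>R a" and i = j]]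
      by (simp add: b_def)
    have "((\<lambda>s. integral (cbox 0 t) (\<lambda>u. partial j f (x + s *\<^sub>R a + u *\<^sub>R b))) has_vector_derivative
        integral (cbox 0 t) (\<lambda>u. partial i (partial j f) (x + 0 *\<^sub>R a + u *\<^sub>R b))) (at 0 within UNIV)"
    proof (rule leibniz_rule_vector_derivative)
      fix s u :: real
      have "((\<lambda>s. partial j f (x + u *\<^sub>R b + s *\<^sub>R a)) has_vector_derivative partial i (partial j f) (x + u *\<^sub>R b + s *\<^sub>R a)) (at s)"
        unfolding a_def by (rule axis_line_derivative) (use diff[of "[j]"] in simp)
      then show "((\<lambda>s. partial j f (x + s *\<^sub>R a + u *\<^sub>R b)) has_vector_derivative partial i (partial j f) (x + s *\<^sub>R a + u *\<^sub>R b)) (at s)"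
        by (simp add: algebra_simps)
    next
      fix s :: real
      show "(\<lambda>u. partial j f (x + s *\<^sub>R a + u *\<^sub>R b)) integrable_on cbox 0 t"
        using ftc[of s] by (auto simp: integrable_on_def)
    next
      show "continuous_on (UNIV \<times> cbox 0 t) (\<lambda>(s, u). partial i (partial j f) (x + s *\<^sub>R a + u *\<^sub>R b))"
        unfolding split_beta
        by (rule continuous_on_compose2[OF cont[of "[i, j]", simplified]]) (auto intro!: continuous_intros)
    qed auto
    then have d1: "((\<lambda>s. f (x + s *\<^sub>R a + t *\<^sub>R b) - f (x + s *\<^sub>R a)) has_vector_derivative integral {0..t} B) (at 0)"
      using integral_unique[OF ftc] by (simp add: B_def[abs_def])
    have d2: "((\<lambda>s. f (x + t *\<^sub>R b + s *\<^sub>R a) - f (x + s *\<^sub>R a)) has_vector_derivative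
        partial i f (x + t *\<^sub>R b + 0 *\<^sub>R a) - partial i f (x + 0 *\<^sub>R a)) (at 0)"
      unfolding a_def
      by (intro has_vector_derivative_diff axis_line_derivative) (use diff[of "[]"] in simp_all)
    have e: "(\<lambda>s. f (x + t *\<^sub>R b + s *\<^sub>R a) - f (x + s *\<^sub>R a)) = (\<lambda>s. f (x + s *\<^sub>R a + t *\<^sub>R b) - f (x + s *\<^sub>R a))"
      by (simp add: add_ac)
    show ?thesis using vector_derivative_unique_at[OF d1 d2[unfolded e]] by simp
  qed
  have "((\<lambda>t. integral {0..t} B) has_vector_derivative B 0) (at 0 within {0..1})"
    by (rule integral_has_vector_derivative) (use contB continuous_on_subset in auto)
  then have "((\<lambda>t. partial i f (x + t *\<^sub>R b) - partial i f x) has_vector_derivative B 0) (at 0 within {0..1})"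
    by (rule has_vector_derivative_transform[rotated 2]) (auto simp: key)
  moreover have "((\<lambda>t. partial i f (x + t *\<^sub>R b) - partial i f x) has_vector_derivative partial j (partial i f) (x + 0 *\<^sub>R b) - 0) (at 0 within {0..1})"
    unfolding b_def
    by (intro has_vector_derivative_diff has_vector_derivative_at_within[OF axis_line_derivative]) (use diff[of "[i]"] in simp_all)
  ultimately have "B 0 = partial j (partial i f) (x + 0 *\<^sub>R b) - 0"
    by (intro vector_derivative_unique_within_closed_interval[of 0 1 0 "\<lambda>t. partial i f (x + t *\<^sub>R b) - partial i f x"]) auto
  then show "partial i (partial j f) x = partial j (partial i f) x"
    by (simp add: B_def)
qed

lemma partial_ders_commute: "smooth f \<Longrightarrow> partial i (ders is f) = ders is (partial i f)"
  by (induction "is") (auto simp: partial_commute[OF smooth_ders])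

text \<open>
  By symmetry of second derivatives only the multiplicities of the letters matter.
\<close>

lemma ders_permute:
  assumes "smooth f" "mset is = mset js"
  shows "ders is f = ders js f"
  using assms(2)
proof (induction "is" arbitrary: js)
  case (Cons i "is")
  have "i \<in> set js" using Cons.prems by (metis list.set_intros(1) set_mset_mset)
  then obtain as bs where js: "js = as @ i # bs" by (meson split_list)
  have "ders js f = partial i (ders (as @ bs) f)"
    unfolding js using partial_ders_commute[OF smooth_ders[OF assms(1)], of i as bs] by simp
  moreover have "ders is f = ders (as @ bs) f" using Cons js by (intro Cons.IH) auto
  ultimately show ?case by simp
qed simp

lemma mpartial_ders:
  fixes \<alpha> :: "'n::finite \<Rightarrow> nat"
  obtains "is" where "mpartial \<alpha> = ders is" "length is = (\<Sum>i\<in>UNIV. \<alpha> i)" "\<And>i. count (mset is) i = \<alpha> i"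
proof -
  obtain L where L: "L = (SOME is. distinct is \<and> set is = (UNIV :: 'n set))" by blast
  have dL: "distinct L \<and> set L = UNIV"
    unfolding L by (rule someI_ex) (metis finite_distinct_list finite)
  have fold: "foldr (\<lambda>i. partial i ^^ \<alpha> i) M f = ders (concat (map (\<lambda>i. replicate (\<alpha> i) i) M)) f" for M f
    by (induction M) auto
  have len: "length (concat (map (\<lambda>i. replicate (\<alpha> i) i) M)) = sum_list (map \<alpha> M)" for M
    by (induction M) auto
  have cnt: "count (mset (concat (map (\<lambda>i. replicate (\<alpha> i) i) M))) x = (if x \<in> set M then \<alpha> x else 0)" if "distinct M" for M x
    using that by (induction M) auto
  show ?thesis
    by (rule that[of "concat (map (\<lambda>i. replicate (\<alpha> i) i) L)"])
      (use dL in \<open>auto simp: mpartial_def L[symmetric] fold len sum_list_distinct_conv_sum_set cnt\<close>)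
qed

lemma ders_mpartial:
  fixes "is" :: "'n::finite list"
  obtains \<alpha> where "(\<Sum>i\<in>UNIV. \<alpha> i) = length is" "\<And>f. smooth f \<Longrightarrow> ders is f = mpartial \<alpha> f"
proof -
  obtain js where js: "mpartial (count (mset is)) = ders js"
     "\<And>i. count (mset js) i = count (mset is) i"
    using mpartial_ders[of "count (mset is)"] by metis
  have "mset is = mset js" using js(2) by (intro multiset_eqI) simp
  moreover have "(\<Sum>i\<in>UNIV. count (mset is) i) = length is"
    by (simp add: sum_count_set count_mset)
  ultimately show ?thesis using ders_permute[of _ "is" js] js(1) by (intro that[of "count (mset is)"]) simp_all
qed

section \<open>Leibniz rule, supports and affine substitutions\<close>

abbreviation words :: "nat \<Rightarrow> 'n::finite list set" where
  "words m \<equiv> {is. length is \<le> m}"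

lemma finite_words: "finite (words m :: 'n::finite list set)"
  using finite_lists_length_le[of "UNIV :: 'n set" m] by simp

lemma sum_ders_partial_le:
  fixes f :: "'n::finite cfun"
  shows "(\<Sum>is\<in>words m. norm (ders is (partial i f) x)) \<le> (\<Sum>is\<in>words (Suc m). norm (ders is f x))"
proof -
  have "(\<Sum>is\<in>words m. norm (ders is (partial i f) x)) = (\<Sum>is\<in>words m. norm (ders (is @ [i]) f x))"
    by simp
  also have "\<dots> = (\<Sum>js\<in>(\<lambda>is. is @ [i]) ` words m. norm (ders js f x))"
    by (subst sum.reindex) (auto simp: inj_on_def)
  also have "\<dots> \<le> (\<Sum>is\<in>words (Suc m). norm (ders is f x))"
    by (rule sum_mono2[OF finite_words]) auto
  finally show ?thesis .
qed

lemma sum_ders_mono: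
  fixes f :: "'n::finite cfun"
  shows "(\<Sum>is\<in>words m. norm (ders is f x)) \<le> (\<Sum>is\<in>words (Suc m). norm (ders is f x))"
  by (rule sum_mono2[OF finite_words]) auto

text \<open>
  A Leibniz rule without binomial coefficients: each differentiation replaces a product by two products, whence
  the factor \<open>2 ^ m\<close>.
\<close>

lemma norm_ders_mult_le:
  fixes f u :: "'n::finite cfun"
  assumes "smooth u" "smooth f" "\<And>js. js \<in> words m \<Longrightarrow> norm (ders js u x) \<le> A" "is \<in> words m"
  shows "norm (ders is (\<lambda>x. u x * f x) x) \<le> 2 ^ m * A * (\<Sum>js\<in>words m. norm (ders js f x))"
  using assms
proof (induction m arbitrary: u f "is")
  case 0
  then have "norm (u x) \<le> A" by (auto dest: 0(3)[of "[]"])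
  moreover have "words 0 = {[] :: 'n list}" by auto
  ultimately show ?case using 0 by (simp add: norm_mult mult_right_mono)
next
  case (Suc m)
  let ?S = "\<lambda>m f. \<Sum>js\<in>words m. norm (ders js f x)"
  have "norm (u x) \<le> A" using Suc.prems(3)[of "[]"] by simp
  then have A: "0 \<le> A" using norm_ge_zero[of "u x"] by linarith
  show ?case
  proof (cases "is" rule: rev_cases)
    case Nil
    have "norm (u x) \<le> A" using Suc.prems(3)[of "[]"] by simp
    moreover have "norm (f x) \<le> ?S (Suc m) f"
      using member_le_sum[of "[]" "words (Suc m)" "\<lambda>js. norm (ders js f x)"] by (simp add: finite_words)
    ultimately have "norm (u x) * norm (f x) \<le> A * ?S (Suc m) f"
      using A by (intro mult_mono) auto
    also have "\<dots> \<le> 2 ^ Suc m * (A * ?S (Suc m) f)"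
    proof -
      have "0 \<le> A * ?S (Suc m) f" using A by (intro mult_nonneg_nonneg sum_nonneg) auto
      moreover have "(1::real) \<le> 2 ^ Suc m" by (rule one_le_power) simp
      ultimately show ?thesis using mult_right_mono by fastforce
    qed
    finally show ?thesis using Nil by (simp add: norm_mult mult.assoc)
  next
    case (snoc js i)
    have js: "js \<in> words m" using Suc.prems(4) snoc by simp
    have "partial i (\<lambda>x. u x * f x) = (\<lambda>x. partial i u x * f x + u x * partial i f x)"
      by (intro ext partial_mult) (auto intro: smooth_differentiable Suc.prems)
    then have eq: "ders is (\<lambda>x. u x * f x) x = ders js (\<lambda>x. partial i u x * f x) x + ders js (\<lambda>x. u x * partial i f x) x"
      using snoc Suc.prems by (simp add: ders_add smooth_mult smooth_partial)
    have "norm (ders js (\<lambda>x. partial i u x * f x) x) \<le> 2 ^ m * A * ?S m f"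
    proof (rule Suc.IH[OF smooth_partial[OF Suc.prems(1)] Suc.prems(2) _ js])
      show "norm (ders ks (partial i u) x) \<le> A" if "ks \<in> words m" for ks
        using Suc.prems(3)[of "ks @ [i]"] that by simp
    qed
    also have "\<dots> \<le> 2 ^ m * A * ?S (Suc m) f"
      using A sum_ders_mono by (intro mult_left_mono) auto
    finally have 1: "norm (ders js (\<lambda>x. partial i u x * f x) x) \<le> 2 ^ m * A * ?S (Suc m) f" .
    have "norm (ders js (\<lambda>x. u x * partial i f x) x) \<le> 2 ^ m * A * ?S m (partial i f)"
    proof (rule Suc.IH[OF Suc.prems(1) smooth_partial[OF Suc.prems(2)] _ js])
      show "norm (ders ks u x) \<le> A" if "ks \<in> words m" for ks
        using Suc.prems(3)[of ks] that by simp
    qed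
    also have "\<dots> \<le> 2 ^ m * A * ?S (Suc m) f"
      using A sum_ders_partial_le by (intro mult_left_mono) auto
    finally have 2: "norm (ders js (\<lambda>x. u x * partial i f x) x) \<le> 2 ^ m * A * ?S (Suc m) f" .
    have "norm (ders is (\<lambda>x. u x * f x) x) \<le> 2 ^ m * A * ?S (Suc m) f + 2 ^ m * A * ?S (Suc m) f"
      unfolding eq using norm_triangle_ineq 1 2 by (rule order_trans[OF _ add_mono])
    then show ?thesis by (simp add: mult_ac)
  qed
qed

lemma ders_eq_0_on_open:
  assumes "open U" "\<And>x. x \<in> U \<Longrightarrow> f x = 0" "x \<in> U"
  shows "ders is f x = 0"
  using assms(3)
proof (induction "is" arbitrary: x)
  case (Cons i "is")
  have "((\<lambda>x. 0 :: complex) has_derivative (\<lambda>h. 0)) (at x)" by (rule has_derivative_const)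
  then have "(ders is f has_derivative (\<lambda>h. 0)) (at x)"
    by (rule has_derivative_transform_within_open[OF _ assms(1) Cons.prems]) (use Cons.IH in simp)
  from partial_eqI[OF this] show ?case by simp
qed (use assms in auto)

lemma fun_support_superset: "f x \<noteq> 0 \<Longrightarrow> x \<in> fun_support f"
  unfolding fun_support_def using closure_subset by fastforce

lemma ders_eq_0_off_support: "x \<notin> fun_support f \<Longrightarrow> ders is f x = 0"
proof (rule ders_eq_0_on_open[of "- fun_support f"])
  show "open (- fun_support f)" unfolding fun_support_def by (simp add: open_Compl)
qed (use fun_support_superset in blast)+

lemma fun_support_subset: "closed S \<Longrightarrow> (\<And>x. x \<notin> S \<Longrightarrow> f x = 0) \<Longrightarrow> fun_support f \<subseteq> S"
  unfolding fun_support_def by (rule closure_minimal) auto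

lemma smooth_affine:
  fixes f :: "'n::finite cfun"
  assumes "smooth f"
  shows "smooth (\<lambda>x. f (a + c *\<^sub>R x))"
    and "ders is (\<lambda>x. f (a + c *\<^sub>R x)) = (\<lambda>x. of_real (c ^ length is) * ders is f (a + c *\<^sub>R x))"
proof -
  have d: "((\<lambda>x. k * g (a + c *\<^sub>R x)) has_derivative (\<lambda>h. k * (\<Sum>i\<in>UNIV. ((c *\<^sub>R h) $ i) *\<^sub>R partial i g (a + c *\<^sub>R x)))) (at x)"
    if "smooth g" for g k x
  proof -
    have "((\<lambda>x. a + c *\<^sub>R x) has_derivative (\<lambda>h. c *\<^sub>R h)) (at x)"
      by (auto intro!: derivative_eq_intros)
    from has_derivative_compose[OF this smooth_has_derivative[OF that]]
    show ?thesis by (rule has_derivative_mult_right)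
  qed
  have p: "partial i (\<lambda>x. k * g (a + c *\<^sub>R x)) = (\<lambda>x. of_real c * k * partial i g (a + c *\<^sub>R x))" if "smooth g" for g k i
  proof
    fix x
    have "(\<Sum>j\<in>UNIV. ((c *\<^sub>R axis i 1) $ j) *\<^sub>R partial j g (a + c *\<^sub>R x)) = c *\<^sub>R partial i g (a + c *\<^sub>R x)"
      by (subst sum.remove[of _ i]) (auto simp: axis_def intro!: sum.neutral)
    then show "partial i (\<lambda>x. k * g (a + c *\<^sub>R x)) x = of_real c * k * partial i g (a + c *\<^sub>R x)"
      using partial_eqI[OF d[OF that, of k x], of i] by (simp add: scaleR_conv_of_real)
  qed
  show "smooth (\<lambda>x. f (a + c *\<^sub>R x))"
  proof (rule smooth_coinduct[of _ "{\<lambda>x. k * g (a + c *\<^sub>R x) | k g. smooth g}"])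
    show "(\<lambda>x. f (a + c *\<^sub>R x)) \<in> {\<lambda>x. k * g (a + c *\<^sub>R x) | k g. smooth g}"
      using assms by (auto intro!: exI[of _ 1] exI[of _ f])
    show "h differentiable (at x)" if "h \<in> {\<lambda>x. k * g (a + c *\<^sub>R x) | k g. smooth g}" for h x
      using that d differentiableI by blast
    show "partial i h \<in> {\<lambda>x. k * g (a + c *\<^sub>R x) | k g. smooth g}" if hS: "h \<in> {\<lambda>x. k * g (a + c *\<^sub>R x) | k g. smooth g}" for h i
    proof -
      obtain k g where h: "h = (\<lambda>x. k * g (a + c *\<^sub>R x))" "smooth g" using hS by blast
      show ?thesis unfolding h(1) p[OF h(2)] using smooth_partial[OF h(2)] by blast
    qed
  qed
  show "ders is (\<lambda>x. f (a + c *\<^sub>R x)) = (\<lambda>x. of_real (c ^ length is) * ders is f (a + c *\<^sub>R x))"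
    by (induction "is") (simp_all add: p[OF smooth_ders[OF assms]])
qed

section \<open>Smooth cutoff functions\<close>

lemma power_div_fact_le_exp:
  fixes y :: real
  assumes "0 \<le> y"
  shows "y ^ n / fact n \<le> exp y"
proof -
  have "(\<Sum>k\<in>{n}. y ^ k /\<^sub>R fact k) \<le> (\<Sum>k. y ^ k /\<^sub>R fact k)"
    by (rule sum_le_suminf[OF summable_exp_generic]) (use assms in auto)
  then show ?thesis by (simp add: exp_def divide_inverse mult.commute)
qed

text \<open>
  The powers are included because the linear span of these functions is stable under differentiation.
\<close>

definition flat :: "nat \<Rightarrow> real \<Rightarrow> real" where
  "flat k t = (if t \<le> 0 then 0 else inverse t ^ k * exp (- inverse t))"

lemma flat_nonneg: "0 \<le> flat k t"
  unfolding flat_def by simp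

text \<open>
  A quadratic bound makes the derivative at \<open>0\<close> vanish.
\<close>

lemma flat_bound: "\<bar>flat k t\<bar> \<le> fact (k + 2) * t\<^sup>2"
proof (cases "t \<le> 0")
  case False
  define y where "y = inverse t"
  have y: "0 < y" "t = inverse y" using False by (auto simp: y_def)
  have "y ^ (k + 2) \<le> fact (k + 2) * exp y"
    using power_div_fact_le_exp[of y "k + 2"] y by (simp add: field_simps del: fact_Suc)
  then have "y ^ k * exp (- y) * y\<^sup>2 \<le> fact (k + 2)"
    by (simp add: exp_minus field_simps power_add power2_eq_square del: fact_Suc)
  then have "y ^ k * exp (- y) \<le> fact (k + 2) * (inverse y)\<^sup>2"
    using y by (simp add: field_simps del: fact_Suc)
  then show ?thesis using False by (simp add: flat_def y_def del: fact_Suc)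
qed (simp add: flat_def)

lemma flat_derivative: "(flat k has_real_derivative flat (k + 2) t - real k * flat (k + 1) t) (at t)"
proof -
  consider "t < 0" | "t = 0" | "0 < t" by linarith
  then show ?thesis
  proof cases
    case 1
    have "((\<lambda>t. 0) has_real_derivative 0) (at t)" by simp
    then have "(flat k has_real_derivative 0) (at t)"
      by (rule has_field_derivative_transform_within_open[of _ _ _ "{..<0}"]) (use 1 in \<open>auto simp: flat_def\<close>)
    then show ?thesis using 1 by (simp add: flat_def)
  next
    case 2
    have "((\<lambda>h. (flat k (0 + h) - flat k 0) / h) \<longlongrightarrow> 0) (at 0)"
    proof (rule Lim_null_comparison)
      show "((\<lambda>h. fact (k + 2) * \<bar>h\<bar>) \<longlongrightarrow> (0::real)) (at 0)"
        by (rule tendsto_eq_intros refl | simp del: fact_Suc)+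
      have "norm ((flat k (0 + h) - flat k 0) / h) \<le> fact (k + 2) * \<bar>h\<bar>" if "h \<noteq> 0" for h
      proof -
        have "\<bar>flat k h\<bar> / \<bar>h\<bar> \<le> (fact (k + 2) * h\<^sup>2) / \<bar>h\<bar>"
          by (rule divide_right_mono[OF flat_bound]) simp
        also have "\<dots> = fact (k + 2) * \<bar>h\<bar>"
          using that by (cases "0 < h") (simp_all add: power2_eq_square del: fact_Suc)
        finally show ?thesis by (simp add: flat_def[of _ 0] del: fact_Suc)
      qed
      then show "\<forall>\<^sub>F h in at 0. norm ((flat k (0 + h) - flat k 0) / h) \<le> fact (k + 2) * \<bar>h\<bar>"
        by (simp add: eventually_at_filter)
    qed
    then show ?thesis using 2 by (simp add: DERIV_def flat_def)
  next
    case 3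
    have "((\<lambda>t. inverse t ^ k * exp (- inverse t)) has_real_derivative
        (inverse t ^ (k + 2) * exp (- inverse t) - real k * (inverse t ^ (k + 1) * exp (- inverse t)))) (at t)"
    proof (cases k)
      case 0
      then show ?thesis using 3 by (auto intro!: derivative_eq_intros simp: field_simps power2_eq_square)
    next
      case (Suc j)
      have pow: "t ^ l = t * t ^ (l - Suc 0)" if "l \<noteq> 0" for l
        using that by (cases l) auto
      show ?thesis using 3 Suc
        by (cases j) (auto intro!: derivative_eq_intros pow simp: field_simps power2_eq_square)
    qed
    then have "(flat k has_real_derivative
        (inverse t ^ (k + 2) * exp (- inverse t) - real k * (inverse t ^ (k + 1) * exp (- inverse t)))) (at t)"
      by (rule has_field_derivative_transform_within_open[of _ _ _ "{0<..}"]) (use 3 in \<open>auto simp: flat_def\<close>)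
    then show ?thesis using 3 by (simp add: flat_def)
  qed
qed

text \<open>
  A primitive of the bump \<open>flat 0 s * flat 0 (1 - s)\<close>, which lives on \<open>[0, 1]\<close>. Starting at \<open>-1\<close> makes all points
  \<open>t \<ge> 0\<close> interior to the interval of integration.
\<close>

definition step :: "real \<Rightarrow> real" where
  "step t = integral {- 1..t} (\<lambda>s. flat 0 s * flat 0 (1 - s))"

lemma step_derivative: "(step has_real_derivative flat 0 t * flat 0 (1 - t)) (at t)"
proof -
  have flat: "continuous_on UNIV (flat 0)"
    by (intro continuous_at_imp_continuous_on ballI DERIV_isCont[OF flat_derivative])
  have "continuous_on S (\<lambda>s. flat 0 (1 - s))" for S
    by (rule continuous_on_compose2[OF flat]) (auto intro!: continuous_intros)
  then have cont: "continuous_on S (\<lambda>s. flat 0 s * flat 0 (1 - s))" for S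
    by (intro continuous_on_mult continuous_on_subset[OF flat]) auto
  show ?thesis
  proof (cases "t < 0")
    case True
    have z: "step s = 0" if "s < 0" for s
    proof -
      have "step s = integral {- 1..s} (\<lambda>s. 0)"
        unfolding step_def by (rule integral_cong) (use that in \<open>auto simp: flat_def\<close>)
      then show ?thesis by simp
    qed
    have "((\<lambda>t. 0) has_real_derivative 0) (at t)" by simp
    then have "(step has_real_derivative 0) (at t)"
      by (rule has_field_derivative_transform_within_open[of _ _ _ "{..<0}"]) (use True z in auto)
    then show ?thesis using True by (simp add: flat_def)
  next
    case False
    have "(step has_real_derivative flat 0 t * flat 0 (1 - t)) (at t within {- 1..t + 1})"
      unfolding step_def using False by (intro integral_has_real_derivative cont) auto
    then show ?thesis using False by (simp add: at_within_Icc_at)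
  qed
qed

lemma step_mono: "s \<le> t \<Longrightarrow> step s \<le> step t"
  by (rule DERIV_nonneg_imp_nondecreasing[of s t step]) (use step_derivative flat_nonneg in \<open>meson mult_nonneg_nonneg\<close>)+

lemma step_0: "t \<le> 0 \<Longrightarrow> step t = 0"
proof -
  assume "t \<le> 0"
  have "step t = integral {- 1..t} (\<lambda>s. 0)"
    unfolding step_def by (rule integral_cong) (use \<open>t \<le> 0\<close> in \<open>auto simp: flat_def\<close>)
  then show ?thesis by simp
qed

lemma step_1_pos: "0 < step 1"
proof -
  have "step 0 < step 1"
  proof (rule DERIV_pos_imp_increasing_open[of 0 1 step])
    show "\<exists>y. (step has_real_derivative y) (at x) \<and> 0 < y" if "0 < x" "x < 1" for x
      using that by (intro exI[of _ "flat 0 x * flat 0 (1 - x)"] conjI step_derivative) (simp add: flat_def)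
    show "continuous_on {0..1} step"
      by (rule DERIV_continuous_on[OF step_derivative[THEN has_field_derivative_at_within]])
  qed simp
  then show ?thesis by (simp add: step_0)
qed

lemma step_ge_1: "1 \<le> t \<Longrightarrow> step t = step 1"
proof -
  assume t: "1 \<le> t"
  have "\<exists>c. \<forall>t\<in>{1..}. step t = c"
  proof (rule has_field_derivative_zero_constant)
    show "(step has_real_derivative 0) (at x within {1..})" if "x \<in> {1..}" for x
      using has_field_derivative_at_within[OF step_derivative[of x], of "{1..}"] that by (simp add: flat_def)
  qed simp
  then show ?thesis using t by auto
qed

text \<open>
  A function of \<open>|x|\<^sup>2\<close> is smooth at the origin, too. It is \<open>1\<close> for \<open>|x| \<le> 1\<close>, where \<open>4 - |x|\<^sup>2 \<ge> 1\<close>, and \<open>0\<close> for \<open>|x| \<ge> 2\<close>.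
\<close>

definition cutoff1 :: "'n::finite cfun" where
  "cutoff1 x = of_real (step (4 - x \<bullet> x) / step 1)"

lemma radial_partial:
  fixes u u' :: "real \<Rightarrow> real"
  assumes "\<And>t. (u has_real_derivative u' t) (at t)"
  shows "(\<lambda>x :: real ^ 'n::finite. complex_of_real (u (c + d * (x \<bullet> x)))) differentiable (at x)"
    and "partial i (\<lambda>x :: real ^ 'n::finite. complex_of_real (u (c + d * (x \<bullet> x)))) =
      (\<lambda>x. complex_of_real (u' (c + d * (x \<bullet> x))) * (of_real (2 * d) * of_real (x $ i)))"
proof -
  have der: "((\<lambda>x :: real ^ 'n. complex_of_real (u (c + d * (x \<bullet> x)))) has_derivative
     (\<lambda>h. of_real (u' (c + d * (x \<bullet> x)) * (d * (2 * (x \<bullet> h)))))) (at x)" for x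
  proof -
    have 1: "((\<lambda>x :: real ^ 'n. c + d * (x \<bullet> x)) has_derivative (\<lambda>h. d * (2 * (x \<bullet> h)))) (at x)"
      by (auto intro!: derivative_eq_intros simp: inner_commute)
    have 2: "(u has_derivative (\<lambda>h. u' (c + d * (x \<bullet> x)) * h)) (at (c + d * (x \<bullet> x)))"
      using assms unfolding has_field_derivative_def by (simp add: mult_commute_abs)
    show ?thesis by (rule has_derivative_of_real[OF has_derivative_compose[OF 1 2]])
  qed
  show "(\<lambda>x :: real ^ 'n::finite. complex_of_real (u (c + d * (x \<bullet> x)))) differentiable (at x)"
    using der differentiableI by blast
  show "partial i (\<lambda>x :: real ^ 'n::finite. complex_of_real (u (c + d * (x \<bullet> x)))) =
      (\<lambda>x. complex_of_real (u' (c + d * (x \<bullet> x))) * (of_real (2 * d) * of_real (x $ i)))"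
    by (rule ext, subst partial_eqI[OF der]) (simp add: inner_axis)
qed

text \<open>
  The functions \<open>flat k\<close> and \<open>step\<close> of \<open>c + d |x|\<^sup>2\<close>, together with the coordinates, generate an algebra that is
  stable under differentiation.
\<close>

lemma smooth_cutoff1: "smooth (cutoff1 :: 'n::finite cfun)"
proof -
  define Fl where "Fl = (\<lambda>k c d (x :: real ^ 'n). complex_of_real (flat k (c + d * (x \<bullet> x))))"
  define S where "S = {Fl k c d | k c d. True} \<union> {\<lambda>x :: real ^ 'n. complex_of_real (step (4 + (- 1) * (x \<bullet> x)))} \<union> {\<lambda>x. complex_of_real (x $ i) | i. True}"
  have Fl_alg: "Fl k c d \<in> alg S" for k c d by (rule alg_base) (auto simp: S_def)
  have coord_alg: "(\<lambda>x. complex_of_real (x $ i)) \<in> alg S" for i by (rule alg_base) (auto simp: S_def)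
  have coord_der: "((\<lambda>x :: real ^ 'n. complex_of_real (x $ i)) has_derivative (\<lambda>h. of_real (h $ i))) (at x)" for i x
    by (intro has_derivative_of_real bounded_linear_imp_has_derivative bounded_linear_vec_nth)
  have "f differentiable (at x) \<and> partial i f \<in> alg S" if "f \<in> S" for f x i
    using that[unfolded S_def]
  proof (elim UnE CollectE exE conjE)
    fix k c d assume f: "f = Fl k c d"
    have "partial i f = (\<lambda>x. (Fl (k + 2) c d x + of_real (- real k) * Fl (k + 1) c d x) * (of_real (2 * d) * of_real (x $ i)))"
      unfolding f Fl_def by (subst radial_partial(2)[OF flat_derivative]) simp
    also have "\<dots> \<in> alg S" by (intro alg_mult alg_add alg_const Fl_alg coord_alg)
    finally show ?thesis unfolding f Fl_def using radial_partial(1)[OF flat_derivative] by blast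
  next
    assume f: "f \<in> {\<lambda>x. complex_of_real (step (4 + (- 1) * (x \<bullet> x)))}"
    have "partial i f = (\<lambda>x. Fl 0 4 (-1) x * Fl 0 (-3) 1 x * (of_real (2 * (-1)) * of_real (x $ i)))"
      unfolding Fl_def using f radial_partial(2)[OF step_derivative, of i 4 "-1"] by simp
    also have "\<dots> \<in> alg S" by (intro alg_mult alg_add alg_const Fl_alg coord_alg)
    finally show ?thesis using f radial_partial(1)[OF step_derivative, of 4 "-1"] by blast
  next
    fix j assume f: "f = (\<lambda>x. complex_of_real (x $ j))"
    have "partial i f = (\<lambda>x. complex_of_real (axis i 1 $ j))"
      unfolding f by (rule ext, subst partial_eqI[OF coord_der]) simp
    also have "\<dots> \<in> alg S" by (rule alg_const)
    finally show ?thesis unfolding f using coord_der differentiableI by blast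
  qed
  then have sm: "smooth f" if "f \<in> alg S" for f
    using smooth_alg[OF _ _ that] by blast
  have mem: "(\<lambda>x. of_real (inverse (step 1)) * complex_of_real (step (4 + (- 1) * (x \<bullet> x)))) \<in> alg S"
    by (intro alg_mult alg_const alg_base) (auto simp: S_def)
  have "(\<lambda>x :: real ^ 'n. of_real (inverse (step 1)) * complex_of_real (step (4 + (- 1) * (x \<bullet> x)))) = cutoff1"
    by (auto simp: cutoff1_def fun_eq_iff divide_inverse mult.commute)
  then show ?thesis using sm[OF mem] by simp
qed

definition cutoff :: "real \<Rightarrow> 'n::finite cfun" where
  "cutoff R x = cutoff1 ((1 / R) *\<^sub>R x)"

lemma cutoff1_eq_1: "norm x \<le> 1 \<Longrightarrow> cutoff1 x = 1"
proof -
  assume "norm x \<le> 1"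
  then have "x \<bullet> x \<le> 1" using power_mono[of "norm x" 1 2] by (simp add: power2_norm_eq_inner)
  then show ?thesis using step_ge_1[of "4 - x \<bullet> x"] step_1_pos by (simp add: cutoff1_def)
qed

lemma cutoff1_eq_0: "2 \<le> norm x \<Longrightarrow> cutoff1 x = 0"
proof -
  assume "2 \<le> norm x"
  then have "4 \<le> x \<bullet> x" using power_mono[of 2 "norm x" 2] by (simp add: power2_norm_eq_inner)
  then show ?thesis using step_0[of "4 - x \<bullet> x"] by (simp add: cutoff1_def)
qed

lemma cutoff1_range: "\<exists>r. cutoff1 x = of_real r \<and> 0 \<le> r \<and> r \<le> 1"
proof -
  have "0 \<le> step (4 - x \<bullet> x)" using step_mono[of "min 0 (4 - x \<bullet> x)" "4 - x \<bullet> x"] step_0 by simp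
  moreover have "step (4 - x \<bullet> x) \<le> step 1"
    using step_mono[of "4 - x \<bullet> x" "max 1 (4 - x \<bullet> x)"] step_ge_1[of "max 1 (4 - x \<bullet> x)"] by simp
  ultimately show ?thesis unfolding cutoff1_def using step_1_pos by (intro exI[of _ "step (4 - x \<bullet> x) / step 1"]) auto
qed

lemma cutoff_eq_1: "0 < R \<Longrightarrow> norm x \<le> R \<Longrightarrow> cutoff R x = 1"
  unfolding cutoff_def by (rule cutoff1_eq_1) simp

lemma cutoff_eq_0: "0 < R \<Longrightarrow> 2 * R \<le> norm x \<Longrightarrow> cutoff R x = 0"
  unfolding cutoff_def by (rule cutoff1_eq_0) (simp add: field_simps)

lemma smooth_cutoff: "smooth (cutoff R)"
  unfolding cutoff_def[abs_def] using smooth_affine(1)[OF smooth_cutoff1, of 0 "1 / R"] by simp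

lemma fun_support_cutoff: "0 < R \<Longrightarrow> fun_support (cutoff R) \<subseteq> cball 0 (2 * R)"
  by (rule fun_support_subset) (auto intro!: cutoff_eq_0)

definition bdd_smooth :: "'n::finite cfun \<Rightarrow> bool" where
  "bdd_smooth u \<longleftrightarrow> smooth u \<and> (\<forall>is. bounded (range (ders is u)))"

lemma test_functions_bdd_smooth:
  assumes "f \<in> test_functions"
  shows "bdd_smooth f"
proof -
  have "bounded (range (ders is f))" for "is"
  proof -
    have f: "smooth f" "compact (fun_support f)" using assms unfolding test_functions_def by auto
    have "compact (ders is f ` fun_support f)"
      using f by (intro compact_continuous_image continuous_on_subset[OF smooth_continuous[OF smooth_ders]]) auto
    then have "bounded (insert 0 (ders is f ` fun_support f))" by (simp add: compact_imp_bounded)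
    then show ?thesis
      by (rule bounded_subset) (use ders_eq_0_off_support in blast)
  qed
  then show ?thesis using assms unfolding test_functions_def bdd_smooth_def by auto
qed

lemma cutoff_test:
  assumes "0 < R"
  shows "(cutoff R :: 'n::finite cfun) \<in> test_functions"
proof -
  have "bounded (fun_support (cutoff R :: 'n cfun))"
    by (rule bounded_subset[OF bounded_cball fun_support_cutoff[OF assms]])
  then show ?thesis
    unfolding test_functions_def compact_eq_bounded_closed using smooth_cutoff by (simp add: fun_support_def)
qed

lemma bdd_smooth_const: "bdd_smooth (\<lambda>x :: real ^ 'n::finite. c)"
proof -
  have "ders is (\<lambda>x :: real ^ 'n. c) = (\<lambda>x. if is = [] then c else 0)" for "is" by (induction "is") auto
  then have "range (ders is (\<lambda>x :: real ^ 'n. c)) \<subseteq> {c, 0}" for "is" by auto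
  then have "bounded (range (ders is (\<lambda>x :: real ^ 'n. c)))" for "is"
    by (rule bounded_subset[rotated]) simp
  then show ?thesis unfolding bdd_smooth_def using smooth_const by blast
qed

lemma bdd_smooth_diff: "bdd_smooth f \<Longrightarrow> bdd_smooth g \<Longrightarrow> bdd_smooth (\<lambda>x. f x - g x)"
  unfolding bdd_smooth_def by (auto simp: ders_diff smooth_diff intro!: bounded_minus_comp)

lemma bdd_smooth_bound:
  assumes "bdd_smooth u"
  obtains A where "0 < A" "\<And>is x. is \<in> words m \<Longrightarrow> norm (ders is u x) \<le> A"
proof -
  have "\<exists>A>0. \<forall>x. norm (ders is u x) \<le> A" for "is"
    using assms unfolding bdd_smooth_def bounded_pos by auto
  then obtain B where B: "\<And>is. 0 < B is" "\<And>is x. norm (ders is u x) \<le> B is" by metis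
  have "norm (ders is u x) \<le> 1 + (\<Sum>js\<in>words m. B js)" if "is \<in> words m" for "is" x
  proof -
    have "B is \<le> (\<Sum>js\<in>words m. B js)"
      by (rule member_le_sum[OF that]) (auto simp: finite_words intro: less_imp_le B(1))
    then show ?thesis using B(2)[of "is" x] by linarith
  qed
  moreover have "0 \<le> (\<Sum>js\<in>words m. B js)" by (intro sum_nonneg less_imp_le B(1))
  ultimately show ?thesis by (intro that[of "1 + (\<Sum>js\<in>words m. B js)"]) auto
qed

text \<open>
  A derivative of order \<open>k\<close> of the rescaled function carries the factor \<open>R\<^sup>-\<^sup>k\<close>.
\<close>

lemma cutoff_bound:
  obtains A where "0 < A" "\<And>R is x. 1 \<le> R \<Longrightarrow> is \<in> words m \<Longrightarrow> norm (ders is (cutoff R) (x :: real ^ 'n::finite)) \<le> A"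
proof -
  have "(cutoff1 :: 'n cfun) = cutoff 1" by (simp add: cutoff_def fun_eq_iff)
  moreover have "bdd_smooth (cutoff 1 :: 'n cfun)"
    by (rule test_functions_bdd_smooth[OF cutoff_test]) simp
  ultimately have "bdd_smooth (cutoff1 :: 'n cfun)" by simp
  then obtain A where A: "0 < A" "\<And>is x. is \<in> words m \<Longrightarrow> norm (ders is cutoff1 (x :: real ^ 'n)) \<le> A"
    by (rule bdd_smooth_bound[where m = m]) blast
  have "norm (ders is (cutoff R) x) \<le> A" if "1 \<le> R" "is \<in> words m" for R "is" and x :: "real ^ 'n"
  proof -
    have "ders is (cutoff R) x = of_real ((1 / R) ^ length is) * ders is cutoff1 ((1 / R) *\<^sub>R x)"
      using smooth_affine(2)[OF smooth_cutoff1, of "is" 0 "1 / R"] by (simp add: cutoff_def[abs_def])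
    then have "norm (ders is (cutoff R) x) = \<bar>1 / R\<bar> ^ length is * norm (ders is cutoff1 ((1 / R) *\<^sub>R x))"
      by (simp add: norm_mult norm_power norm_divide power_divide)
    also have "\<dots> \<le> 1 * A"
      using that A by (intro mult_mono power_le_one) auto
    finally show ?thesis by simp
  qed
  then show ?thesis using A(1) that by blast
qed

section \<open>Integrable functions and the space of integrable derivatives\<close>

definition weight :: "'n::finite cfun \<Rightarrow> bool" where
  "weight g \<longleftrightarrow> g \<in> borel_measurable borel \<and> bounded (range g)"

lemma weight_bound:
  assumes "weight g"
  obtains A where "0 < A" "\<And>x. norm (g x) \<le> A"
  using assms unfolding weight_def bounded_pos by auto

lemma weight_const: "weight (\<lambda>x. c)"
  unfolding weight_def by (simp add: bounded_def) (metis order_refl)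

lemma bdd_smooth_weight: "bdd_smooth f \<Longrightarrow> weight f"
  unfolding bdd_smooth_def weight_def by (auto intro: smooth_borel dest: spec[of _ "[]"])

lemma weight_integrable:
  assumes g: "weight g" and f: "integrable lborel f"
  shows "integrable lborel (\<lambda>x. g x * f x)"
proof -
  obtain A where A: "0 < A" "\<And>x. norm (g x) \<le> A" using weight_bound[OF g] by blast
  have [measurable]: "g \<in> borel_measurable borel" "f \<in> borel_measurable borel"
    using g f by (auto simp: weight_def)
  show ?thesis
  proof (rule Bochner_Integration.integrable_bound[of _ "\<lambda>x. A * norm (f x)"])
    show "AE x in lborel. norm (g x * f x) \<le> norm (A * norm (f x))"
      using A by (auto simp: norm_mult intro!: mult_right_mono)
  qed (use f in auto)
qed

lemma L1_norm_nonneg: "0 \<le> L1_norm f"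
  unfolding L1_norm_def by simp

lemma L1_norm_mono:
  assumes "integrable lborel g" "f \<in> borel_measurable borel" "\<And>x. norm (f x) \<le> norm (g x)"
  shows "L1_norm f \<le> L1_norm g"
  unfolding L1_norm_def
proof (rule integral_mono)
  have "integrable lborel f"
    by (rule Bochner_Integration.integrable_bound[OF assms(1)]) (use assms in auto)
  then show "integrable lborel (\<lambda>x. norm (f x))" by simp
qed (use assms in auto)

lemma L1_norm_scale: "L1_norm (\<lambda>x. c * f x) = norm c * L1_norm f"
  unfolding L1_norm_def by (simp add: norm_mult)

lemma L1_norm_add:
  assumes "integrable lborel f" "integrable lborel g"
  shows "L1_norm (\<lambda>x. f x + g x) \<le> L1_norm f + L1_norm g"
proof -
  have "L1_norm (\<lambda>x. f x + g x) \<le> (LINT x|lborel. norm (f x) + norm (g x))"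
    unfolding L1_norm_def by (rule integral_mono) (use assms in \<open>auto intro: norm_triangle_ineq\<close>)
  then show ?thesis using assms by (simp add: L1_norm_def)
qed

lemma L1_norm_mult_le:
  assumes "integrable lborel f" "\<And>x. norm (g x) \<le> A" "g \<in> borel_measurable borel"
  shows "L1_norm (\<lambda>x. g x * f x) \<le> A * L1_norm f"
proof -
  have A: "0 \<le> A" using assms(2)[of 0] norm_ge_zero order_trans by blast
  have [measurable]: "g \<in> borel_measurable borel" "f \<in> borel_measurable borel" using assms by auto
  have "L1_norm (\<lambda>x. g x * f x) \<le> L1_norm (\<lambda>x. of_real A * f x)"
    using assms A by (intro L1_norm_mono) (auto simp: norm_mult intro: mult_right_mono)
  then show ?thesis using A by (simp add: L1_norm_scale)
qed

lemma nn_integral_norm_eq_L1: "integrable lborel f \<Longrightarrow> (\<integral>\<^sup>+x. ennreal (norm (f x)) \<partial>lborel) = ennreal (L1_norm f)"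
  unfolding L1_norm_def by (rule nn_integral_eq_integral) auto

lemma L1_norm_leI:
  assumes "f \<in> borel_measurable borel" "(\<integral>\<^sup>+x. ennreal (norm (f x)) \<partial>lborel) \<le> ennreal B" "0 \<le> B"
  shows "integrable lborel f" "L1_norm f \<le> B"
proof -
  show i: "integrable lborel f"
    using assms by (intro integrableI_bounded) (auto simp: le_less_trans)
  show "L1_norm f \<le> B"
    using assms(2,3) nn_integral_norm_eq_L1[OF i] by (simp add: ennreal_le_iff)
qed

lemma integral_translate:
  fixes h :: "real ^ 'n::finite" and f :: "real ^ 'n \<Rightarrow> 'b::{banach, second_countable_topology}"
  assumes [measurable]: "f \<in> borel_measurable borel"
  shows "(LINT x|lborel. f (x + h)) = (LINT x|lborel. f x)"
proof -
  have "(LINT x|lborel. f x) = (LINT x|distr lborel borel ((+) h). f x)"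
    by (simp add: lborel_distr_plus)
  also have "\<dots> = (LINT x|lborel. f (h + x))" by (subst integral_distr) auto
  finally show ?thesis by (simp add: add.commute)
qed

lemma integrable_translate:
  fixes h :: "real ^ 'n::finite" and f :: "'n cfun"
  assumes "integrable lborel f"
  shows "integrable lborel (\<lambda>x. f (x + h))"
proof -
  have [measurable]: "f \<in> borel_measurable borel" using assms by auto
  have "integrable (distr lborel borel ((+) h)) f" using assms by (simp add: lborel_distr_plus)
  then show ?thesis by (simp add: integrable_distr_eq add.commute)
qed

lemma L1_norm_translate:
  "f \<in> borel_measurable borel \<Longrightarrow> L1_norm (\<lambda>x. f (x + h)) = L1_norm f"
  unfolding L1_norm_def by (rule integral_translate) measurable

text \<open>
  Symmetry of second derivatives turns the condition on multi-indices into one on words.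
\<close>

lemma D_L1_iff: "f \<in> D_L1 \<longleftrightarrow> smooth f \<and> (\<forall>is. integrable lborel (ders is f))"
proof
  assume f: "f \<in> D_L1"
  then have s: "smooth f" by (simp add: D_L1_def)
  have "integrable lborel (ders is f)" for "is"
  proof -
    obtain \<alpha> where "ders is f = mpartial \<alpha> f" using ders_mpartial s by metis
    then show ?thesis using f by (simp add: D_L1_def)
  qed
  then show "smooth f \<and> (\<forall>is. integrable lborel (ders is f))" using s by blast
next
  assume f: "smooth f \<and> (\<forall>is. integrable lborel (ders is f))"
  have "integrable lborel (mpartial \<alpha> f)" for \<alpha>
  proof -
    obtain "is" where "mpartial \<alpha> = ders is" using mpartial_ders by metis
    then show ?thesis using f by simp
  qed
  then show "f \<in> D_L1" using f by (simp add: D_L1_def)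
qed

lemma D_L1_smooth: "f \<in> D_L1 \<Longrightarrow> smooth f" by (simp add: D_L1_iff)
lemma D_L1_integrable_ders: "f \<in> D_L1 \<Longrightarrow> integrable lborel (ders is f)" by (simp add: D_L1_iff)
lemma D_L1_integrable: "f \<in> D_L1 \<Longrightarrow> integrable lborel f" using D_L1_integrable_ders[of f "[]"] by simp
lemma D_L1_borel: "f \<in> D_L1 \<Longrightarrow> f \<in> borel_measurable borel" by (simp add: smooth_borel D_L1_smooth)

lemma D_L1_ders:
  assumes "f \<in> D_L1"
  shows "ders js f \<in> D_L1"
proof -
  have "integrable lborel (ders is (ders js f))" for "is"
    using D_L1_integrable_ders[OF assms, of "is @ js"] by simp
  then show ?thesis using assms smooth_ders D_L1_iff by blast
qed

lemma D_L1_partial: "f \<in> D_L1 \<Longrightarrow> partial i f \<in> D_L1"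
  using D_L1_ders[of f "[i]"] by simp

lemma subspace_D_L1: "subspace_fun (D_L1 :: 'n::finite cfun set)"
proof -
  have "(\<lambda>x. a * f x + b * g x) \<in> D_L1" if "f \<in> D_L1" "g \<in> D_L1" for f g :: "'n cfun" and a b
    using that by (auto simp: D_L1_iff ders_lincomb intro!: smooth_add smooth_mult smooth_const)
  moreover have "(\<lambda>x :: real ^ 'n. 0) \<in> D_L1"
  proof -
    have "ders is (\<lambda>x :: real ^ 'n. 0) = (\<lambda>x. 0)" for "is" by (induction "is") auto
    then show ?thesis by (simp add: D_L1_iff smooth_const)
  qed
  ultimately show ?thesis unfolding subspace_fun_def by blast
qed

lemmas D_L1_add = subspace_fun_add[OF subspace_D_L1]
  and D_L1_diff = subspace_fun_diff[OF subspace_D_L1]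
  and D_L1_scale = subspace_fun_scale[OF subspace_D_L1]

lemma D_L1_translate: "f \<in> D_L1 \<Longrightarrow> (\<lambda>x. f (x + h)) \<in> D_L1"
proof -
  assume f: "f \<in> D_L1"
  have "smooth (\<lambda>x. f (x + h))" "ders is (\<lambda>x. f (x + h)) = (\<lambda>x. ders is f (x + h))" for "is"
    using smooth_affine[OF D_L1_smooth[OF f], where a = h and c = 1] by (simp_all add: add.commute)
  then show ?thesis
    using D_L1_integrable_ders[OF f] by (simp add: D_L1_iff integrable_translate)
qed

lemma D_L1_mult:
  assumes u: "bdd_smooth u" and f: "f \<in> D_L1"
  shows "(\<lambda>x. u x * f x) \<in> D_L1"
proof -
  have su: "smooth u" and sf: "smooth f" using u f by (auto simp: bdd_smooth_def D_L1_smooth)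
  have "integrable lborel (ders is (\<lambda>x. u x * f x))" for "is"
  proof -
    obtain A where A: "0 < A" "\<And>js x. js \<in> words (length is) \<Longrightarrow> norm (ders js u x) \<le> A"
      by (rule bdd_smooth_bound[OF u, of "length is"]) blast
    have "integrable lborel (\<lambda>x. 2 ^ length is * A * (\<Sum>js\<in>words (length is). norm (ders js f x)))"
      by (intro integrable_mult_right Bochner_Integration.integrable_sum integrable_norm D_L1_integrable_ders f)
    then show ?thesis
    proof (rule Bochner_Integration.integrable_bound)
      show "ders is (\<lambda>x. u x * f x) \<in> borel_measurable lborel"
        using smooth_borel[OF smooth_ders[OF smooth_mult[OF su sf]]] by simp
      show "AE x in lborel. norm (ders is (\<lambda>x. u x * f x) x) \<le> norm (2 ^ length is * A * (\<Sum>js\<in>words (length is). norm (ders js f x)))"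
        using norm_ders_mult_le[OF su sf A(2)] A(1) by (auto simp: abs_of_nonneg sum_nonneg)
    qed
  qed
  then show ?thesis using su sf by (simp add: D_L1_iff smooth_mult)
qed

section \<open>Weighted norms\<close>

definition wnorm :: "'n::finite cfun \<Rightarrow> nat \<Rightarrow> 'n cfun \<Rightarrow> real" where
  "wnorm g m f = (SUP \<alpha>\<in>mindex_le m. L1_norm (\<lambda>x. g x * mpartial \<alpha> f x))"

lemma finite_mindex_le: "finite (mindex_le m :: ('n::finite \<Rightarrow> nat) set)"
proof (rule finite_subset)
  show "mindex_le m \<subseteq> PiE (UNIV :: 'n set) (\<lambda>_. {..m})"
  proof
    fix \<alpha> :: "'n \<Rightarrow> nat" assume "\<alpha> \<in> mindex_le m"
    then have "\<alpha> i \<le> m" for i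
      using member_le_sum[of i UNIV \<alpha>] unfolding mindex_le_def by force
    then show "\<alpha> \<in> PiE UNIV (\<lambda>_. {..m})" by auto
  qed
qed (simp add: finite_PiE)

lemma mindex_le_nonempty: "mindex_le m \<noteq> {}"
  unfolding mindex_le_def by (metis (mono_tags, lifting) empty_iff le0 mem_Collect_eq sum.neutral_const)

lemma D_L1_seminorms_wnorm: "D_L1_seminorms = {wnorm (\<lambda>x. 1) m | m. True}"
  unfolding D_L1_seminorms_def wnorm_def[abs_def] by simp

lemma wnorm_ge:
  assumes "smooth f" "is \<in> words m"
  shows "L1_norm (\<lambda>x. g x * ders is f x) \<le> wnorm g m f"
proof -
  obtain \<alpha> where \<alpha>: "(\<Sum>i\<in>UNIV. \<alpha> i) = length is" "ders is f = mpartial \<alpha> f"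
    using ders_mpartial[of "is"] assms(1) by metis
  show ?thesis unfolding wnorm_def \<alpha>(2)
  proof (rule cSUP_upper)
    show "\<alpha> \<in> mindex_le m" using \<alpha>(1) assms(2) by (simp add: mindex_le_def)
  qed (intro bdd_above_finite finite_imageI finite_mindex_le)
qed

lemma wnorm_le:
  assumes "\<And>is. is \<in> words m \<Longrightarrow> L1_norm (\<lambda>x. g x * ders is f x) \<le> c"
  shows "wnorm g m f \<le> c"
  unfolding wnorm_def
proof (rule cSUP_least[OF mindex_le_nonempty])
  fix \<alpha> :: "'a \<Rightarrow> nat" assume "\<alpha> \<in> mindex_le m"
  moreover obtain "is" where "mpartial \<alpha> = ders is" "length is = (\<Sum>i\<in>UNIV. \<alpha> i)" using mpartial_ders by metis
  ultimately show "L1_norm (\<lambda>x. g x * mpartial \<alpha> f x) \<le> c" using assms[of "is"] by (simp add: mindex_le_def)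
qed

lemma wnorm_attained:
  assumes "smooth f"
  obtains "is" where "is \<in> words m" "wnorm g m f = L1_norm (\<lambda>x. g x * ders is f x)"
proof -
  have "wnorm g m f \<in> (\<lambda>\<alpha>. L1_norm (\<lambda>x. g x * mpartial \<alpha> f x)) ` mindex_le m"
    unfolding wnorm_def
    by (subst cSup_eq_Max) (auto simp: finite_mindex_le mindex_le_nonempty intro!: Max_in)
  then obtain \<alpha> where a: "\<alpha> \<in> mindex_le m" "wnorm g m f = L1_norm (\<lambda>x. g x * mpartial \<alpha> f x)" by blast
  obtain "is" where "mpartial \<alpha> = ders is" "length is = (\<Sum>i\<in>UNIV. \<alpha> i)" using mpartial_ders by metis
  then show ?thesis using a by (intro that[of "is"]) (auto simp: mindex_le_def)
qed

lemma wnorm_ge_1: "smooth f \<Longrightarrow> is \<in> words m \<Longrightarrow> L1_norm (ders is f) \<le> wnorm (\<lambda>x. 1) m f"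
  using wnorm_ge[of f "is" m "\<lambda>x. 1"] by simp

lemma wnorm_nonneg: "smooth f \<Longrightarrow> 0 \<le> wnorm g m f"
  using order_trans[OF L1_norm_nonneg wnorm_ge[of f "[]" m g]] by simp

lemma wnorm_mono_order: "m \<le> k \<Longrightarrow> smooth f \<Longrightarrow> wnorm g m f \<le> wnorm g k f"
  by (rule wnorm_le) (auto intro: wnorm_ge)

lemma wnorm_partial: "smooth f \<Longrightarrow> wnorm g m (partial i f) \<le> wnorm g (Suc m) f"
  by (rule wnorm_le) (use wnorm_ge[of f "js @ [i]" "Suc m" g for js] in simp)

lemma integrable_weighted: "weight g \<Longrightarrow> f \<in> D_L1 \<Longrightarrow> integrable lborel (\<lambda>x. g x * ders is f x)"
  by (rule weight_integrable[OF _ D_L1_integrable_ders])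

abbreviation dnorm :: "nat \<Rightarrow> 'n::finite cfun \<Rightarrow> real" where
  "dnorm \<equiv> wnorm (\<lambda>x. 1)"

lemma wnorm_seminorm:
  assumes g: "weight g"
  shows "seminorm_on D_L1 (wnorm g m)"
  unfolding seminorm_on_def
proof (intro conjI ballI allI)
  fix f h :: "'a cfun" assume f: "f \<in> D_L1" and h: "h \<in> D_L1"
  note s = D_L1_smooth[OF f] D_L1_smooth[OF h]
  show "wnorm g m (\<lambda>t. f t + h t) \<le> wnorm g m f + wnorm g m h"
  proof (rule wnorm_le)
    fix "is" :: "'a list" assume is_: "is \<in> words m"
    have "L1_norm (\<lambda>x. g x * ders is (\<lambda>t. f t + h t) x) = L1_norm (\<lambda>x. g x * ders is f x + g x * ders is h x)"
      by (simp add: ders_add s algebra_simps)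
    also have "\<dots> \<le> L1_norm (\<lambda>x. g x * ders is f x) + L1_norm (\<lambda>x. g x * ders is h x)"
      by (intro L1_norm_add integrable_weighted g f h)
    also have "\<dots> \<le> wnorm g m f + wnorm g m h" by (intro add_mono wnorm_ge s is_)
    finally show "L1_norm (\<lambda>x. g x * ders is (\<lambda>t. f t + h t) x) \<le> wnorm g m f + wnorm g m h" .
  qed
next
  fix f :: "'a cfun" and c assume f: "f \<in> D_L1"
  have le: "wnorm g m (\<lambda>t. c * f t) \<le> norm c * wnorm g m f" if "f \<in> D_L1" for f c
  proof (rule wnorm_le)
    fix "is" :: "'a list" assume is_: "is \<in> words m"
    have "(\<lambda>x. g x * ders is (\<lambda>t. c * f t) x) = (\<lambda>x. c * (g x * ders is f x))"
      by (simp add: ders_scale D_L1_smooth that algebra_simps)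
    then show "L1_norm (\<lambda>x. g x * ders is (\<lambda>t. c * f t) x) \<le> norm c * wnorm g m f"
      using wnorm_ge[OF D_L1_smooth[OF that] is_, of g] by (simp add: L1_norm_scale mult_left_mono)
  qed
  show "wnorm g m (\<lambda>t. c * f t) = norm c * wnorm g m f"
  proof (cases "c = 0")
    case True
    then show ?thesis using le[OF f, of 0] wnorm_nonneg[OF smooth_const, of g m 0] by (simp add: True)
  next
    case False
    have "wnorm g m (\<lambda>t. (1 / c) * (c * f t)) \<le> norm (1 / c) * wnorm g m (\<lambda>t. c * f t)"
      by (rule le[OF D_L1_scale[OF f]])
    then have "wnorm g m f \<le> wnorm g m (\<lambda>t. c * f t) / norm c" using False by (simp add: norm_divide)
    then show ?thesis using le[OF f, of c] False by (simp add: field_simps)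
  qed
qed

text \<open>
  The two weights are compared only where the multiplier lives. Depending on their choice this says that
  multiplication is continuous, that tails are small, or that a piece on an annulus is controlled by the weight there.
\<close>

lemma wnorm_mult_le:
  fixes g1 g2 u f :: "'n::finite cfun"
  assumes g: "weight g1" "weight g2" and f: "f \<in> D_L1" and u: "bdd_smooth u"
    and A: "\<And>js x. js \<in> words m \<Longrightarrow> norm (ders js u x) \<le> A"
    and le: "\<And>x. x \<in> fun_support u \<Longrightarrow> norm (g1 x) \<le> norm (g2 x)"
  shows "wnorm g1 m (\<lambda>x. u x * f x) \<le> 2 ^ m * A * card (words m :: 'n list set) * wnorm g2 m f"
proof (rule wnorm_le)
  fix "is" :: "'n list" assume is_: "is \<in> words m"
  have su: "smooth u" and sf: "smooth f" using u f by (auto simp: bdd_smooth_def D_L1_smooth)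
  have "norm (u 0) \<le> A" using A[of "[]" 0] by simp
  then have A0: "0 \<le> A" by (rule order_trans[OF norm_ge_zero])
  let ?c = "2 ^ m * A"
  have int: "integrable lborel (\<lambda>x. norm (g2 x * ders js f x))" for js
    by (intro integrable_norm integrable_weighted g f)
  have "norm (g1 x * ders is (\<lambda>x. u x * f x) x) \<le> ?c * (\<Sum>js\<in>words m. norm (g2 x * ders js f x))" for x
  proof (cases "x \<in> fun_support u")
    case True
    have "norm (g1 x) * norm (ders is (\<lambda>x. u x * f x) x) \<le> norm (g2 x) * (?c * (\<Sum>js\<in>words m. norm (ders js f x)))"
      by (intro mult_mono le True norm_ders_mult_le[OF su sf A is_]) auto
    then show ?thesis by (simp add: norm_mult sum_distrib_left mult_ac)
  next
    case False
    have "fun_support (\<lambda>x. u x * f x) \<subseteq> fun_support u"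
    proof (rule fun_support_subset)
      show "u x * f x = 0" if "x \<notin> fun_support u" for x
        using that fun_support_superset by fastforce
    qed (simp add: fun_support_def)
    then have "ders is (\<lambda>x. u x * f x) x = 0" using False by (intro ders_eq_0_off_support) auto
    then show ?thesis using A0 by (simp add: sum_nonneg)
  qed
  then have "L1_norm (\<lambda>x. g1 x * ders is (\<lambda>x. u x * f x) x) \<le> (LINT x|lborel. ?c * (\<Sum>js\<in>words m. norm (g2 x * ders js f x)))"
    unfolding L1_norm_def
    by (intro integral_mono integrable_norm integrable_weighted g D_L1_mult u f integrable_mult_right Bochner_Integration.integrable_sum int)
  also have "\<dots> = ?c * (\<Sum>js\<in>words m. L1_norm (\<lambda>x. g2 x * ders js f x))"
    by (simp add: Bochner_Integration.integral_sum int L1_norm_def)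
  also have "\<dots> \<le> ?c * (\<Sum>js\<in>(words m :: 'n list set). wnorm g2 m f)"
    using A0 by (intro mult_left_mono sum_mono wnorm_ge sf) auto
  finally show "L1_norm (\<lambda>x. g1 x * ders is (\<lambda>x. u x * f x) x) \<le> ?c * card (words m :: 'n list set) * wnorm g2 m f"
    by simp
qed

lemma wnorm_le_unweighted:
  assumes "weight g" "\<And>x. norm (g x) \<le> A" "f \<in> D_L1"
  shows "wnorm g m f \<le> A * dnorm m f"
proof (rule wnorm_le)
  fix "is" :: "'a list" assume is_: "is \<in> words m"
  have A: "0 \<le> A" using assms(2)[of 0] norm_ge_zero order_trans by blast
  have "L1_norm (\<lambda>x. g x * ders is f x) \<le> A * L1_norm (ders is f)"
    using assms by (intro L1_norm_mult_le D_L1_integrable_ders) (auto simp: weight_def)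
  also have "\<dots> \<le> A * dnorm m f"
    by (intro mult_left_mono wnorm_ge_1 D_L1_smooth assms is_ A)
  finally show "L1_norm (\<lambda>x. g x * ders is f x) \<le> A * dnorm m f" .
qed

section \<open>Translations in the mean\<close>

text \<open>
  Minkowski's integral inequality for \<open>F x 1 - F x 0 = \<integral>\<^sub>0\<^sup>1 F' x t dt\<close>.
\<close>

lemma L1_norm_increment_le:
  fixes F F' :: "real ^ 'n::finite \<Rightarrow> real \<Rightarrow> complex"
  assumes der: "\<And>x t. (F x has_vector_derivative F' x t) (at t)"
    and cont: "\<And>x. continuous_on {0..1} (F' x)"
    and meas: "(\<lambda>(x, t). F' x t) \<in> borel_measurable (lborel \<Otimes>\<^sub>M lborel)"
    and diff: "(\<lambda>x. F x 1 - F x 0) \<in> borel_measurable borel"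
    and int: "\<And>t. t \<in> {0..1} \<Longrightarrow> integrable lborel (\<lambda>x. F' x t)"
    and B: "\<And>t. t \<in> {0..1} \<Longrightarrow> L1_norm (\<lambda>x. F' x t) \<le> B"
  shows "L1_norm (\<lambda>x. F x 1 - F x 0) \<le> B"
proof -
  have B0: "0 \<le> B" using B[of 0] L1_norm_nonneg[of "\<lambda>x. F' x 0"] by simp
  have pt: "ennreal (norm (F x 1 - F x 0)) \<le> (\<integral>\<^sup>+t. ennreal (norm (F' x t)) * indicator {0..1} t \<partial>lborel)" for x
  proof -
    have hi: "(F' x has_integral F x 1 - F x 0) {0..1}"
      by (rule fundamental_theorem_of_calculus) (auto intro: has_vector_derivative_at_within der)
    have cn: "continuous_on {0..1} (\<lambda>t. norm (F' x t))" using cont by (intro continuous_on_norm) auto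
    have "norm (F x 1 - F x 0) = norm (integral {0..1} (F' x))" using hi by (simp add: integral_unique)
    also have "\<dots> \<le> integral {0..1} (\<lambda>t. norm (F' x t))"
      using hi cn by (intro integral_norm_bound_integral) (auto intro: integrable_continuous_real)
    finally have "ennreal (norm (F x 1 - F x 0)) \<le> ennreal (integral {0..1} (\<lambda>t. norm (F' x t)))"
      by (rule ennreal_leI)
    also have "\<dots> = (\<integral>\<^sup>+t. ennreal (norm (F' x t)) * indicator {0..1} t \<partial>lborel)"
    proof -
      have "(\<integral>\<^sup>+t. ennreal (norm (F' x t)) * indicator {0..1} t \<partial>lborel) = (\<integral>\<^sup>+t. ennreal (indicator {0..1} t *\<^sub>R norm (F' x t)) \<partial>lborel)"
        by (intro nn_integral_cong) (simp split: split_indicator)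
      also have "\<dots> = ennreal (LINT t|lborel. indicator {0..1} t *\<^sub>R norm (F' x t))"
        using borel_integrable_atLeastAtMost'[OF cn]
        by (intro nn_integral_eq_integral) (auto simp: set_integrable_def)
      also have "(LINT t|lborel. indicator {0..1} t *\<^sub>R norm (F' x t)) = integral {0..1} (\<lambda>t. norm (F' x t))"
        using set_borel_integral_eq_integral(2)[OF borel_integrable_atLeastAtMost'[OF cn]]
        by (simp add: set_lebesgue_integral_def)
      finally show ?thesis by simp
    qed
    finally show ?thesis .
  qed
  have meas' [measurable]: "(\<lambda>p. F' (fst p) (snd p)) \<in> borel_measurable (lborel \<Otimes>\<^sub>M lborel)"
    using meas by (simp add: split_beta)
  have "(\<integral>\<^sup>+x. ennreal (norm (F x 1 - F x 0)) \<partial>lborel) \<le> (\<integral>\<^sup>+x. (\<integral>\<^sup>+t. ennreal (norm (F' x t)) * indicator {0..1} t \<partial>lborel) \<partial>lborel)"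
    by (intro nn_integral_mono pt)
  also have "\<dots> = (\<integral>\<^sup>+t. (\<integral>\<^sup>+x. ennreal (norm (F' x t)) * indicator {0..1} t \<partial>lborel) \<partial>lborel)"
  proof (rule lborel_pair.Fubini'[symmetric])
    show "(\<lambda>(t, x). ennreal (norm (F' t x)) * indicator {0..1} x) \<in> borel_measurable (lborel \<Otimes>\<^sub>M lborel)"
      unfolding split_beta by measurable
  qed
  also have "\<dots> \<le> (\<integral>\<^sup>+t. ennreal B * indicator {0..1} t \<partial>(lborel :: real measure))"
  proof (rule nn_integral_mono)
    fix t :: real
    show "(\<integral>\<^sup>+x. ennreal (norm (F' x t)) * indicator {0..1} t \<partial>lborel) \<le> ennreal B * indicator {0..1} t"
    proof (cases "t \<in> {0..1}")
      case True
      then show ?thesis using nn_integral_norm_eq_L1[OF int[OF True]] B[OF True] by (simp add: ennreal_leI)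
    qed simp
  qed
  also have "\<dots> = ennreal B"
    by (subst nn_integral_cmult_indicator) auto
  finally show ?thesis by (rule L1_norm_leI(2)[OF diff _ B0])
qed

lemma borel_measurable_along_line:
  fixes f :: "'n::finite cfun"
  assumes "f \<in> borel_measurable borel"
  shows "(\<lambda>p. f (fst p + snd p *\<^sub>R h)) \<in> borel_measurable (lborel \<Otimes>\<^sub>M lborel)"
proof -
  have "(\<lambda>p :: (real ^ 'n) \<times> real. fst p + snd p *\<^sub>R h) \<in> borel_measurable (lborel \<Otimes>\<^sub>M lborel)"
    by measurable
  then show ?thesis using assms by (rule measurable_compose)
qed

lemma L1_translate_le:
  fixes f :: "'n::finite cfun"
  assumes f: "f \<in> D_L1"
  shows "L1_norm (\<lambda>x. f (x + h) - f x) \<le> (\<Sum>i\<in>UNIV. \<bar>h $ i\<bar> * L1_norm (partial i f))"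
proof -
  note s = D_L1_smooth[OF f]
  have [measurable]: "f \<in> borel_measurable borel" by (rule D_L1_borel[OF f])
  have int: "integrable lborel (\<lambda>x. partial i f (x + t *\<^sub>R h))" for i t
    by (rule integrable_translate[OF D_L1_integrable[OF D_L1_partial[OF f]]])
  have "L1_norm (\<lambda>x. f (x + 1 *\<^sub>R h) - f (x + 0 *\<^sub>R h)) \<le> (\<Sum>i\<in>UNIV. \<bar>h $ i\<bar> * L1_norm (partial i f))"
  proof (rule L1_norm_increment_le[where F = "\<lambda>x t. f (x + t *\<^sub>R h)" and F' = "\<lambda>x t. \<Sum>i\<in>UNIV. (h $ i) *\<^sub>R partial i f (x + t *\<^sub>R h)"])
    show "((\<lambda>t. f (x + t *\<^sub>R h)) has_vector_derivative (\<Sum>i\<in>UNIV. (h $ i) *\<^sub>R partial i f (x + t *\<^sub>R h))) (at t)" for x t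
      by (rule line_derivative[OF smooth_differentiable[OF s]])
    show "continuous_on {0..1} (\<lambda>t. \<Sum>i\<in>UNIV. (h $ i) *\<^sub>R partial i f (x + t *\<^sub>R h))" for x
      by (intro continuous_on_sum continuous_on_scaleR continuous_on_const continuous_on_compose2[OF smooth_continuous[OF smooth_partial[OF s]]] continuous_on_add continuous_on_id) auto
    show "(\<lambda>(x, t). \<Sum>i\<in>UNIV. (h $ i) *\<^sub>R partial i f (x + t *\<^sub>R h)) \<in> borel_measurable (lborel \<Otimes>\<^sub>M lborel)"
      unfolding split_beta
      by (intro borel_measurable_sum borel_measurable_scaleR borel_measurable_const borel_measurable_along_line D_L1_borel[OF D_L1_partial[OF f]])
    show "(\<lambda>x. f (x + 1 *\<^sub>R h) - f (x + 0 *\<^sub>R h)) \<in> borel_measurable borel" by measurable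
    show "integrable lborel (\<lambda>x. \<Sum>i\<in>UNIV. (h $ i) *\<^sub>R partial i f (x + t *\<^sub>R h))" for t
      by (intro Bochner_Integration.integrable_sum integrable_scaleR_right int)
    show "L1_norm (\<lambda>x. \<Sum>i\<in>UNIV. (h $ i) *\<^sub>R partial i f (x + t *\<^sub>R h)) \<le> (\<Sum>i\<in>UNIV. \<bar>h $ i\<bar> * L1_norm (partial i f))" for t
    proof -
      have "L1_norm (\<lambda>x. \<Sum>i\<in>UNIV. (h $ i) *\<^sub>R partial i f (x + t *\<^sub>R h)) \<le>
          (LINT x|lborel. (\<Sum>i\<in>UNIV. \<bar>h $ i\<bar> * norm (partial i f (x + t *\<^sub>R h))))"
        unfolding L1_norm_def
      proof (rule integral_mono)
        show "norm (\<Sum>i\<in>UNIV. (h $ i) *\<^sub>R partial i f (x + t *\<^sub>R h)) \<le> (\<Sum>i\<in>UNIV. \<bar>h $ i\<bar> * norm (partial i f (x + t *\<^sub>R h)))" for x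
          by (rule order_trans[OF norm_sum]) simp
      qed (auto intro!: integrable_norm Bochner_Integration.integrable_sum integrable_scaleR_right int integrable_mult_right)
      also have "\<dots> = (\<Sum>i\<in>UNIV. \<bar>h $ i\<bar> * L1_norm (\<lambda>x. partial i f (x + t *\<^sub>R h)))"
        by (simp add: Bochner_Integration.integral_sum int integrable_norm L1_norm_def)
      finally show ?thesis
        by (simp add: L1_norm_translate D_L1_borel[OF D_L1_partial[OF f]])
    qed
  qed
  then show ?thesis by simp
qed

lemma L1_translate_le_norm:
  assumes f: "f \<in> D_L1"
  shows "L1_norm (\<lambda>x. f (x + h) - f x) \<le> norm h * (\<Sum>i\<in>UNIV. L1_norm (partial i f))"
  unfolding sum_distrib_left
  by (rule order_trans[OF L1_translate_le[OF f]])
    (intro sum_mono mult_right_mono component_le_norm_cart L1_norm_nonneg)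

text \<open>
  The first-order estimate is applied to the integrand \<open>\<Sum>\<^sub>i h\<^sub>i (\<partial>\<^sub>i f (x + t h) - \<partial>\<^sub>i f x)\<close> of the remainder.
\<close>

lemma L1_taylor_le:
  fixes f :: "'n::finite cfun"
  assumes f: "f \<in> D_L1"
  shows "L1_norm (\<lambda>x. f (x + h) - f x - (\<Sum>i\<in>UNIV. (h $ i) *\<^sub>R partial i f x))
    \<le> (norm h)\<^sup>2 * (\<Sum>i\<in>UNIV. \<Sum>j\<in>UNIV. L1_norm (partial j (partial i f)))"
proof -
  note s = D_L1_smooth[OF f]
  have [measurable]: "f \<in> borel_measurable borel" "partial i f \<in> borel_measurable borel" for i
    by (auto intro: D_L1_borel f D_L1_partial)
  have int: "integrable lborel (\<lambda>x. partial i f (x + t *\<^sub>R h) - partial i f x)" for i t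
    by (intro Bochner_Integration.integrable_diff integrable_translate D_L1_integrable D_L1_partial f)
  let ?F = "\<lambda>x t. f (x + t *\<^sub>R h) - t *\<^sub>R (\<Sum>i\<in>UNIV. (h $ i) *\<^sub>R partial i f x)"
  let ?F' = "\<lambda>x t. \<Sum>i\<in>UNIV. (h $ i) *\<^sub>R (partial i f (x + t *\<^sub>R h) - partial i f x)"
  let ?B = "(norm h)\<^sup>2 * (\<Sum>i\<in>UNIV. \<Sum>j\<in>UNIV. L1_norm (partial j (partial i f)))"
  have "L1_norm (\<lambda>x. ?F x 1 - ?F x 0) \<le> ?B"
  proof (rule L1_norm_increment_le[where F = ?F and F' = ?F'])
    show "((\<lambda>t. f (x + t *\<^sub>R h) - t *\<^sub>R (\<Sum>i\<in>UNIV. (h $ i) *\<^sub>R partial i f x)) has_vector_derivative ?F' x t) (at t)" for x t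
    proof -
      have "((\<lambda>t. f (x + t *\<^sub>R h) - t *\<^sub>R (\<Sum>i\<in>UNIV. (h $ i) *\<^sub>R partial i f x)) has_vector_derivative
          (\<Sum>i\<in>UNIV. (h $ i) *\<^sub>R partial i f (x + t *\<^sub>R h)) - 1 *\<^sub>R (\<Sum>i\<in>UNIV. (h $ i) *\<^sub>R partial i f x)) (at t)"
        by (intro has_vector_derivative_diff line_derivative[OF smooth_differentiable[OF s]])
          (auto intro!: derivative_eq_intros simp: has_vector_derivative_def)
      then show ?thesis by (simp add: scaleR_diff_right sum_subtractf)
    qed
    show "continuous_on {0..1} (?F' x)" for x
      by (intro continuous_on_sum continuous_on_scaleR continuous_on_diff continuous_on_const continuous_on_compose2[OF smooth_continuous[OF smooth_partial[OF s]]] continuous_on_add continuous_on_id) auto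
    show "(\<lambda>(x, t). ?F' x t) \<in> borel_measurable (lborel \<Otimes>\<^sub>M lborel)"
      unfolding split_beta
      by (intro borel_measurable_sum borel_measurable_scaleR borel_measurable_const borel_measurable_diff borel_measurable_along_line D_L1_borel[OF D_L1_partial[OF f]] measurable_compose[OF measurable_fst]) measurable
    show "(\<lambda>x. ?F x 1 - ?F x 0) \<in> borel_measurable borel" by measurable
    show "integrable lborel (\<lambda>x. ?F' x t)" for t
      by (intro Bochner_Integration.integrable_sum integrable_scaleR_right int)
    show "L1_norm (\<lambda>x. ?F' x t) \<le> ?B" if t: "t \<in> {0..1}" for t
    proof -
      have "L1_norm (\<lambda>x. ?F' x t) \<le> (LINT x|lborel. (\<Sum>i\<in>UNIV. \<bar>h $ i\<bar> * norm (partial i f (x + t *\<^sub>R h) - partial i f x)))"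
        unfolding L1_norm_def
      proof (rule integral_mono)
        show "norm (?F' x t) \<le> (\<Sum>i\<in>UNIV. \<bar>h $ i\<bar> * norm (partial i f (x + t *\<^sub>R h) - partial i f x))" for x
          by (rule order_trans[OF norm_sum]) simp
      qed (auto intro!: integrable_norm Bochner_Integration.integrable_sum integrable_scaleR_right int integrable_mult_right)
      also have "\<dots> = (\<Sum>i\<in>UNIV. \<bar>h $ i\<bar> * L1_norm (\<lambda>x. partial i f (x + t *\<^sub>R h) - partial i f x))"
        by (simp add: Bochner_Integration.integral_sum int integrable_norm L1_norm_def)
      also have "\<dots> \<le> (\<Sum>i\<in>UNIV. norm h * (norm h * (\<Sum>j\<in>UNIV. L1_norm (partial j (partial i f)))))"
      proof (intro sum_mono mult_mono component_le_norm_cart)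
        fix i
        have "L1_norm (\<lambda>x. partial i f (x + t *\<^sub>R h) - partial i f x) \<le> norm (t *\<^sub>R h) * (\<Sum>j\<in>UNIV. L1_norm (partial j (partial i f)))"
          by (rule L1_translate_le_norm[OF D_L1_partial[OF f]])
        also have "\<dots> \<le> norm h * (\<Sum>j\<in>UNIV. L1_norm (partial j (partial i f)))"
          using t by (intro mult_right_mono sum_nonneg L1_norm_nonneg) (auto simp: mult_left_le_one_le)
        finally show "L1_norm (\<lambda>x. partial i f (x + t *\<^sub>R h) - partial i f x) \<le> norm h * (\<Sum>j\<in>UNIV. L1_norm (partial j (partial i f)))" .
      qed (auto simp: L1_norm_nonneg)
      also have "\<dots> = ?B" by (simp add: sum_distrib_left power2_eq_square mult.assoc)
      finally show ?thesis .
    qed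
  qed
  then show ?thesis by (simp add: algebra_simps)
qed

section \<open>Correlation with a bounded function\<close>

text \<open>
  In the applications \<open>w\<close> is either a mollifier, or a phase times a weight that turns an integral norm of \<open>f\<close> into
  the value at \<open>0\<close>.
\<close>

definition corr :: "'n::finite cfun \<Rightarrow> 'n cfun \<Rightarrow> 'n cfun" where
  "corr w f h = (LINT x|lborel. w x * f (x + h))"

lemma has_derivativeI_quadratic:
  fixes F :: "'a::real_normed_vector \<Rightarrow> 'b::real_normed_vector"
  assumes L: "bounded_linear L" and C: "\<And>k. norm (F (h + k) - F h - L k) \<le> C * (norm k)\<^sup>2"
  shows "(F has_derivative L) (at h)"
proof -
  have "((\<lambda>k. norm (F (h + k) - F h - L k) / norm k) \<longlongrightarrow> 0) (at 0)"
  proof (rule Lim_null_comparison)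
    have "norm (norm (F (h + k) - F h - L k) / norm k) \<le> C * norm k" if "k \<noteq> 0" for k
    proof -
      have "norm (F (h + k) - F h - L k) / norm k \<le> C * (norm k)\<^sup>2 / norm k"
        by (rule divide_right_mono[OF C]) simp
      then show ?thesis using that by (simp add: power2_eq_square)
    qed
    then show "\<forall>\<^sub>F k in at 0. norm (norm (F (h + k) - F h - L k) / norm k) \<le> C * norm k"
      by (simp add: eventually_at_filter)
    show "((\<lambda>k. C * norm k) \<longlongrightarrow> 0) (at 0)"
      using tendsto_mult_right_zero[OF tendsto_norm_zero[OF tendsto_ident_at]] .
  qed
  then show ?thesis unfolding has_derivative_at using L by blast
qed

lemma norm_corr_le:
  assumes "integrable lborel f" "weight w"
  shows "norm (corr w f h) \<le> L1_norm (\<lambda>x. w x * f (x + h))"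
  unfolding corr_def L1_norm_def by (rule integral_norm_bound)

lemma norm_corr_le_bound:
  assumes f: "integrable lborel f" and w: "weight w" and A: "\<And>x. norm (w x) \<le> A"
  shows "norm (corr w f h) \<le> A * L1_norm f"
proof -
  have "L1_norm (\<lambda>x. w x * f (x + h)) \<le> A * L1_norm (\<lambda>x. f (x + h))"
    using w A by (intro L1_norm_mult_le integrable_translate f) (auto simp: weight_def)
  then show ?thesis
    using norm_corr_le[OF f w, of h] L1_norm_translate[of f h] f by simp
qed

text \<open>
  The Taylor estimate in the mean bounds the remainder of the correlation, because \<open>w\<close> is bounded; all
  derivatives fall on \<open>f\<close>.
\<close>

lemma corr_has_derivative:
  assumes f: "f \<in> D_L1" and w: "weight w"
  shows "(corr w f has_derivative (\<lambda>k. \<Sum>i\<in>UNIV. (k $ i) *\<^sub>R corr w (partial i f) h)) (at h)"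
proof -
  obtain A where A: "0 < A" "\<And>x. norm (w x) \<le> A" using weight_bound[OF w] by blast
  let ?C = "A * (\<Sum>i\<in>UNIV. \<Sum>j\<in>UNIV. L1_norm (partial j (partial i f)))"
  have int: "integrable lborel (\<lambda>x. w x * g (x + h))" if "g \<in> D_L1" for g h
    by (intro weight_integrable w integrable_translate D_L1_integrable that)
  have sint: "integrable lborel (\<lambda>x. w x * ((k $ i) *\<^sub>R partial i f (x + h)))" for i k
    by (intro weight_integrable w integrable_scaleR_right integrable_translate D_L1_integrable D_L1_partial f)
  show ?thesis
  proof (rule has_derivativeI_quadratic[where C = ?C])
    show "bounded_linear (\<lambda>k. \<Sum>i\<in>UNIV. (k $ i) *\<^sub>R corr w (partial i f) h)"
      by (intro bounded_linear_sum bounded_linear_scaleR_left[THEN bounded_linear_compose] bounded_linear_vec_nth)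
    fix k
    let ?r = "\<lambda>x. f (x + k) - f x - (\<Sum>i\<in>UNIV. (k $ i) *\<^sub>R partial i f x)"
    have [measurable]: "f \<in> borel_measurable borel" "partial i f \<in> borel_measurable borel" for i
      by (auto intro: D_L1_borel f D_L1_partial)
    have r_int: "integrable lborel ?r"
      by (intro Bochner_Integration.integrable_diff Bochner_Integration.integrable_sum integrable_scaleR_right integrable_translate D_L1_integrable D_L1_partial f)
    have "corr w f (h + k) - corr w f h - (\<Sum>i\<in>UNIV. (k $ i) *\<^sub>R corr w (partial i f) h)
      = (LINT x|lborel. w x * f (x + (h + k))) - (LINT x|lborel. w x * f (x + h)) - (LINT x|lborel. (\<Sum>i\<in>UNIV. w x * ((k $ i) *\<^sub>R partial i f (x + h))))"
    proof -
      have "(LINT x|lborel. (\<Sum>i\<in>UNIV. w x * ((k $ i) *\<^sub>R partial i f (x + h)))) = (\<Sum>i\<in>UNIV. (k $ i) *\<^sub>R corr w (partial i f) h)"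
        by (subst Bochner_Integration.integral_sum[OF sint]) (simp add: corr_def)
      then show ?thesis by (simp add: corr_def)
    qed
    also have "\<dots> = (LINT x|lborel. w x * f (x + (h + k)) - w x * f (x + h) - (\<Sum>i\<in>UNIV. w x * ((k $ i) *\<^sub>R partial i f (x + h))))"
      using int[OF f, of "h + k"] int[OF f, of h] sint
      by (subst Bochner_Integration.integral_diff, auto intro!: Bochner_Integration.integrable_diff Bochner_Integration.integrable_sum)+
    also have "\<dots> = corr w ?r h"
      unfolding corr_def by (simp add: algebra_simps sum_distrib_left)
    finally have "corr w f (h + k) - corr w f h - (\<Sum>i\<in>UNIV. (k $ i) *\<^sub>R corr w (partial i f) h) = corr w ?r h" .
    moreover have "norm (corr w ?r h) \<le> A * ((norm k)\<^sup>2 * (\<Sum>i\<in>UNIV. \<Sum>j\<in>UNIV. L1_norm (partial j (partial i f))))"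
      using norm_corr_le_bound[OF r_int w A(2), of h] mult_left_mono[OF L1_taylor_le[OF f, of k], of A] A(1) by linarith
    ultimately show "norm (corr w f (h + k) - corr w f h - (\<Sum>i\<in>UNIV. (k $ i) *\<^sub>R corr w (partial i f) h)) \<le> ?C * (norm k)\<^sup>2"
      by (simp add: mult_ac)
  qed
qed

lemma partial_corr:
  assumes f: "f \<in> D_L1" and w: "weight w"
  shows "partial i (corr w f) = corr w (partial i f)"
proof
  fix h
  have "(\<Sum>j\<in>UNIV. (axis i 1 $ j) *\<^sub>R corr w (partial j f) h) = corr w (partial i f) h"
    by (subst sum.remove[of _ i]) (auto simp: axis_def intro!: sum.neutral)
  then show "partial i (corr w f) h = corr w (partial i f) h"
    using partial_eqI[OF corr_has_derivative[OF f w]] by simp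
qed

lemma smooth_corr:
  assumes f: "f \<in> D_L1" and w: "weight w"
  shows "smooth (corr w f)" and "ders is (corr w f) = corr w (ders is f)"
proof -
  show "smooth (corr w f)"
  proof (rule smooth_coinduct[of _ "corr w ` D_L1"])
    show "g differentiable (at x)" if "g \<in> corr w ` D_L1" for g x
      using that corr_has_derivative[OF _ w] differentiableI by blast
    show "partial i g \<in> corr w ` D_L1" if "g \<in> corr w ` D_L1" for g i
      using that partial_corr[OF _ w] D_L1_partial by blast
  qed (use f in blast)
  show "ders is (corr w f) = corr w (ders is f)"
    by (induction "is") (simp_all add: partial_corr[OF D_L1_ders[OF f] w])
qed

text \<open>
  The correlation with \<open>1\<close> is constant by translation invariance, so its derivative, which is the integral of
  \<open>\<partial>\<^sub>i f\<close>, vanishes. Applied to products this is integration by parts.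
\<close>

lemma integral_partial_eq_0:
  assumes f: "f \<in> D_L1"
  shows "(LINT x|lborel. partial i f x) = 0"
proof -
  have "corr (\<lambda>x. 1) f = (\<lambda>h. LINT x|lborel. f x)"
    using integral_translate[OF D_L1_borel[OF f]] by (simp add: corr_def[abs_def])
  then have "partial i (corr (\<lambda>x. 1) f) = (\<lambda>h. 0)" by simp
  then have "corr (\<lambda>x. 1) (partial i f) 0 = 0" using partial_corr[OF f weight_const] by metis
  then show ?thesis by (simp add: corr_def)
qed

lemma bdd_smooth_ders:
  assumes "bdd_smooth k"
  shows "bdd_smooth (ders js k)"
proof -
  have "bounded (range (ders (is @ js) k))" for "is" using assms unfolding bdd_smooth_def by blast
  moreover have "smooth (ders js k)" using assms smooth_ders unfolding bdd_smooth_def by blast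
  ultimately show ?thesis unfolding bdd_smooth_def by simp
qed

lemma corr_partial:
  assumes k: "bdd_smooth k" and f: "f \<in> D_L1"
  shows "corr k (partial i f) h = - corr (partial i k) f h"
proof -
  have pk: "bdd_smooth (partial i k)" using bdd_smooth_ders[OF k, of "[i]"] by simp
  have sk: "smooth k" using k by (simp add: bdd_smooth_def)
  have tf: "(\<lambda>x. f (x + h)) \<in> D_L1" by (rule D_L1_translate[OF f])
  have pt: "partial i (\<lambda>x. f (x + h)) = (\<lambda>x. partial i f (x + h))"
    using smooth_affine(2)[OF D_L1_smooth[OF f], of "[i]" h 1] by (simp add: add.commute)
  have "partial i (\<lambda>x. k x * f (x + h)) = (\<lambda>x. partial i k x * f (x + h) + k x * partial i f (x + h))"
    using partial_mult[OF smooth_differentiable[OF sk] smooth_differentiable[OF D_L1_smooth[OF tf]], where i = i] pt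
    by (auto simp: fun_eq_iff)
  then have "0 = (LINT x|lborel. partial i k x * f (x + h) + k x * partial i f (x + h))"
    using integral_partial_eq_0[OF D_L1_mult[OF k tf], of i] by simp
  also have "\<dots> = corr (partial i k) f h + corr k (partial i f) h"
    unfolding corr_def
    by (intro Bochner_Integration.integral_add weight_integrable bdd_smooth_weight k pk integrable_translate D_L1_integrable D_L1_partial f)
  finally show ?thesis by (simp add: eq_neg_iff_add_eq_0 add.commute)
qed

text \<open>
  Integration by parts moves all derivatives to the smooth kernel.
\<close>

lemma norm_corr_ders:
  assumes k: "bdd_smooth k" and f: "f \<in> D_L1"
  shows "norm (corr k (ders is f) h) = norm (corr (ders (rev is) k) f h)"
  using k
proof (induction "is" arbitrary: k)
  case (Cons i "is")
  have "norm (corr k (partial i (ders is f)) h) = norm (corr (partial i k) (ders is f) h)"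
    by (simp add: corr_partial[OF Cons.prems D_L1_ders[OF f]])
  also have "\<dots> = norm (corr (ders (rev is) (partial i k)) f h)"
    using bdd_smooth_ders[OF Cons.prems, of "[i]"] by (intro Cons.IH) simp
  finally show ?case by simp
qed simp

text \<open>
  Young's inequality, by Tonelli. The case \<open>c = 0\<close> bounds a correlation; the case \<open>c = 1\<close>, with \<open>B\<close> bounding only
  the translations by points where \<open>k\<close> does not vanish, bounds the error of a mollification.
\<close>

lemma L1_norm_corr_diff_le:
  fixes k f :: "'n::finite cfun"
  assumes k: "weight k" "integrable lborel k" and f: "integrable lborel f"
    and G: "G \<in> borel_measurable borel" "\<And>h. norm (G h) \<le> L1_norm (\<lambda>x. k x * (f (x + h) - c * f h))"
    and B: "\<And>x. k x \<noteq> 0 \<Longrightarrow> L1_norm (\<lambda>h. f (h + x) - c * f h) \<le> B" and B0: "0 \<le> B"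
  shows "integrable lborel G" "L1_norm G \<le> B * L1_norm k"
proof -
  have [measurable]: "k \<in> borel_measurable borel" "f \<in> borel_measurable borel"
    using k f by auto
  have nn: "ennreal (norm (G h)) \<le> (\<integral>\<^sup>+x. ennreal (norm (k x * (f (x + h) - c * f h))) \<partial>lborel)" for h
  proof -
    have ik: "integrable lborel (\<lambda>x. k x * (f (x + h) - c * f h))"
    proof -
      have "integrable lborel (\<lambda>x. k x * f (x + h) - (c * f h) * k x)"
        by (intro Bochner_Integration.integrable_diff weight_integrable k integrable_translate f integrable_mult_right)
      then show ?thesis by (simp add: algebra_simps)
    qed
    show ?thesis unfolding nn_integral_norm_eq_L1[OF ik] by (rule ennreal_leI[OF G(2)])
  qed
  have "(\<integral>\<^sup>+h. ennreal (norm (G h)) \<partial>lborel) \<le> (\<integral>\<^sup>+h. (\<integral>\<^sup>+x. ennreal (norm (k x * (f (x + h) - c * f h))) \<partial>lborel) \<partial>lborel)"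
    by (rule nn_integral_mono) (rule nn)
  also have "\<dots> = (\<integral>\<^sup>+x. (\<integral>\<^sup>+h. ennreal (norm (k x * (f (x + h) - c * f h))) \<partial>lborel) \<partial>lborel)"
    by (rule lborel_pair.Fubini') measurable
  also have "\<dots> \<le> (\<integral>\<^sup>+x. ennreal (norm (B * norm (k x))) \<partial>lborel)"
  proof (rule nn_integral_mono)
    fix x
    have id: "integrable lborel (\<lambda>h. f (h + x) - c * f h)"
      by (intro Bochner_Integration.integrable_diff integrable_translate f integrable_mult_right)
    have "(\<integral>\<^sup>+h. ennreal (norm (k x * (f (x + h) - c * f h))) \<partial>lborel) = (\<integral>\<^sup>+h. ennreal (norm (k x)) * ennreal (norm (f (h + x) - c * f h)) \<partial>lborel)"
      by (simp add: norm_mult ennreal_mult add.commute)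
    also have "\<dots> = ennreal (norm (k x)) * ennreal (L1_norm (\<lambda>h. f (h + x) - c * f h))"
      by (subst nn_integral_cmult) (simp_all add: nn_integral_norm_eq_L1[OF id])
    also have "\<dots> \<le> ennreal (norm (B * norm (k x)))"
    proof (cases "k x = 0")
      case False
      have "norm (k x) * L1_norm (\<lambda>h. f (h + x) - c * f h) \<le> norm (k x) * B"
        by (rule mult_left_mono[OF B[OF False]]) simp
      then show ?thesis using B0 by (simp add: ennreal_mult[symmetric] L1_norm_nonneg ennreal_leI mult.commute)
    qed simp
    finally show "(\<integral>\<^sup>+h. ennreal (norm (k x * (f (x + h) - c * f h))) \<partial>lborel) \<le> ennreal (norm (B * norm (k x)))" .
  qed
  also have "\<dots> = ennreal (B * L1_norm k)"
  proof -
    have "integrable lborel (\<lambda>x. of_real B * k x)" using k(2) by simp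
    from nn_integral_norm_eq_L1[OF this] show ?thesis using B0 by (simp add: L1_norm_scale norm_mult abs_mult)
  qed
  finally show "integrable lborel G" "L1_norm G \<le> B * L1_norm k"
    using B0 L1_norm_nonneg[of k] G(1) by (auto intro: L1_norm_leI)
qed

lemma L1_norm_corr_le:
  fixes k f :: "'n::finite cfun"
  assumes k: "weight k" "integrable lborel k" and f: "f \<in> D_L1"
  shows "integrable lborel (corr k f)" "L1_norm (corr k f) \<le> L1_norm f * L1_norm k"
proof -
  have "corr k f \<in> borel_measurable borel" by (rule smooth_borel[OF smooth_corr(1)[OF f k(1)]])
  moreover have "norm (corr k f h) \<le> L1_norm (\<lambda>x. k x * (f (x + h) - 0 * f h))" for h
    using norm_corr_le[OF D_L1_integrable[OF f] k(1), of h] by simp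
  moreover have "L1_norm (\<lambda>h. f (h + x) - 0 * f h) \<le> L1_norm f" for x
    by (simp add: L1_norm_translate[OF D_L1_borel[OF f]])
  ultimately show "integrable lborel (corr k f)" "L1_norm (corr k f) \<le> L1_norm f * L1_norm k"
    using L1_norm_corr_diff_le[OF k D_L1_integrable[OF f], where c = 0] L1_norm_nonneg by blast+
qed

lemma corr_D_L1:
  assumes k: "weight k" "integrable lborel k" and f: "f \<in> D_L1"
  shows "corr k f \<in> D_L1"
  using smooth_corr[OF f k(1)] L1_norm_corr_le(1)[OF k D_L1_ders[OF f]] by (simp add: D_L1_iff)

section \<open>Mollifiers\<close>

definition mollifier :: "real \<Rightarrow> 'n::finite cfun \<Rightarrow> bool" where
  "mollifier d k \<longleftrightarrow> k \<in> test_functions \<and> integrable lborel k \<and> (LINT x|lborel. k x) = 1 \<and> L1_norm k = 1 \<and> (\<forall>x. k x \<noteq> 0 \<longrightarrow> norm x \<le> d)"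

lemma test_functions_D_L1:
  assumes "f \<in> test_functions"
  shows "f \<in> D_L1"
proof -
  have sf: "smooth f" and c: "compact (fun_support f)" using assms by (auto simp: test_functions_def)
  have "integrable lborel (ders is f)" for "is"
  proof -
    have "integrable lborel (\<lambda>x. indicator (fun_support f) x *\<^sub>R ders is f x)"
      by (rule borel_integrable_compact[OF c continuous_on_subset[OF smooth_continuous[OF smooth_ders[OF sf]]]]) simp
    moreover have "(\<lambda>x. indicator (fun_support f) x *\<^sub>R ders is f x) = ders is f"
      using ders_eq_0_off_support[of _ f "is"] by (auto simp: fun_eq_iff indicator_def)
    ultimately show ?thesis by simp
  qed
  then show ?thesis using sf by (simp add: D_L1_iff)
qed

lemma ex_mollifier:
  assumes d: "0 < d"
  shows "\<exists>k :: 'n::finite cfun. mollifier d k"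
proof -
  define u where "u = (cutoff (d / 2) :: 'n cfun)"
  have u: "u \<in> test_functions" unfolding u_def using d by (intro cutoff_test) simp
  have su: "smooth u" and int: "integrable lborel u"
    using u D_L1_integrable[OF test_functions_D_L1] by (auto simp: test_functions_def)
  define r where "r x = Re (u x)" for x
  have "\<exists>s. u x = of_real s \<and> 0 \<le> s \<and> s \<le> 1" for x unfolding u_def cutoff_def by (rule cutoff1_range)
  then have ur: "u x = of_real (r x)" "0 \<le> r x" "r x \<le> 1" for x unfolding r_def by (metis Re_complex_of_real)+
  have rint: "integrable lborel r" unfolding r_def[abs_def] using int by simp
  define c where "c = (LINT x|lborel. r x)"
  have "measure lborel (cball (0 :: real ^ 'n) (d / 2)) \<le> c"
  proof -
    have "(LINT x|lborel. indicator (cball (0 :: real ^ 'n) (d / 2)) x :: real) \<le> c"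
      unfolding c_def
    proof (rule integral_mono[OF _ rint])
      fix x :: "real ^ 'n"
      show "indicator (cball 0 (d / 2)) x \<le> r x"
        using ur(2)[of x] cutoff_eq_1[of "d / 2" x] d by (auto simp: indicator_def r_def u_def)
    qed (auto intro!: integrable_real_indicator emeasure_bounded_finite)
    then show ?thesis by simp
  qed
  moreover have "0 < measure lborel (cball (0 :: real ^ 'n) (d / 2))"
    using d content_cball_pos[of "d / 2" "0 :: real ^ 'n"] by simp
  ultimately have c: "0 < c" by linarith
  define k where "k x = of_real (1 / c) * u x" for x
  have "smooth k" unfolding k_def by (intro smooth_mult smooth_const su)
  moreover have "fun_support k = fun_support u" unfolding fun_support_def k_def using c by simp
  ultimately have "k \<in> test_functions" using u by (simp add: test_functions_def)
  moreover have "integrable lborel k" unfolding k_def[abs_def] using int by simp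
  moreover have "(LINT x|lborel. k x) = 1"
    unfolding k_def ur(1) using c by (simp add: c_def)
  moreover have "L1_norm k = 1"
  proof -
    have "norm (k x) = r x / c" for x
      unfolding k_def ur(1) using c ur(2)[of x] by (simp add: norm_mult norm_divide)
    then have "L1_norm k = c / c" by (simp add: L1_norm_def c_def)
    then show ?thesis using c by simp
  qed
  moreover have "norm x \<le> d" if "k x \<noteq> 0" for x
    using cutoff_eq_0[of "d / 2" x] that d by (force simp: k_def u_def)
  ultimately show ?thesis unfolding mollifier_def by blast
qed

lemma mollifier_weight: "mollifier d k \<Longrightarrow> weight k"
  unfolding mollifier_def using bdd_smooth_weight test_functions_bdd_smooth by blast

lemma mollifier_approx:
  fixes k f :: "'n::finite cfun"
  assumes k: "mollifier d k" and f: "f \<in> D_L1" and d: "0 \<le> d"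
  shows "L1_norm (\<lambda>x. f x - corr k f x) \<le> d * (\<Sum>i\<in>UNIV. L1_norm (partial i f))"
proof -
  have ki: "integrable lborel k" "(LINT x|lborel. k x) = 1" "L1_norm k = 1" and kd: "\<And>x. k x \<noteq> 0 \<Longrightarrow> norm x \<le> d"
    using k by (auto simp: mollifier_def)
  note w = mollifier_weight[OF k]
  let ?B = "d * (\<Sum>i\<in>UNIV. L1_norm (partial i f))"
  have S0: "0 \<le> (\<Sum>i\<in>UNIV. L1_norm (partial i f))" by (intro sum_nonneg L1_norm_nonneg)
  have "L1_norm (\<lambda>x. f x - corr k f x) \<le> ?B * L1_norm k"
  proof (rule L1_norm_corr_diff_le(2)[OF w ki(1) D_L1_integrable[OF f], where c = 1])
    show "(\<lambda>x. f x - corr k f x) \<in> borel_measurable borel"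
      using smooth_borel[OF smooth_corr(1)[OF f w]] D_L1_borel[OF f] by measurable
    show "norm (f h - corr k f h) \<le> L1_norm (\<lambda>x. k x * (f (x + h) - 1 * f h))" for h
    proof -
      have "(LINT x|lborel. k x * (f (x + h) - 1 * f h)) = (LINT x|lborel. k x * f (x + h) - f h * k x)"
        by (simp add: algebra_simps)
      also have "\<dots> = corr k f h - f h"
        unfolding corr_def using ki
        by (subst Bochner_Integration.integral_diff)
          (auto intro!: weight_integrable w integrable_translate D_L1_integrable[OF f])
      finally show ?thesis
        using integral_norm_bound[of lborel "\<lambda>x. k x * (f (x + h) - 1 * f h)"]
        by (simp add: L1_norm_def norm_minus_commute)
    qed
    show "L1_norm (\<lambda>h. f (h + x) - 1 * f h) \<le> ?B" if "k x \<noteq> 0" for x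
      using L1_translate_le_norm[OF f, of x] mult_right_mono[OF kd[OF that] S0] by simp
    show "0 \<le> ?B" using d S0 by simp
  qed
  then show ?thesis using ki by simp
qed

section \<open>Weights vanishing at infinity\<close>

text \<open>
  Take \<open>b y = sup\<^sub>z a z / (1 + |z - y|)\<close>. The inequality \<open>1 + |z - x| \<le> (1 + |h|) (1 + |z - (x + h)|)\<close> gives the slow
  variation, which in turn gives a Lipschitz bound.
\<close>

lemma ex_slow_majorant:
  fixes a :: "real ^ 'n::finite \<Rightarrow> real"
  assumes a0: "\<And>x. 0 \<le> a x" and aA: "\<And>x. a x \<le> A" and lim: "(a \<longlongrightarrow> 0) at_infinity"
  obtains b where "continuous_on UNIV b" "(b \<longlongrightarrow> 0) at_infinity" "\<And>x. a x \<le> b x" "\<And>x. b x \<le> A"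
    "\<And>x h. b (x + h) \<le> (1 + norm h) * b x"
proof -
  define b where "b y = (SUP z. a z / (1 + norm (z - y)))" for y
  have A0: "0 \<le> A" using a0[of 0] aA[of 0] by linarith
  have le_A: "a z / (1 + norm (z - y)) \<le> A" for z y
  proof -
    have "a z / (1 + norm (z - y)) \<le> a z / 1" using a0 by (intro divide_left_mono) (auto intro: add_pos_nonneg)
    then show ?thesis using aA[of z] by simp
  qed
  have bdd: "bdd_above (range (\<lambda>z. a z / (1 + norm (z - y))))" for y
    using le_A by (intro bdd_aboveI[of _ A]) auto
  have up: "a z / (1 + norm (z - y)) \<le> b y" for z y
    unfolding b_def by (rule cSUP_upper[OF _ bdd]) simp
  have lo: "b y \<le> c" if "\<And>z. a z / (1 + norm (z - y)) \<le> c" for y c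
    unfolding b_def using that by (intro cSUP_least) auto
  have ab: "a x \<le> b x" for x using up[of x x] by simp
  have bA: "b x \<le> A" for x by (rule lo[OF le_A])
  have b0: "0 \<le> b x" for x using ab a0 order_trans by blast
  have slow: "b (x + h) \<le> (1 + norm h) * b x" for x h
  proof (rule lo)
    fix z
    have "1 + norm (z - x) \<le> (1 + norm h) * (1 + norm (z - (x + h)))"
    proof -
      have "norm (z - x) \<le> norm (z - (x + h)) + norm h" using norm_triangle_ineq[of "z - (x + h)" h] by simp
      moreover have "0 \<le> norm h * norm (z - (x + h))" by simp
      moreover have "(1 + norm h) * (1 + norm (z - (x + h))) = 1 + norm h + norm (z - (x + h)) + norm h * norm (z - (x + h))"
        by (simp add: distrib_left distrib_right)
      ultimately show ?thesis by linarith
    qed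
    then have "a z * (1 + norm (z - x)) \<le> a z * ((1 + norm h) * (1 + norm (z - (x + h))))"
      by (rule mult_left_mono[OF _ a0])
    then have "a z / (1 + norm (z - (x + h))) \<le> (1 + norm h) * (a z / (1 + norm (z - x)))"
      by (simp add: field_simps add_pos_nonneg)
    also have "\<dots> \<le> (1 + norm h) * b x" by (intro mult_left_mono up) auto
    finally show "a z / (1 + norm (z - (x + h))) \<le> (1 + norm h) * b x" .
  qed
  have lip: "b y - b x \<le> A * norm (y - x)" for x y
  proof -
    have "b y \<le> b x + norm (y - x) * b x" using slow[of x "y - x"] by (simp add: algebra_simps)
    also have "\<dots> \<le> b x + norm (y - x) * A" by (intro add_left_mono mult_left_mono bA) auto
    finally show ?thesis by (simp add: mult.commute)
  qed
  have "A-lipschitz_on UNIV b"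
  proof (rule lipschitz_onI)
    show "dist (b x) (b y) \<le> A * dist x y" for x y
      using lip[of x y] lip[of y x] by (simp add: dist_norm norm_minus_commute abs_le_iff)
  qed (rule A0)
  then have cont: "continuous_on UNIV b" by (rule lipschitz_on_continuous_on)
  have "(b \<longlongrightarrow> 0) at_infinity"
  proof (rule tendstoI)
    fix e :: real assume e: "0 < e"
    obtain R where R: "\<And>x. R \<le> norm x \<Longrightarrow> a x < e / 2"
      using tendstoD[OF lim, of "e / 2"] e a0 unfolding eventually_at_infinity by (auto simp: dist_real_def)
    define S where "S = \<bar>R\<bar> + 2 * A / e"
    have "b y < e" if y: "S \<le> norm y" for y
    proof -
      have "b y \<le> e / 2"
      proof (rule lo)
        fix z
        show "a z / (1 + norm (z - y)) \<le> e / 2"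
        proof (cases "R \<le> norm z")
          case True
          have "a z / (1 + norm (z - y)) \<le> a z / 1" using a0 by (intro divide_left_mono) (auto intro: add_pos_nonneg)
          then show ?thesis using R[OF True] by linarith
        next
          case False
          have "norm y \<le> norm z + norm (z - y)" using norm_triangle_ineq[of z "y - z"] by (simp add: norm_minus_commute)
          then have "2 * A / e \<le> 1 + norm (z - y)" using y False unfolding S_def by linarith
          then have "A \<le> e / 2 * (1 + norm (z - y))" using e by (simp add: field_simps)
          then have "a z \<le> e / 2 * (1 + norm (z - y))" using aA[of z] by linarith
          then show ?thesis by (simp add: divide_le_eq add_pos_nonneg)
        qed
      qed
      then show ?thesis using e by linarith
    qed
    then show "\<forall>\<^sub>F x in at_infinity. dist (b x) 0 < e"
      unfolding eventually_at_infinity using b0 by (auto simp: dist_real_def intro!: exI[of _ S])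
  qed
  then show ?thesis using that[OF cont _ ab bA slow] by blast
qed

lemma C0_bounded:
  assumes "g \<in> C0"
  obtains A where "0 < A" "\<And>x. norm (g x) \<le> A"
proof -
  have g: "continuous_on UNIV g" "(g \<longlongrightarrow> 0) at_infinity" using assms by (auto simp: C0_def)
  obtain R where R: "\<And>x. R \<le> norm x \<Longrightarrow> norm (g x) < 1"
    using tendstoD[OF g(2), of 1] unfolding eventually_at_infinity by auto
  have "compact (g ` cball 0 R)"
    by (rule compact_continuous_image[OF continuous_on_subset[OF g(1)]]) auto
  then obtain B where B: "\<And>x. norm x \<le> R \<Longrightarrow> norm (g x) \<le> B"
    using compact_imp_bounded[of "g ` cball 0 R"] unfolding bounded_iff by (metis imageI mem_cball_0)
  have "norm (g x) \<le> max 1 B" for x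
    using R[of x] B[of x] by (cases "R \<le> norm x") (simp_all add: le_max_iff_disj)
  then show ?thesis by (intro that[of "max 1 B"]) auto
qed

lemma C0_weight: "g \<in> C0 \<Longrightarrow> weight g"
proof -
  assume g: "g \<in> C0"
  obtain A where "0 < A" "\<And>x. norm (g x) \<le> A" using C0_bounded[OF g] by blast
  then have "bounded (range g)" by (auto simp: bounded_iff)
  then show ?thesis using g by (simp add: weight_def C0_def borel_measurable_continuous_onI)
qed

section \<open>The interior gradient estimate\<close>

lemma second_derivative_at_min:
  fixes f f' :: "real \<Rightarrow> real"
  assumes f: "\<And>t. (f has_real_derivative f' t) (at t)" and f': "(f' has_real_derivative l) (at 0)"
    and d: "0 < d" and min: "\<And>t. \<bar>t\<bar> < d \<Longrightarrow> f 0 \<le> f t"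
  shows "0 \<le> l"
proof (rule ccontr)
  assume "\<not> 0 \<le> l"
  then have "l < 0" by simp
  have f0: "f' 0 = 0"
    by (rule DERIV_local_min[OF f d]) (use min in auto)
  obtain e where e: "0 < e" "\<And>h. 0 < h \<Longrightarrow> h < e \<Longrightarrow> f' (0 + h) < f' 0"
    using DERIV_neg_dec_right[OF f' \<open>l < 0\<close>] by blast
  define h where "h = min d e / 2"
  have h: "0 < h" "h < d" "h < e" unfolding h_def using d e by auto
  have "f h < f 0"
  proof (rule DERIV_neg_imp_decreasing_open[OF h(1)])
    show "\<exists>y. (f has_real_derivative y) (at x) \<and> y < 0" if "0 < x" "x < h" for x
      using f[of x] e(2)[of x] f0 that h by auto
    show "continuous_on {0..h} f"
      by (rule DERIV_continuous_on[OF f[THEN has_field_derivative_at_within]])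
  qed
  then show False using min[of h] h by simp
qed

text \<open>
  The derivative along coordinate lines, for real functions, as in the second derivative test at a minimum.
\<close>

definition pderiv_real :: "(real ^ 'n::finite \<Rightarrow> real) \<Rightarrow> 'n \<Rightarrow> (real ^ 'n \<Rightarrow> real) \<Rightarrow> bool" where
  "pderiv_real u j u' \<longleftrightarrow> (\<forall>x. ((\<lambda>t. u (x + t *\<^sub>R axis j 1)) has_real_derivative u' x) (at 0))"

lemma pderiv_real_at:
  assumes "pderiv_real u j u'"
  shows "((\<lambda>t. u (x + t *\<^sub>R axis j 1)) has_real_derivative u' (x + t *\<^sub>R axis j 1)) (at t)"
proof -
  have "((\<lambda>s. u (x + t *\<^sub>R axis j 1 + s *\<^sub>R axis j 1)) has_real_derivative u' (x + t *\<^sub>R axis j 1)) (at 0)"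
    using assms unfolding pderiv_real_def by blast
  then have "((\<lambda>s. u (x + (s + t) *\<^sub>R axis j 1)) has_real_derivative u' (x + t *\<^sub>R axis j 1)) (at 0)"
    by (simp add: algebra_simps)
  then show ?thesis using DERIV_shift[of "\<lambda>s. u (x + s *\<^sub>R axis j 1)" "u' (x + t *\<^sub>R axis j 1)" 0 t] by simp
qed

text \<open>
  The comparison argument of Gilbarg and Trudinger: in the half cube \<open>0 \<le> x\<^sub>i\<close>, \<open>|x\<^sub>j| \<le> 1\<close>, the odd part of \<open>u\<close> under
  the reflection \<open>r\<close> in the hyperplane \<open>x\<^sub>i = 0\<close> lies below a barrier that is at least \<open>M\<close> on the other faces and has Laplacian \<open>- N - 2e\<close>.
  Both functions vanish at \<open>0\<close>, so their derivatives in direction \<open>e\<^sub>i\<close> compare there.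
\<close>

lemma interior_gradient_one_sided:
  fixes u :: "real ^ 'n::finite \<Rightarrow> real" and M N :: real
  assumes cont: "continuous_on UNIV u"
    and du: "\<And>j. pderiv_real u j (du j)" and ddu: "\<And>j. pderiv_real (du j) j (ddu j)"
    and M: "\<And>x. (\<And>j. \<bar>x $ j\<bar> \<le> 1) \<Longrightarrow> \<bar>u x\<bar> \<le> M"
    and N: "\<And>x. (\<And>j. \<bar>x $ j\<bar> \<le> 1) \<Longrightarrow> \<bar>\<Sum>j\<in>UNIV. ddu j x\<bar> \<le> N"
  shows "du i 0 \<le> CARD('n) * M + N / 2"
proof (rule field_le_epsilon)
  fix e :: real assume e: "0 < e"
  define C where "C = CARD('n) * M + N / 2 + e"
  define r where "r x = x - (2 * x $ i) *\<^sub>R axis i 1" for x :: "real ^ 'n"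
  \<comment> \<open>the barrier minus the odd part\<close>
  define w where "w x = M * (x \<bullet> x) + C * (x $ i * (1 - x $ i)) - (u x - u (r x)) / 2" for x
  define dw where "dw j x = M * (2 * x $ j) + (if j = i then C * (1 - 2 * x $ i) else 0)
      - (du j x - (if j = i then - 1 else 1) * du j (r x)) / 2" for j x
  define ddw where "ddw j x = M * 2 + (if j = i then - 2 * C else 0) - (ddu j x - ddu j (r x)) / 2" for j x
  have M0: "0 \<le> M" using M[of 0] by simp
  have N0: "0 \<le> N" using N[of 0] by simp
  have C0: "0 \<le> C" unfolding C_def using M0 N0 e by simp
  have r_comp: "r x $ j = (if j = i then - x $ i else x $ j)" for x j
    by (simp add: r_def axis_def)
  have r_line: "r (x + t *\<^sub>R axis j 1) = r x + ((if j = i then - 1 else 1) * t) *\<^sub>R axis j 1" for x t j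
    by (auto simp: vec_eq_iff r_comp axis_def)
  \<comment> \<open>the chain rule for the reflection; the sign appears twice in second derivatives and cancels\<close>
  have ur: "((\<lambda>t. f (r (x + t *\<^sub>R axis j 1))) has_real_derivative (if j = i then - 1 else 1) * f' (r x)) (at 0)"
    if "pderiv_real f j f'" for f f' j x
  proof -
    define s where "s = (if j = i then - 1 else 1 :: real)"
    have "((\<lambda>t. f (r x + t *\<^sub>R axis j 1)) has_real_derivative f' (r x)) (at (s * 0))"
      using that unfolding pderiv_real_def by simp
    from DERIV_chain2[where f = "\<lambda>t. f (r x + t *\<^sub>R axis j 1)" and g = "\<lambda>t. s * t" and Db = s, OF this] have "((\<lambda>t. f (r x + (s * t) *\<^sub>R axis j 1)) has_real_derivative f' (r x) * s) (at 0)"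
      by (auto intro!: derivative_eq_intros)
    then show ?thesis unfolding r_line s_def by (simp add: mult.commute)
  qed
  have coord: "((\<lambda>t. (x + t *\<^sub>R axis j 1) $ k) has_real_derivative (if k = j then 1 else 0)) (at 0)" for x :: "real ^ 'n" and j k
    by (auto simp: axis_def intro!: derivative_eq_intros)
  have sq: "((\<lambda>t. (x + t *\<^sub>R axis j 1) \<bullet> (x + t *\<^sub>R axis j 1)) has_real_derivative 2 * x $ j) (at 0)" for x :: "real ^ 'n" and j
  proof -
    have "(\<lambda>t. (x + t *\<^sub>R axis j 1) \<bullet> (x + t *\<^sub>R axis j 1)) = (\<lambda>t. x \<bullet> x + 2 * t * x $ j + t * t)"
      by (simp add: fun_eq_iff inner_add_left inner_add_right inner_axis inner_axis' inner_axis_axis algebra_simps)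
    then show ?thesis by (auto intro!: derivative_eq_intros)
  qed
  have dw: "pderiv_real w j (dw j)" for j
    unfolding pderiv_real_def
  proof
    fix x
    have d: "((\<lambda>t. u (x + t *\<^sub>R axis j 1)) has_real_derivative du j x) (at 0)" using du unfolding pderiv_real_def by blast
    have 1: "((\<lambda>t. M * ((x + t *\<^sub>R axis j 1) \<bullet> (x + t *\<^sub>R axis j 1))) has_real_derivative M * (2 * x $ j)) (at 0)"
      by (rule DERIV_cmult[OF sq])
    have 2: "((\<lambda>t. C * ((x + t *\<^sub>R axis j 1) $ i * (1 - (x + t *\<^sub>R axis j 1) $ i))) has_real_derivative
        C * ((if i = j then 1 else 0) * (1 - (x + 0 *\<^sub>R axis j 1) $ i) + (0 - (if i = j then 1 else 0)) * (x + 0 *\<^sub>R axis j 1) $ i)) (at 0)"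
      by (intro DERIV_cmult DERIV_mult DERIV_diff DERIV_const coord)
    have 3: "((\<lambda>t. (u (x + t *\<^sub>R axis j 1) - u (r (x + t *\<^sub>R axis j 1))) / 2) has_real_derivative
        (du j x - (if j = i then - 1 else 1) * du j (r x)) / 2) (at 0)"
      by (intro DERIV_cdivide DERIV_diff d ur du)
    show "((\<lambda>t. w (x + t *\<^sub>R axis j 1)) has_real_derivative dw j x) (at 0)"
      unfolding w_def dw_def
      by (rule DERIV_cong[OF DERIV_diff[OF DERIV_add[OF 1 2] 3]]) (auto simp: algebra_simps)
  qed
  have ddw: "pderiv_real (dw j) j (ddw j)" for j
    unfolding pderiv_real_def
  proof
    fix x
    have d: "((\<lambda>t. du j (x + t *\<^sub>R axis j 1)) has_real_derivative ddu j x) (at 0)" using ddu unfolding pderiv_real_def by blast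
    have 1: "((\<lambda>t. M * (2 * (x + t *\<^sub>R axis j 1) $ j)) has_real_derivative M * (2 * (if j = j then 1 else 0))) (at 0)"
      by (intro DERIV_cmult coord)
    have 2: "((\<lambda>t. if j = i then C * (1 - 2 * (x + t *\<^sub>R axis j 1) $ i) else 0) has_real_derivative (if j = i then - 2 * C else 0)) (at 0)"
    proof (cases "j = i")
      case True
      show ?thesis unfolding if_P[OF True]
        by (rule DERIV_cong[OF DERIV_cmult[OF DERIV_diff[OF DERIV_const DERIV_cmult[OF coord]]]]) (simp add: True)
    qed simp
    define s where "s = (if j = i then - 1 else 1 :: real)"
    have ur': "((\<lambda>t. du j (r (x + t *\<^sub>R axis j 1))) has_real_derivative s * ddu j (r x)) (at 0)"
      unfolding s_def by (rule ur[OF ddu])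
    have "((\<lambda>t. (du j (x + t *\<^sub>R axis j 1) - s * du j (r (x + t *\<^sub>R axis j 1))) / 2) has_real_derivative (ddu j x - s * (s * ddu j (r x))) / 2) (at 0)"
      by (rule DERIV_cdivide[OF DERIV_diff[OF d DERIV_cmult[OF ur']]])
    moreover have "s * (s * y) = y" for y by (simp add: s_def)
    ultimately have 3: "((\<lambda>t. (du j (x + t *\<^sub>R axis j 1) - s * du j (r (x + t *\<^sub>R axis j 1))) / 2) has_real_derivative (ddu j x - ddu j (r x)) / 2) (at 0)"
      by simp
    show "((\<lambda>t. dw j (x + t *\<^sub>R axis j 1)) has_real_derivative ddw j x) (at 0)"
      unfolding dw_def ddw_def s_def[symmetric]
      by (rule DERIV_cong[OF DERIV_diff[OF DERIV_add[OF 1 2] 3]]) simp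
  qed
  define Q where "Q = {x :: real ^ 'n. (\<forall>j. \<bar>x $ j\<bar> \<le> 1) \<and> 0 \<le> x $ i}"
  have "compact Q"
  proof -
    have "Q = cbox (- 1) 1 \<inter> {x. 0 \<le> x $ i}"
      unfolding Q_def by (auto simp: mem_box_cart abs_le_iff)
    moreover have "closed {x :: real ^ 'n. 0 \<le> x $ i}"
      by (intro closed_Collect_le continuous_intros)
    ultimately show ?thesis by (simp add: compact_Int_closed)
  qed
  moreover have "continuous_on UNIV r" unfolding r_def by (intro continuous_intros)
  then have "continuous_on UNIV w"
    unfolding w_def by (intro continuous_intros cont continuous_on_compose2[OF cont]) auto
  then have "continuous_on Q w" by (rule continuous_on_subset) simp
  moreover have "0 \<in> Q" unfolding Q_def by simp
  ultimately obtain x0 where x0: "x0 \<in> Q" "\<And>y. y \<in> Q \<Longrightarrow> w x0 \<le> w y"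
    using continuous_attains_inf[of Q w] by blast
  have wpos: "0 \<le> w x0"
  proof (rule ccontr)
    assume neg: "\<not> 0 \<le> w x0"
    have x0Q: "\<bar>x0 $ j\<bar> \<le> 1" "0 \<le> x0 $ i" for j using x0(1) by (auto simp: Q_def)
    have bump: "0 \<le> C * (x0 $ i * (1 - x0 $ i))"
      using C0 x0Q(2) x0Q(1)[of i] by (intro mult_nonneg_nonneg) auto
    have rQ: "\<bar>r x0 $ j\<bar> \<le> 1" for j using x0Q(1) by (simp add: r_comp)
    have v: "(u x0 - u (r x0)) / 2 \<le> M"
      using abs_le_D1[OF M[OF x0Q(1)]] abs_le_D2[OF M[OF rQ]] by simp
    \<comment> \<open>a negative minimum is not attained on the boundary: the barrier is at least \<open>M\<close> if \<open>|x\<^sub>j| = 1\<close>, and the odd part vanishes if \<open>x\<^sub>i = 0\<close>\<close>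
    have lt1: "\<bar>x0 $ j\<bar> < 1" for j
    proof (rule ccontr)
      assume "\<not> \<bar>x0 $ j\<bar> < 1"
      then have "1 \<le> x0 \<bullet> x0"
        using component_le_norm_cart[of x0 j] power_mono[of 1 "norm x0" 2] by (simp add: power2_norm_eq_inner)
      then have "M * 1 \<le> M * (x0 \<bullet> x0)" by (rule mult_left_mono[OF _ M0])
      then show False using neg bump v unfolding w_def by linarith
    qed
    have gt0: "0 < x0 $ i"
    proof (rule ccontr)
      assume "\<not> 0 < x0 $ i"
      then have "x0 $ i = 0" using x0Q by simp
      then have "r x0 = x0" by (auto simp: vec_eq_iff r_comp)
      then have "w x0 = M * (x0 \<bullet> x0)" unfolding w_def using \<open>x0 $ i = 0\<close> by simp
      then show False using neg M0 by simp
    qed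
    have "0 \<le> ddw j x0" for j
    proof (rule second_derivative_at_min)
      show "((\<lambda>t. w (x0 + t *\<^sub>R axis j 1)) has_real_derivative dw j (x0 + t *\<^sub>R axis j 1)) (at t)" for t
        by (rule pderiv_real_at[OF dw])
      show "((\<lambda>t. dw j (x0 + t *\<^sub>R axis j 1)) has_real_derivative ddw j x0) (at 0)"
        using ddw unfolding pderiv_real_def by blast
      show "0 < min (x0 $ i) (1 - \<bar>x0 $ j\<bar>)" using gt0 lt1[of j] by simp
      fix t assume t: "\<bar>t\<bar> < min (x0 $ i) (1 - \<bar>x0 $ j\<bar>)"
      have "\<bar>(x0 + t *\<^sub>R axis j 1) $ k\<bar> \<le> 1" for k
        using t x0Q(1)[of k] by (cases "k = j") (auto simp: axis_def)
      moreover have "0 \<le> (x0 + t *\<^sub>R axis j 1) $ i"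
        using t x0Q(2) by (cases "i = j") (auto simp: axis_def)
      ultimately have "x0 + t *\<^sub>R axis j 1 \<in> Q" by (simp add: Q_def)
      then show "w (x0 + 0 *\<^sub>R axis j 1) \<le> w (x0 + t *\<^sub>R axis j 1)" using x0(2) by simp
    qed
    then have "0 \<le> (\<Sum>j\<in>UNIV. ddw j x0)" by (intro sum_nonneg) auto
    also have "\<dots> = CARD('n) * (M * 2) - 2 * C - ((\<Sum>j\<in>UNIV. ddu j x0) - (\<Sum>j\<in>UNIV. ddu j (r x0))) / 2"
      unfolding ddw_def by (simp add: sum.distrib sum_subtractf sum_divide_distrib[symmetric])
    also have "\<dots> \<le> CARD('n) * (M * 2) - 2 * C + N"
    proof -
      have *: "C' - (a - b) / 2 \<le> C' + N" if "- a \<le> N" "b \<le> N" for a b C' :: real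
        using that by (simp add: field_simps)
      show ?thesis by (rule *[OF abs_le_D2[OF N[OF x0Q(1)]] abs_le_D1[OF N[OF rQ]]])
    qed
    also have "\<dots> = - (2 * e)" unfolding C_def by simp
    finally show False using e by simp
  qed
  have line: "0 \<le> w (0 + t *\<^sub>R axis i 1)" if "0 \<le> t" "t \<le> 1" for t
  proof -
    have "t *\<^sub>R axis i 1 \<in> Q" using that by (auto simp: Q_def axis_def)
    then show ?thesis using x0(2) wpos by fastforce
  qed
  have der: "((\<lambda>t. w (0 + t *\<^sub>R axis i 1)) has_real_derivative C - du i 0) (at 0)"
  proof -
    have "dw i 0 = C - du i 0" by (simp add: dw_def r_def)
    then show ?thesis using dw[of i] unfolding pderiv_real_def by metis
  qed
  have w0: "w (0 + 0 *\<^sub>R axis i 1) = 0" by (simp add: w_def r_def)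
  have "\<not> C - du i 0 < 0"
  proof
    assume "C - du i 0 < 0"
    then obtain d where d: "0 < d" "\<And>h. 0 < h \<Longrightarrow> h < d \<Longrightarrow> w (0 + (0 + h) *\<^sub>R axis i 1) < w (0 + 0 *\<^sub>R axis i 1)"
      using DERIV_neg_dec_right[OF der] by blast
    define h where "h = min 1 (d / 2)"
    have h: "0 < h" "h < d" "h \<le> 1" unfolding h_def using d(1) by auto
    show False using line[of h] d(2)[OF h(1,2)] w0 h by simp
  qed
  then show "du i 0 \<le> CARD('n) * M + N / 2 + e" unfolding C_def by linarith
qed

lemma interior_gradient:
  fixes u :: "real ^ 'n::finite \<Rightarrow> real" and M N :: real
  assumes cont: "continuous_on UNIV u"
    and du: "\<And>j. pderiv_real u j (du j)" and ddu: "\<And>j. pderiv_real (du j) j (ddu j)"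
    and M: "\<And>x. (\<And>j. \<bar>x $ j\<bar> \<le> 1) \<Longrightarrow> \<bar>u x\<bar> \<le> M"
    and N: "\<And>x. (\<And>j. \<bar>x $ j\<bar> \<le> 1) \<Longrightarrow> \<bar>\<Sum>j\<in>UNIV. ddu j x\<bar> \<le> N"
  shows "\<bar>du i 0\<bar> \<le> CARD('n) * M + N / 2"
proof -
  have "- du i 0 \<le> CARD('n) * M + N / 2"
  proof (rule interior_gradient_one_sided[where u = "\<lambda>x. - u x" and du = "\<lambda>j x. - du j x" and ddu = "\<lambda>j x. - ddu j x"])
    show "continuous_on UNIV (\<lambda>x. - u x)" using cont by (rule continuous_on_minus)
    show "pderiv_real (\<lambda>x. - u x) j (\<lambda>x. - du j x)" for j
      using du unfolding pderiv_real_def by (auto intro: DERIV_minus)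
    show "pderiv_real (\<lambda>x. - du j x) j (\<lambda>x. - ddu j x)" for j
      using ddu unfolding pderiv_real_def by (auto intro: DERIV_minus)
  qed (use M N in \<open>simp_all add: sum_negf\<close>)
  then show ?thesis
    using interior_gradient_one_sided[OF cont du ddu M N, of i] by (simp add: abs_le_iff)
qed

section \<open>The weighted elliptic estimate\<close>

text \<open>
  The factor \<open>1 + |h|\<close> makes a weighted norm of a translate comparable with that of the function.
\<close>

definition slow_weight :: "(real ^ 'n::finite \<Rightarrow> real) \<Rightarrow> bool" where
  "slow_weight b \<longleftrightarrow> b \<in> borel_measurable borel \<and> (\<exists>A. \<forall>x. b x \<le> A) \<and> (\<forall>x. 0 \<le> b x) \<and> (\<forall>x h. b (x + h) \<le> (1 + norm h) * b x)"

lemma slow_weight_weight: "slow_weight b \<Longrightarrow> weight (\<lambda>x. of_real (b x))"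
  unfolding slow_weight_def weight_def bounded_iff by (auto simp: abs_of_nonneg)

lemma smooth_laplacian:
  assumes "smooth f"
  shows "smooth (laplacian f)" "partial i (laplacian f) = laplacian (partial i f)"
proof -
  have "smooth (\<lambda>x. \<Sum>j\<in>UNIV. partial j (partial j f) x) \<and> partial i (\<lambda>x. \<Sum>j\<in>UNIV. partial j (partial j f) x) = (\<lambda>x. \<Sum>j\<in>UNIV. partial i (partial j (partial j f)) x)"
    by (rule partial_sum) (auto intro!: smooth_partial assms)
  moreover have "partial i (partial j (partial j f)) = partial j (partial j (partial i f))" for j
    using partial_commute assms smooth_partial by metis
  ultimately show "smooth (laplacian f)" "partial i (laplacian f) = laplacian (partial i f)"
    by (simp_all add: laplacian_def[abs_def])
qed

lemma D_L1_sum: "finite I \<Longrightarrow> (\<And>k. k \<in> I \<Longrightarrow> f k \<in> D_L1) \<Longrightarrow> (\<lambda>x. \<Sum>k\<in>I. f k x) \<in> D_L1"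
proof (induction I rule: finite_induct)
  case empty
  then show ?case using conjunct1[OF subspace_D_L1[unfolded subspace_fun_def]] by simp
next
  case (insert k I)
  then show ?case using D_L1_add[of "f k" "\<lambda>x. \<Sum>k\<in>I. f k x"] by simp
qed

lemma laplacian_D_L1: "f \<in> D_L1 \<Longrightarrow> laplacian f \<in> D_L1"
  unfolding laplacian_def[abs_def] by (intro D_L1_sum D_L1_partial) auto

lemma one_minus_laplacian_D_L1: "f \<in> D_L1 \<Longrightarrow> one_minus_laplacian f \<in> D_L1"
  unfolding one_minus_laplacian_def[abs_def] by (intro D_L1_diff laplacian_D_L1)

lemma one_minus_laplacian_pow_D_L1: "f \<in> D_L1 \<Longrightarrow> (one_minus_laplacian ^^ k) f \<in> D_L1"
  by (induction k) (auto intro: one_minus_laplacian_D_L1)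

lemma partial_one_minus_laplacian:
  assumes "smooth f"
  shows "partial i (one_minus_laplacian f) = one_minus_laplacian (partial i f)"
proof -
  have "partial i (\<lambda>x. f x - laplacian f x) = (\<lambda>x. partial i f x - partial i (laplacian f) x)"
    using ders_diff[OF assms smooth_laplacian(1)[OF assms], of "[i]"] by simp
  then show ?thesis by (simp add: one_minus_laplacian_def[abs_def] smooth_laplacian(2)[OF assms])
qed

lemma partial_one_minus_laplacian_pow:
  "f \<in> D_L1 \<Longrightarrow> (one_minus_laplacian ^^ k) (partial i f) = partial i ((one_minus_laplacian ^^ k) f)"
  by (induction k) (simp_all add: partial_one_minus_laplacian D_L1_smooth one_minus_laplacian_pow_D_L1)

lemma corr_sum:
  assumes "finite I" "\<And>k. k \<in> I \<Longrightarrow> f k \<in> D_L1" "weight w"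
  shows "corr w (\<lambda>x. \<Sum>k\<in>I. f k x) h = (\<Sum>k\<in>I. corr w (f k) h)"
  unfolding corr_def sum_distrib_left
  by (rule Bochner_Integration.integral_sum) (intro weight_integrable integrable_translate D_L1_integrable assms)

lemma smooth_pderiv_real:
  assumes "smooth U"
  shows "pderiv_real (\<lambda>x. Re (U x)) j (\<lambda>x. Re (partial j U x))"
  unfolding pderiv_real_def
proof
  fix x
  have "((\<lambda>t. U (x + t *\<^sub>R axis j 1)) has_vector_derivative partial j U (x + 0 *\<^sub>R axis j 1)) (at 0)"
    by (rule axis_line_derivative[OF smooth_differentiable[OF assms]])
  from bounded_linear.has_vector_derivative[OF bounded_linear_Re this]
  show "((\<lambda>t. Re (U (x + t *\<^sub>R axis j 1))) has_real_derivative Re (partial j U x)) (at 0)"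
    by (simp add: has_real_derivative_iff_has_vector_derivative)
qed

lemma corr_slow_bound:
  fixes b :: "real ^ 'n::finite \<Rightarrow> real"
  assumes b: "slow_weight b" and w: "weight w" "\<And>x. norm (w x) \<le> b x" and f: "f \<in> D_L1"
  shows "norm (corr w f h) \<le> (1 + norm h) * L1_norm (\<lambda>x. of_real (b x) * f x)"
proof -
  have bm: "b \<in> borel_measurable borel" and b0: "\<And>x. 0 \<le> b x" and bs: "\<And>x h. b (x + h) \<le> (1 + norm h) * b x"
    using b by (auto simp: slow_weight_def)
  have [measurable]: "b \<in> borel_measurable borel" "w \<in> borel_measurable borel" "f \<in> borel_measurable borel"
    using bm w f by (auto simp: weight_def D_L1_borel)
  have "norm (corr w f h) \<le> L1_norm (\<lambda>x. w x * f (x + h))"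
    by (rule norm_corr_le[OF D_L1_integrable[OF f] w(1)])
  also have "\<dots> \<le> L1_norm (\<lambda>x. of_real (1 + norm h) * (of_real (b (x + h)) * f (x + h)))"
  proof (rule L1_norm_mono)
    show "integrable lborel (\<lambda>x. of_real (1 + norm h) * (of_real (b (x + h)) * f (x + h)))"
      by (intro integrable_mult_right integrable_translate[of "\<lambda>x. of_real (b x) * f x"] weight_integrable slow_weight_weight b D_L1_integrable f)
    fix x
    have "norm (w x) \<le> (1 + norm h) * b (x + h)"
      using w(2)[of x] bs[of "x + h" "- h"] by simp
    then have "norm (w x) * norm (f (x + h)) \<le> ((1 + norm h) * b (x + h)) * norm (f (x + h))"
      by (rule mult_right_mono) simp
    then show "norm (w x * f (x + h)) \<le> norm (of_real (1 + norm h) * (of_real (b (x + h)) * f (x + h)))"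
      using b0 by (simp only: norm_mult norm_of_real abs_of_nonneg) (simp add: mult.assoc)
  qed measurable
  also have "\<dots> = (1 + norm h) * L1_norm (\<lambda>x. of_real (b x) * f x)"
  proof -
    have "(\<lambda>x. of_real (b x) * f x) \<in> borel_measurable borel" by measurable
    from L1_norm_translate[OF this, of h] show ?thesis
      by (subst L1_norm_scale) (simp del: of_real_add)
  qed
  finally show ?thesis .
qed

text \<open>
  The interior gradient estimate for \<open>U = corr w f\<close>, where \<open>w\<close> is \<open>b\<close> times the conjugate phase of \<open>\<partial>\<^sub>i f\<close>: the
  left-hand side is \<open>\<partial>\<^sub>i U 0\<close>, and slow variation bounds \<open>U\<close> and \<open>\<Delta> U\<close> on the cube \<open>|x\<^sub>j| \<le> 1\<close>.
\<close>

lemma weighted_gradient: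
  fixes b :: "real ^ 'n::finite \<Rightarrow> real"
  assumes b: "slow_weight b" and f: "f \<in> D_L1"
  shows "L1_norm (\<lambda>x. of_real (b x) * partial i f x) \<le>
    (CARD('n) + 1)\<^sup>2 * (L1_norm (\<lambda>x. of_real (b x) * f x) + L1_norm (\<lambda>x. of_real (b x) * laplacian f x))"
proof -
  let ?n = "real CARD('n)"
  define w where "w x = of_real (b x) * (cnj (partial i f x) / of_real (norm (partial i f x)))" for x
  define U where "U = corr w f"
  have bm: "b \<in> borel_measurable borel" and b0: "\<And>x. 0 \<le> b x" using b by (auto simp: slow_weight_def)
  have [measurable]: "b \<in> borel_measurable borel" "partial i f \<in> borel_measurable borel"
    using bm D_L1_borel[OF D_L1_partial[OF f]] by auto
  have wb: "norm (w x) \<le> b x" for x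
    using b0[of x] by (cases "partial i f x = 0") (auto simp: w_def norm_mult norm_divide)
  have wm: "w \<in> borel_measurable borel"
  proof -
    have "(\<lambda>x. cnj (partial i f x)) \<in> borel_measurable borel"
      by (rule measurable_compose[OF _ borel_measurable_continuous_onI]) (auto intro!: continuous_intros)
    then show ?thesis unfolding w_def[abs_def] by measurable
  qed
  have w: "weight w"
  proof -
    obtain A where "\<And>x. b x \<le> A" using b by (auto simp: slow_weight_def)
    then have "bounded (range w)" using order_trans[OF wb] by (auto simp: bounded_iff)
    then show ?thesis using wm by (simp add: weight_def)
  qed
  have wf: "w x * partial i f x = of_real (b x * norm (partial i f x))" for x
  proof (cases "partial i f x = 0")
    case False
    have "cnj (partial i f x) * partial i f x = of_real ((norm (partial i f x))\<^sup>2)"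
      by (metis complex_norm_square mult.commute of_real_power)
    moreover have "w x * partial i f x = of_real (b x) * (cnj (partial i f x) * partial i f x) / of_real (norm (partial i f x))"
      by (simp add: w_def)
    ultimately show ?thesis using False by (simp add: power2_eq_square)
  qed (simp add: w_def)
  have sU: "smooth U" and pU: "partial j U = corr w (partial j f)" and ppU: "partial j (partial j U) = corr w (partial j (partial j f))" for j
    unfolding U_def using smooth_corr[OF f w] smooth_corr(2)[OF f w, of "[j]"] smooth_corr(2)[OF f w, of "[j, j]"] by simp_all
  have cube: "norm x \<le> ?n" if "\<And>j. \<bar>x $ j\<bar> \<le> 1" for x :: "real ^ 'n"
    using order_trans[OF norm_le_l1_cart sum_mono[of UNIV "\<lambda>j. \<bar>x $ j\<bar>" "\<lambda>j. 1"]] that by simp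
  have bound: "norm (corr w g x) \<le> (1 + ?n) * L1_norm (\<lambda>x. of_real (b x) * g x)" if "\<And>j. \<bar>x $ j\<bar> \<le> 1" "g \<in> D_L1" for x g
  proof -
    have "norm (corr w g x) \<le> (1 + norm x) * L1_norm (\<lambda>x. of_real (b x) * g x)"
      by (rule corr_slow_bound[OF b w wb that(2)])
    also have "\<dots> \<le> (1 + ?n) * L1_norm (\<lambda>x. of_real (b x) * g x)"
      using cube[OF that(1)] by (intro mult_right_mono L1_norm_nonneg) simp
    finally show ?thesis .
  qed
  let ?a = "L1_norm (\<lambda>x. of_real (b x) * f x)" and ?c = "L1_norm (\<lambda>x. of_real (b x) * laplacian f x)"
  have "\<bar>Re (partial i U 0)\<bar> \<le> CARD('n) * ((1 + ?n) * ?a) + (1 + ?n) * ?c / 2"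
  proof (rule interior_gradient[where u = "\<lambda>x. Re (U x)" and du = "\<lambda>j x. Re (partial j U x)" and ddu = "\<lambda>j x. Re (partial j (partial j U) x)"])
    show "continuous_on UNIV (\<lambda>x. Re (U x))"
      by (intro continuous_on_Re smooth_continuous[OF sU])
    show "pderiv_real (\<lambda>x. Re (U x)) j (\<lambda>x. Re (partial j U x))" for j by (rule smooth_pderiv_real[OF sU])
    show "pderiv_real (\<lambda>x. Re (partial j U x)) j (\<lambda>x. Re (partial j (partial j U) x))" for j
      by (rule smooth_pderiv_real[OF smooth_partial[OF sU]])
    show "\<bar>Re (U x)\<bar> \<le> (1 + ?n) * ?a" if "\<And>j. \<bar>x $ j\<bar> \<le> 1" for x
      using order_trans[OF abs_Re_le_cmod bound[OF that f]] unfolding U_def .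
    show "\<bar>\<Sum>j\<in>UNIV. Re (partial j (partial j U) x)\<bar> \<le> (1 + ?n) * ?c" if "\<And>j. \<bar>x $ j\<bar> \<le> 1" for x
    proof -
      have "(\<Sum>j\<in>UNIV. Re (partial j (partial j U) x)) = Re (corr w (laplacian f) x)"
        unfolding laplacian_def[abs_def] ppU
        by (subst corr_sum) (auto intro!: D_L1_partial f w)
      then show ?thesis using order_trans[OF abs_Re_le_cmod bound[OF that laplacian_D_L1[OF f]]] by simp
    qed
  qed
  moreover have "partial i U 0 = of_real (L1_norm (\<lambda>x. of_real (b x) * partial i f x))"
    unfolding pU corr_def L1_norm_def using b0 by (simp add: wf norm_mult abs_of_nonneg del: of_real_mult)
  ultimately have "L1_norm (\<lambda>x. of_real (b x) * partial i f x) \<le> ?n * ((1 + ?n) * ?a) + (1 + ?n) * ?c / 2"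
    using L1_norm_nonneg by simp
  also have "\<dots> \<le> (?n + 1)\<^sup>2 * (?a + ?c)"
  proof -
    have *: "n * ((1 + n) * a) + (1 + n) * c / 2 \<le> (n + 1)\<^sup>2 * (a + c)" if "0 \<le> n" "0 \<le> a" "0 \<le> c" for n a c :: real
    proof -
      have "(n + 1)\<^sup>2 * (a + c) - (n * ((1 + n) * a) + (1 + n) * c / 2) = (1 + n) * (a + n * c + c / 2)"
        by (simp add: power2_eq_square field_simps)
      also have "0 \<le> \<dots>" using that by (intro mult_nonneg_nonneg add_nonneg_nonneg) auto
      finally show ?thesis by simp
    qed
    show ?thesis by (rule *) (simp_all add: L1_norm_nonneg)
  qed
  finally show ?thesis by (simp add: add.commute)
qed

text \<open>
  The gradient estimate, applied to \<open>(1 - \<Delta>)\<^sup>k f\<close> and combined with \<open>\<Delta> F = F - (1 - \<Delta>) F\<close>, trades one derivative for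
  one power of \<open>1 - \<Delta>\<close>.
\<close>

lemma weighted_elliptic:
  fixes b :: "real ^ 'n::finite \<Rightarrow> real"
  assumes b: "slow_weight b"
  shows "\<exists>C. \<forall>f\<in>D_L1. wnorm (\<lambda>x. of_real (b x)) m f \<le>
    C * (\<Sum>k\<le>m. L1_norm (\<lambda>x. of_real (b x) * (one_minus_laplacian ^^ k) f x))"
proof -
  define E where "E k f = L1_norm (\<lambda>x. of_real (b x) * (one_minus_laplacian ^^ k) f x)" for k f
  let ?K = "2 * (CARD('n) + 1)\<^sup>2 :: real"
  have E0: "0 \<le> E k f" for k f unfolding E_def by (rule L1_norm_nonneg)
  have E_partial: "E k (partial i f) \<le> ?K * (E k f + E (Suc k) f)" if f: "f \<in> D_L1" for f k i
  proof -
    define F where "F = (one_minus_laplacian ^^ k) f"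
    have F: "F \<in> D_L1" unfolding F_def by (rule one_minus_laplacian_pow_D_L1[OF f])
    note int = weight_integrable[OF slow_weight_weight[OF b] D_L1_integrable]
    have "L1_norm (\<lambda>x. of_real (b x) * laplacian F x) = L1_norm (\<lambda>x. of_real (b x) * F x + (- 1) * (of_real (b x) * one_minus_laplacian F x))"
      by (simp add: one_minus_laplacian_def algebra_simps)
    also have "\<dots> \<le> L1_norm (\<lambda>x. of_real (b x) * F x) + L1_norm (\<lambda>x. (- 1) * (of_real (b x) * one_minus_laplacian F x))"
      by (intro L1_norm_add integrable_mult_right int F one_minus_laplacian_D_L1)
    also have "\<dots> = E k f + E (Suc k) f" by (subst L1_norm_scale) (simp add: E_def F_def)
    finally have lap: "L1_norm (\<lambda>x. of_real (b x) * laplacian F x) \<le> E k f + E (Suc k) f" .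
    have "E k (partial i f) = L1_norm (\<lambda>x. of_real (b x) * partial i F x)"
      by (simp add: E_def F_def partial_one_minus_laplacian_pow[OF f])
    also have "\<dots> \<le> (CARD('n) + 1)\<^sup>2 * (L1_norm (\<lambda>x. of_real (b x) * F x) + L1_norm (\<lambda>x. of_real (b x) * laplacian F x))"
      by (rule weighted_gradient[OF b F])
    also have "\<dots> \<le> (CARD('n) + 1)\<^sup>2 * (2 * (E k f + E (Suc k) f))"
    proof (rule mult_left_mono)
      show "L1_norm (\<lambda>x. of_real (b x) * F x) + L1_norm (\<lambda>x. of_real (b x) * laplacian F x) \<le> 2 * (E k f + E (Suc k) f)"
        using lap E0[of "Suc k" f] by (simp add: E_def F_def)
    qed simp
    also have "\<dots> = ?K * (E k f + E (Suc k) f)" by (simp add: algebra_simps)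
    finally show ?thesis .
  qed
  have words: "L1_norm (\<lambda>x. of_real (b x) * ders is f x) \<le> (2 * ?K) ^ length is * (\<Sum>k\<le>length is. E k f)" if "f \<in> D_L1" for f "is"
    using that
  proof (induction "is" arbitrary: f rule: rev_induct)
    case Nil
    then show ?case by (simp add: E_def)
  next
    case (snoc i js)
    let ?m = "length js"
    have "L1_norm (\<lambda>x. of_real (b x) * ders (js @ [i]) f x) \<le> (2 * ?K) ^ ?m * (\<Sum>k\<le>?m. E k (partial i f))"
      using snoc.IH[OF D_L1_partial[OF snoc.prems]] by simp
    also have "\<dots> \<le> (2 * ?K) ^ ?m * (\<Sum>k\<le>?m. ?K * (E k f + E (Suc k) f))"
      by (intro mult_left_mono sum_mono E_partial snoc.prems) simp
    also have "(\<Sum>k\<le>?m. ?K * (E k f + E (Suc k) f)) = ?K * ((\<Sum>k\<le>?m. E k f) + (\<Sum>k\<le>?m. E (Suc k) f))"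
      by (simp only: sum_distrib_left[symmetric] sum.distrib)
    also have "(2 * ?K) ^ ?m * (?K * ((\<Sum>k\<le>?m. E k f) + (\<Sum>k\<le>?m. E (Suc k) f))) \<le> (2 * ?K) ^ ?m * (?K * (2 * (\<Sum>k\<le>Suc ?m. E k f)))"
    proof (intro mult_left_mono)
      have "(\<Sum>k\<le>Suc ?m. E k f) = E 0 f + (\<Sum>k\<le>?m. E (Suc k) f)" by (rule sum.atMost_Suc_shift)
      moreover have "(\<Sum>k\<le>Suc ?m. E k f) = (\<Sum>k\<le>?m. E k f) + E (Suc ?m) f" by simp
      ultimately show "(\<Sum>k\<le>?m. E k f) + (\<Sum>k\<le>?m. E (Suc k) f) \<le> 2 * (\<Sum>k\<le>Suc ?m. E k f)"
        using E0[of 0 f] E0[of "Suc ?m" f] by linarith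
    qed simp_all
    also have "\<dots> = (2 * ?K) ^ length (js @ [i]) * (\<Sum>k\<le>length (js @ [i]). E k f)"
      by (simp add: algebra_simps)
    finally show ?case .
  qed
  show ?thesis
  proof (intro exI ballI)
    fix f :: "'n cfun" assume f: "f \<in> D_L1"
    show "wnorm (\<lambda>x. of_real (b x)) m f \<le> (2 * ?K) ^ m * (\<Sum>k\<le>m. L1_norm (\<lambda>x. of_real (b x) * (one_minus_laplacian ^^ k) f x))"
    proof (rule wnorm_le)
      fix "is" :: "'n list" assume "is \<in> words m"
      then have len: "length is \<le> m" by simp
      have "L1_norm (\<lambda>x. of_real (b x) * ders is f x) \<le> (2 * ?K) ^ length is * (\<Sum>k\<le>length is. E k f)"
        by (rule words[OF f])
      also have "\<dots> \<le> (2 * ?K) ^ m * (\<Sum>k\<le>m. E k f)"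
      proof (rule mult_mono)
        have "1 \<le> (1 + real CARD('n))\<^sup>2" by (rule one_le_power) simp
        then have "1 \<le> 4 * (1 + real CARD('n))\<^sup>2" by linarith
        then have "1 \<le> 2 * ?K" by (simp add: add.commute)
        then show "(2 * ?K) ^ length is \<le> (2 * ?K) ^ m" using len by (rule power_increasing[rotated])
        show "(\<Sum>k\<le>length is. E k f) \<le> (\<Sum>k\<le>m. E k f)" using len E0 by (intro sum_mono2) auto
      qed (auto simp: E0 sum_nonneg)
      finally show "L1_norm (\<lambda>x. of_real (b x) * ders is f x) \<le> (2 * ?K) ^ m * (\<Sum>k\<le>m. L1_norm (\<lambda>x. of_real (b x) * (one_minus_laplacian ^^ k) f x))"
        unfolding E_def .
    qed
  qed
qed

lemma one_minus_laplacian_pow_le: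
  fixes g :: "'n::finite cfun"
  assumes g: "weight g"
  shows "\<exists>C. \<forall>f\<in>D_L1. L1_norm (\<lambda>x. g x * (one_minus_laplacian ^^ k) f x) \<le> C * wnorm g (2 * k) f"
proof -
  have step: "wnorm g m (one_minus_laplacian f) \<le> (1 + CARD('n)) * wnorm g (Suc (Suc m)) f" if f: "f \<in> D_L1" for m f
  proof -
    note s = wnorm_seminorm[OF g, of m]
    have sum: "wnorm g m (\<lambda>x. \<Sum>j\<in>J. partial j (partial j f) x) \<le> card J * wnorm g (Suc (Suc m)) f" if "finite J" for J :: "'n set"
      using that
    proof (induction J rule: finite_induct)
      case empty
      then show ?case using seminorm_on_0[OF subspace_D_L1 s] by simp
    next
      case (insert j J)
      have "wnorm g m (\<lambda>x. partial j (partial j f) x + (\<Sum>j\<in>J. partial j (partial j f) x)) \<le> wnorm g m (partial j (partial j f)) + wnorm g m (\<lambda>x. \<Sum>j\<in>J. partial j (partial j f) x)"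
        by (rule seminorm_on_add[OF s]) (intro D_L1_sum D_L1_partial f insert.hyps)+
      also have "wnorm g m (partial j (partial j f)) \<le> wnorm g (Suc (Suc m)) f"
        using wnorm_partial[of "partial j f" g m j] wnorm_partial[of f g "Suc m" j] D_L1_smooth[OF f] smooth_partial
        by (meson order_trans)
      finally show ?case using insert by (simp add: algebra_simps)
    qed
    have "wnorm g m (one_minus_laplacian f) = wnorm g m (\<lambda>x. f x + (- 1) * laplacian f x)"
      by (simp add: one_minus_laplacian_def[abs_def])
    also have "\<dots> \<le> wnorm g m f + wnorm g m (\<lambda>x. (- 1) * laplacian f x)"
      by (rule seminorm_on_add[OF s f D_L1_scale[OF laplacian_D_L1[OF f]]])
    also have "wnorm g m (\<lambda>x. (- 1) * laplacian f x) = wnorm g m (laplacian f)"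
      by (subst seminorm_on_scale[OF s laplacian_D_L1[OF f]]) simp
    also have "wnorm g m f \<le> wnorm g (Suc (Suc m)) f" by (rule wnorm_mono_order[OF _ D_L1_smooth[OF f]]) simp
    finally show ?thesis using sum[of UNIV] by (simp add: laplacian_def[abs_def] algebra_simps)
  qed
  have pow: "wnorm g m ((one_minus_laplacian ^^ k) f) \<le> (1 + CARD('n)) ^ k * wnorm g (m + 2 * k) f" if f: "f \<in> D_L1" for k m f
    using f
  proof (induction k arbitrary: m)
    case (Suc k)
    have "wnorm g m ((one_minus_laplacian ^^ Suc k) f) \<le> (1 + CARD('n)) * wnorm g (Suc (Suc m)) ((one_minus_laplacian ^^ k) f)"
      using step[OF one_minus_laplacian_pow_D_L1[OF f]] by simp
    also have "\<dots> \<le> (1 + CARD('n)) * ((1 + CARD('n)) ^ k * wnorm g (Suc (Suc m) + 2 * k) f)"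
      by (intro mult_left_mono Suc.IH f) simp
    finally show ?case by (simp add: algebra_simps)
  qed simp
  have "L1_norm (\<lambda>x. g x * (one_minus_laplacian ^^ k) f x) \<le> (1 + CARD('n)) ^ k * wnorm g (2 * k) f" if f: "f \<in> D_L1" for f
    using wnorm_ge[of "(one_minus_laplacian ^^ k) f" "[]" 0 g] pow[OF f, of 0 k] one_minus_laplacian_pow_D_L1[OF f, of k] D_L1_smooth
    by fastforce
  then show ?thesis by blast
qed

section \<open>The strong dual\<close>

lemma D_L1_seminorms_seminorm: "p \<in> D_L1_seminorms \<Longrightarrow> seminorm_on D_L1 p"
  unfolding D_L1_seminorms_wnorm using wnorm_seminorm[OF weight_const] by blast

lemma D_L1_seminorms_nonempty: "D_L1_seminorms \<noteq> {}"
  unfolding D_L1_seminorms_def by blast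

lemma topspace_D_L1: "topspace (seminorm_topology D_L1 D_L1_seminorms) = D_L1"
  by (rule topspace_seminorm_topology[OF D_L1_seminorms_nonempty subspace_D_L1 D_L1_seminorms_seminorm])

text \<open>
  Continuity at \<open>0\<close> gives a ball of finitely many norms on which \<open>|T| < 1\<close>; since the norms increase with the
  order, one of them suffices, and the bound follows by scaling.
\<close>

lemma B'_bound:
  fixes T :: "'n::finite functional"
  assumes T: "T \<in> B'"
  obtains m C where "0 < C" "\<And>f. f \<in> D_L1 \<Longrightarrow> norm (T f) \<le> C * dnorm m f"
proof -
  let ?X = "seminorm_topology (D_L1 :: 'n cfun set) D_L1_seminorms"
  have Td: "T \<in> continuous_dual D_L1 D_L1_seminorms" using T by (simp add: B'_def)
  have zero: "(\<lambda>x. 0) \<in> (D_L1 :: 'n cfun set)"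
    by (rule conjunct1[OF subspace_D_L1[unfolded subspace_fun_def]])
  have T0: "T (\<lambda>x. 0) = 0" using continuous_dual_scale[OF Td zero, of 0] by simp
  have "continuous_map ?X euclidean T" using Td by (simp add: continuous_dual_def)
  then have "openin ?X {f \<in> topspace ?X. T f \<in> ball 0 1}" by (rule openin_continuous_map_preimage) simp
  then have op: "openin ?X {f \<in> D_L1. T f \<in> ball 0 1}" by (simp add: topspace_D_L1)
  have mem: "(\<lambda>x. 0) \<in> {f \<in> D_L1. T f \<in> ball 0 1}" using zero T0 by simp
  obtain P0 r where P0: "finite P0" "P0 \<subseteq> D_L1_seminorms" "0 < r"
      and sub: "{g \<in> D_L1. \<forall>p\<in>P0. p (\<lambda>t. g t - 0) < r} \<subseteq> {f \<in> D_L1. T f \<in> ball 0 1}"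
    by (rule openin_seminorm_topology_nhd[OF subspace_D_L1 D_L1_seminorms_seminorm op mem])
  have "\<exists>k. p = dnorm k" if "p \<in> P0" for p
    using that P0(2) unfolding D_L1_seminorms_wnorm by blast
  then obtain k where k: "\<And>p. p \<in> P0 \<Longrightarrow> p = dnorm (k p)" by metis
  define M where "M = (\<Sum>p\<in>P0. k p)"
  have small: "norm (T g) < 1" if g: "g \<in> D_L1" "dnorm M g < r" for g
  proof -
    have "p g < r" if "p \<in> P0" for p
    proof -
      have "k p \<le> M" unfolding M_def by (rule member_le_sum[OF that]) (use P0 in auto)
      then have "p g \<le> dnorm M g" using k[OF that] wnorm_mono_order[OF _ D_L1_smooth[OF g(1)]] by metis
      then show ?thesis using g(2) by linarith
    qed
    then have "g \<in> {g \<in> D_L1. \<forall>p\<in>P0. p (\<lambda>t. g t - 0) < r}" using g(1) by simp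
    then have "T g \<in> ball 0 1" using sub by blast
    then show ?thesis by simp
  qed
  have "norm (T f) \<le> 2 / r * dnorm M f" if f: "f \<in> D_L1" for f
  proof (rule field_le_epsilon)
    fix e :: real assume e: "0 < e"
    define a where "a = dnorm M f"
    have a0: "0 \<le> a" unfolding a_def by (rule wnorm_nonneg[OF D_L1_smooth[OF f]])
    \<comment> \<open>adding a positive number covers the case that the norm of \<open>f\<close> vanishes\<close>
    define d where "d = a + e * r / 2"
    have d: "0 < d" "a < d" unfolding d_def using e P0(3) a0 by (auto intro: add_nonneg_pos)
    define c where "c = r / (2 * d)"
    have c: "0 < c" unfolding c_def using d P0(3) by simp
    have "dnorm M (\<lambda>t. of_real c * f t) = c * a"
      using seminorm_on_scale[OF wnorm_seminorm[OF weight_const] f, of 1 M "of_real c"] c by (simp add: a_def)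
    also have "\<dots> \<le> c * d" using d c by simp
    also have "\<dots> < r" unfolding c_def using d P0(3) by simp
    finally have "norm (T (\<lambda>t. of_real c * f t)) < 1" by (rule small[OF D_L1_scale[OF f]])
    then have "c * norm (T f) < 1" using continuous_dual_scale[OF Td f, of "of_real c"] c by (simp add: norm_mult)
    then have "norm (T f) < 1 / c" using c by (simp add: field_simps)
    also have "1 / c = 2 / r * a + e" unfolding c_def d_def using P0(3) by (simp add: field_simps)
    finally show "norm (T f) \<le> 2 / r * dnorm M f + e" unfolding a_def by simp
  qed
  then show ?thesis using that[of "2 / r" M] P0(3) by simp
qed

lemma B'I:
  fixes T :: "'n::finite functional"
  assumes lin: "\<And>f g a b. f \<in> D_L1 \<Longrightarrow> g \<in> D_L1 \<Longrightarrow> T (\<lambda>t. a * f t + b * g t) = a * T f + b * T g"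
    and off: "\<And>f. f \<notin> D_L1 \<Longrightarrow> T f = 0"
    and bound: "\<And>f. f \<in> D_L1 \<Longrightarrow> norm (T f) \<le> C * dnorm m f"
  shows "T \<in> B'"
proof -
  let ?X = "seminorm_topology (D_L1 :: 'n cfun set) D_L1_seminorms"
  have "openin ?X {f \<in> topspace ?X. T f \<in> U}" if U: "open U" for U
    unfolding topspace_D_L1
  proof (subst openin_subopen, intro ballI)
    fix f assume f: "f \<in> {f \<in> D_L1. T f \<in> U}"
    then obtain e where e: "0 < e" "ball (T f) e \<subseteq> U" using U open_contains_ball by blast
    define r where "r = e / (\<bar>C\<bar> + 1)"
    have r: "0 < r" unfolding r_def using e by (simp add: add_nonneg_pos)
    let ?S = "{g \<in> D_L1. dnorm m (\<lambda>t. g t - f t) < r}"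
    have "openin ?X ?S"
      by (rule openin_seminorm_ball) (use f r in \<open>auto simp: D_L1_seminorms_wnorm\<close>)
    moreover have "f \<in> ?S"
      using f r by (simp add: seminorm_on_0[OF subspace_D_L1 wnorm_seminorm[OF weight_const]])
    moreover have "?S \<subseteq> {f \<in> D_L1. T f \<in> U}"
    proof
      fix g assume g: "g \<in> ?S"
      then have gD: "g \<in> D_L1" by simp
      have d: "(\<lambda>t. g t - f t) \<in> D_L1" using gD f by (intro D_L1_diff) auto
      have n0: "0 \<le> dnorm m (\<lambda>t. g t - f t)" by (rule wnorm_nonneg[OF D_L1_smooth[OF d]])
      have "T (\<lambda>t. 1 * g t + (-1) * f t) = 1 * T g + (-1) * T f" using gD f by (intro lin) auto
      then have "norm (T g - T f) = norm (T (\<lambda>t. g t - f t))" by simp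
      also have "\<dots> \<le> C * dnorm m (\<lambda>t. g t - f t)" by (rule bound[OF d])
      also have "\<dots> \<le> (\<bar>C\<bar> + 1) * dnorm m (\<lambda>t. g t - f t)" using n0 by (intro mult_right_mono) auto
      also have "\<dots> < (\<bar>C\<bar> + 1) * r" using g by (intro mult_strict_left_mono) (auto intro: add_nonneg_pos)
      also have "\<dots> = e" unfolding r_def by (simp add: field_simps add_nonneg_eq_0_iff)
      finally have "T g \<in> ball (T f) e" by (simp add: dist_norm norm_minus_commute)
      then show "g \<in> {f \<in> D_L1. T f \<in> U}" using e gD by blast
    qed
    ultimately show "\<exists>S. openin ?X S \<and> f \<in> S \<and> S \<subseteq> {f \<in> D_L1. T f \<in> U}" by blast
  qed
  then have "continuous_map ?X euclidean T" by (simp add: continuous_map_def)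
  then show ?thesis unfolding B'_def continuous_dual_def using lin off by blast
qed

lemma B'_linear: "T \<in> B' \<Longrightarrow> f \<in> D_L1 \<Longrightarrow> g \<in> D_L1 \<Longrightarrow> T (\<lambda>t. a * f t + b * g t) = a * T f + b * T g"
  unfolding B'_def continuous_dual_def by blast

lemma B'_off: "T \<in> B' \<Longrightarrow> f \<notin> D_L1 \<Longrightarrow> T f = 0"
  unfolding B'_def continuous_dual_def by blast

lemmas B'_add = continuous_dual_add[where V = D_L1 and P = D_L1_seminorms, folded B'_def]
  and B'_diff = continuous_dual_diff[where V = D_L1 and P = D_L1_seminorms, folded B'_def]
  and B'_scale = continuous_dual_scale[where V = D_L1 and P = D_L1_seminorms, folded B'_def]

lemma D_L1_zero: "(\<lambda>x. 0) \<in> D_L1"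
  by (rule conjunct1[OF subspace_D_L1[unfolded subspace_fun_def]])

lemma B'_0: "T \<in> B' \<Longrightarrow> T (\<lambda>x. 0) = 0"
  using B'_scale[of T "\<lambda>x. 0" 0] D_L1_zero by simp

lemma subspace_B': "subspace_fun (B' :: 'n::finite functional set)"
  unfolding subspace_fun_def
proof (intro conjI ballI allI)
  show "(\<lambda>f. 0) \<in> (B' :: 'n functional set)"
    by (rule B'I[where C = 0 and m = 0]) auto
next
  fix S T :: "'n functional" and a b assume S: "S \<in> B'" and T: "T \<in> B'"
  obtain m C where 1: "0 < C" "\<And>f. f \<in> D_L1 \<Longrightarrow> norm (S f) \<le> C * dnorm m f" using B'_bound[OF S] by blast
  obtain k D where 2: "0 < D" "\<And>f. f \<in> D_L1 \<Longrightarrow> norm (T f) \<le> D * dnorm k f" using B'_bound[OF T] by blast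
  show "(\<lambda>f. a * S f + b * T f) \<in> B'"
  proof (rule B'I[where C = "norm a * C + norm b * D" and m = "max m k"])
    fix f :: "'n cfun" assume f: "f \<in> D_L1"
    have "norm (S f) \<le> C * dnorm (max m k) f"
      by (rule order_trans[OF 1(2)[OF f] mult_left_mono[OF wnorm_mono_order[OF _ D_L1_smooth[OF f]]]]) (use 1(1) in auto)
    moreover have "norm (T f) \<le> D * dnorm (max m k) f"
      by (rule order_trans[OF 2(2)[OF f] mult_left_mono[OF wnorm_mono_order[OF _ D_L1_smooth[OF f]]]]) (use 2(1) in auto)
    ultimately have "norm a * norm (S f) + norm b * norm (T f) \<le> norm a * (C * dnorm (max m k) f) + norm b * (D * dnorm (max m k) f)"
      by (intro add_mono mult_left_mono) auto
    then show "norm (a * S f + b * T f) \<le> (norm a * C + norm b * D) * dnorm (max m k) f"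
      using norm_triangle_ineq[of "a * S f" "b * T f"] by (simp add: norm_mult algebra_simps)
  qed (use B'_linear[OF S] B'_linear[OF T] B'_off[OF S] B'_off[OF T] in \<open>simp_all add: algebra_simps\<close>)
qed

text \<open>
  The sets \<open>B\<close> of the strong topology, with boundedness expressed in the norms of \<open>D_L1\<close>.
\<close>

definition bounded_set :: "'n::finite cfun set \<Rightarrow> bool" where
  "bounded_set B \<longleftrightarrow> B \<noteq> {} \<and> B \<subseteq> D_L1 \<and> (\<forall>m. \<exists>c. \<forall>f\<in>B. dnorm m f \<le> c)"

definition sup_on :: "'n::finite cfun set \<Rightarrow> ('n functional) \<Rightarrow> real" where
  "sup_on B T = (SUP f\<in>B. norm (T f))"

lemma B'_topology_eq: "B'_topology = seminorm_topology B' {sup_on B | B. bounded_set B}"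
proof -
  have "(B \<noteq> {} \<and> B \<subseteq> D_L1 \<and> (\<forall>p\<in>D_L1_seminorms. bdd_above (p ` B))) \<longleftrightarrow> bounded_set B" for B :: "'a cfun set"
    unfolding bounded_set_def D_L1_seminorms_wnorm bdd_above_def by auto
  then show ?thesis
    unfolding B'_topology_def strong_dual_topology_def B'_def[symmetric] sup_on_def[abs_def] by simp
qed

lemma sup_on_bdd:
  assumes B: "bounded_set B" and T: "T \<in> B'"
  shows "bdd_above ((\<lambda>f. norm (T f)) ` B)"
proof -
  obtain m C where C: "0 < C" "\<And>f. f \<in> D_L1 \<Longrightarrow> norm (T f) \<le> C * dnorm m f" using B'_bound[OF T] by blast
  obtain c where c: "\<And>f. f \<in> B \<Longrightarrow> dnorm m f \<le> c" using B unfolding bounded_set_def by blast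
  show ?thesis
  proof (rule bdd_aboveI2)
    fix f assume f: "f \<in> B"
    then have "f \<in> D_L1" using B unfolding bounded_set_def by blast
    then show "norm (T f) \<le> C * c" using C(2)[of f] mult_left_mono[OF c[OF f], of C] C(1) by linarith
  qed
qed

lemma sup_on_upper: "bounded_set B \<Longrightarrow> T \<in> B' \<Longrightarrow> f \<in> B \<Longrightarrow> norm (T f) \<le> sup_on B T"
  unfolding sup_on_def by (rule cSUP_upper[OF _ sup_on_bdd])

lemma sup_on_least: "bounded_set B \<Longrightarrow> (\<And>f. f \<in> B \<Longrightarrow> norm (T f) \<le> c) \<Longrightarrow> sup_on B T \<le> c"
  unfolding sup_on_def bounded_set_def by (intro cSUP_least) auto

lemma sup_on_nonneg: "bounded_set B \<Longrightarrow> T \<in> B' \<Longrightarrow> 0 \<le> sup_on B T"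
proof -
  assume B: "bounded_set B" and T: "T \<in> B'"
  then obtain f where "f \<in> B" unfolding bounded_set_def by blast
  then show ?thesis by (rule order_trans[OF norm_ge_zero sup_on_upper[OF B T]])
qed

lemma sup_on_seminorm:
  fixes B :: "'n::finite cfun set"
  assumes B: "bounded_set B"
  shows "seminorm_on B' (sup_on B)"
  unfolding seminorm_on_def
proof (intro conjI ballI allI)
  fix S T :: "'n functional" assume S: "S \<in> B'" and T: "T \<in> B'"
  show "sup_on B (\<lambda>f. S f + T f) \<le> sup_on B S + sup_on B T"
    by (rule sup_on_least[OF B]) (intro norm_triangle_le add_mono sup_on_upper B S T)
next
  fix S :: "'n functional" and c assume S: "S \<in> B'"
  have le: "sup_on B (\<lambda>f. c * S f) \<le> norm c * sup_on B S" if "S \<in> B'" for c and S :: "'n functional"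
    by (rule sup_on_least[OF B]) (simp add: norm_mult mult_left_mono sup_on_upper[OF B that])
  show "sup_on B (\<lambda>f. c * S f) = norm c * sup_on B S"
  proof (cases "c = 0")
    case True
    have "0 \<le> sup_on B (\<lambda>f. 0)"
      by (rule sup_on_nonneg[OF B conjunct1[OF subspace_B'[unfolded subspace_fun_def]]])
    then show ?thesis using le[OF S, of 0] True by simp
  next
    case False
    have "sup_on B (\<lambda>f. (1 / c) * (c * S f)) \<le> norm (1 / c) * sup_on B (\<lambda>f. c * S f)"
      by (rule le[OF subspace_fun_scale[OF subspace_B' S]])
    then show ?thesis using le[OF S, of c] False by (simp add: norm_divide field_simps)
  qed
qed

lemma bounded_set_zero: "bounded_set {\<lambda>x. 0}"
  unfolding bounded_set_def using D_L1_zero by auto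

lemma topspace_B'_topology: "topspace B'_topology = B'"
  unfolding B'_topology_eq
proof (rule topspace_seminorm_topology[OF _ subspace_B'])
  show "{sup_on B | B. bounded_set B} \<noteq> {}" using bounded_set_zero by blast
qed (auto intro: sup_on_seminorm)

section \<open>Cutting off at infinity\<close>

lemma bdd_smooth_cutoff: "0 < R \<Longrightarrow> bdd_smooth (cutoff R)"
  by (rule test_functions_bdd_smooth[OF cutoff_test])

lemma bdd_smooth_one_minus_cutoff: "0 < R \<Longrightarrow> bdd_smooth (\<lambda>x. 1 - cutoff R x)"
  by (intro bdd_smooth_diff bdd_smooth_const bdd_smooth_cutoff)

lemma one_minus_cutoff_bound:
  obtains A where "0 < A" "\<And>R is x. 1 \<le> R \<Longrightarrow> is \<in> words m \<Longrightarrow> norm (ders is (\<lambda>x. 1 - cutoff R x) (x :: real ^ 'n::finite)) \<le> A"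
proof -
  obtain A where A: "0 < A" "\<And>R is x. 1 \<le> R \<Longrightarrow> is \<in> words m \<Longrightarrow> norm (ders is (cutoff R) (x :: real ^ 'n)) \<le> A"
    by (rule cutoff_bound[where m = m]) blast
  have "norm (ders is (\<lambda>x. 1 - cutoff R x) x) \<le> 1 + A" if "1 \<le> R" "is \<in> words m" for R "is" and x :: "real ^ 'n"
  proof -
    have "ders is (\<lambda>x :: real ^ 'n. 1) x = (if is = [] then 1 else 0)"
    proof -
      have "ders is (\<lambda>x :: real ^ 'n. 1) = (\<lambda>x. if is = [] then 1 else 0)" by (induction "is") auto
      then show ?thesis by simp
    qed
    then have "norm (ders is (\<lambda>x :: real ^ 'n. 1) x) \<le> 1" by simp
    moreover have eq: "ders is (\<lambda>x. 1 - cutoff R x) x = ders is (\<lambda>x. 1) x - ders is (cutoff R) x"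
      by (simp add: ders_diff smooth_const smooth_cutoff)
    ultimately show ?thesis unfolding eq using A(2)[OF that, of x] norm_triangle_ineq4[of "ders is (\<lambda>x. 1) x" "ders is (cutoff R) x"] by linarith
  qed
  then show ?thesis using A(1) that[of "1 + A"] by simp
qed

lemma fun_support_one_minus_cutoff: "0 < R \<Longrightarrow> fun_support (\<lambda>x. 1 - cutoff R x) \<subseteq> {x. R \<le> norm x}"
  by (rule fun_support_subset) (auto simp: cutoff_eq_1 closed_Collect_le continuous_on_norm_id)

lemma card_words_pos: "0 < card (words m :: 'n::finite list set)"
proof -
  have "[] \<in> (words m :: 'n list set)" by simp
  then show ?thesis using finite_words by (metis card_gt_0_iff empty_iff)
qed

abbreviation cut :: "real \<Rightarrow> 'n::finite cfun \<Rightarrow> 'n cfun" where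
  "cut R f \<equiv> \<lambda>x. cutoff R x * f x"

abbreviation tail :: "real \<Rightarrow> 'n::finite cfun \<Rightarrow> 'n cfun" where
  "tail R f \<equiv> \<lambda>x. (1 - cutoff R x) * f x"

text \<open>
  The constant is the same for all radii and weights: the derivatives of the cutoffs are bounded independently of \<open>R \<ge> 1\<close>.
\<close>

lemma wnorm_tail_le:
  fixes g :: "'n::finite cfun"
  obtains C where "0 < C"
    "\<And>g f R e. weight g \<Longrightarrow> f \<in> D_L1 \<Longrightarrow> 1 \<le> R \<Longrightarrow> (\<And>x :: real ^ 'n. R \<le> norm x \<Longrightarrow> norm (g x) \<le> e) \<Longrightarrow> 0 \<le> e \<Longrightarrow>
       wnorm g m (tail R f) \<le> C * e * dnorm m f"
proof -
  obtain A where A: "0 < A" "\<And>R is x. 1 \<le> R \<Longrightarrow> is \<in> words m \<Longrightarrow> norm (ders is (\<lambda>x. 1 - cutoff R x) (x :: real ^ 'n)) \<le> A"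
    by (rule one_minus_cutoff_bound[where m = m]) blast
  let ?C = "2 ^ m * A * card (words m :: 'n list set)"
  have C: "0 < ?C" using A(1) card_words_pos[where 'n = 'n and m = m] by simp
  have "wnorm g m (tail R f) \<le> ?C * e * dnorm m f"
    if g: "weight g" and f: "f \<in> D_L1" and R: "1 \<le> R" and e: "\<And>x. R \<le> norm x \<Longrightarrow> norm (g x) \<le> e" "0 \<le> e"
    for g :: "'n cfun" and f R e
  proof -
    have "wnorm g m (tail R f) \<le> ?C * wnorm (\<lambda>x. of_real e) m f"
    proof (rule wnorm_mult_le[OF g weight_const f bdd_smooth_one_minus_cutoff])
      show "norm (g x) \<le> norm (of_real e :: complex)" if "x \<in> fun_support (\<lambda>x. 1 - cutoff R x)" for x
        using that fun_support_one_minus_cutoff[of R] R e by auto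
    qed (use A R in auto)
    also have "\<dots> \<le> ?C * (e * dnorm m f)"
      using C e by (intro mult_left_mono wnorm_le_unweighted weight_const f) auto
    finally show ?thesis by (simp add: mult.assoc)
  qed
  then show ?thesis using that[of ?C] C by blast
qed

lemma wnorm_cutoff_le:
  obtains C where "0 < C"
    "\<And>f R. f \<in> D_L1 \<Longrightarrow> 1 \<le> R \<Longrightarrow> wnorm (\<lambda>x :: real ^ 'n::finite. 1) m (cut R f) \<le> C * dnorm m f"
proof -
  obtain A where A: "0 < A" "\<And>R is x. 1 \<le> R \<Longrightarrow> is \<in> words m \<Longrightarrow> norm (ders is (cutoff R) (x :: real ^ 'n)) \<le> A"
    by (rule cutoff_bound[where m = m]) blast
  let ?C = "2 ^ m * A * card (words m :: 'n list set)"
  have C: "0 < ?C" using A(1) card_words_pos[where 'n = 'n and m = m] by simp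
  have "dnorm m (cut R f) \<le> ?C * wnorm (\<lambda>x :: real ^ 'n. 1) m f" if "f \<in> D_L1" "1 \<le> R" for f R
    by (rule wnorm_mult_le[OF weight_const weight_const that(1) bdd_smooth_cutoff]) (use A that in auto)
  then show ?thesis using that[of ?C] C by blast
qed

text \<open>
  The functional \<open>\<chi>\<^sub>R T\<close>.
\<close>

definition localise :: "real \<Rightarrow> ('n::finite functional) \<Rightarrow> 'n functional" where
  "localise R T f = (if f \<in> D_L1 then T (cut R f) else 0)"

lemma localise_E':
  fixes T :: "'n::finite functional"
  assumes T: "T \<in> B'" and R: "1 \<le> R"
  shows "localise R T \<in> E'"
proof -
  have R0: "0 < R" using R by simp
  obtain m C where C: "0 < C" "\<And>f. f \<in> D_L1 \<Longrightarrow> norm (T f) \<le> C * dnorm m f" using B'_bound[OF T] by blast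
  obtain D where D: "0 < D" "\<And>f R. f \<in> D_L1 \<Longrightarrow> 1 \<le> R \<Longrightarrow> wnorm (\<lambda>x :: real ^ 'n. 1) m (cut R f) \<le> D * dnorm m f"
    by (rule wnorm_cutoff_le[where m = m]) blast
  note cf = D_L1_mult[OF bdd_smooth_cutoff[OF R0]]
  have "localise R T \<in> B'"
  proof (rule B'I[where C = "C * D" and m = m])
    fix f g :: "'n cfun" and a b assume f: "f \<in> D_L1" and g: "g \<in> D_L1"
    have "(\<lambda>t. a * f t + b * g t) \<in> D_L1" using f g subspace_D_L1 unfolding subspace_fun_def by blast
    moreover have "(\<lambda>x. cutoff R x * (a * f x + b * g x)) = (\<lambda>x. a * (cutoff R x * f x) + b * (cutoff R x * g x))"
      by (simp add: algebra_simps)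
    ultimately show "localise R T (\<lambda>t. a * f t + b * g t) = a * localise R T f + b * localise R T g"
      using f g B'_linear[OF T cf[OF f] cf[OF g], of a b] by (simp add: localise_def)
  next
    fix f :: "'n cfun" assume f: "f \<in> D_L1"
    have "norm (T (cut R f)) \<le> C * (D * dnorm m f)"
      using C(2)[OF cf[OF f]] mult_left_mono[OF D(2)[OF f R], of C] C(1) by linarith
    then show "norm (localise R T f) \<le> C * D * dnorm m f" using f by (simp add: localise_def mult.assoc)
  qed (simp add: localise_def)
  moreover have "compact (dist_support (localise R T))"
  proof -
    have "localise R T f = 0" if f: "f \<in> test_functions" "fun_support f \<subseteq> - cball 0 (2 * R)" for f
    proof -
      have "cutoff R x * f x = 0" for x
      proof (cases "norm x \<le> 2 * R")
        case True
        then have "x \<in> cball 0 (2 * R)" by simp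
        then have "f x = 0" using f(2) fun_support_superset[of f x] by blast
        then show ?thesis by simp
      qed (simp add: cutoff_eq_0[OF R0])
      then have "(cut R f) = (\<lambda>x. 0)" by (rule ext)
      then show ?thesis using B'_0[OF T] by (simp add: localise_def)
    qed
    then have "- cball 0 (2 * R) \<in> {U. open U \<and> (\<forall>f\<in>test_functions. fun_support f \<subseteq> U \<longrightarrow> localise R T f = 0)}"
      by (simp add: open_Compl)
    then have "dist_support (localise R T) \<subseteq> cball 0 (2 * R)"
      unfolding dist_support_def by blast
    then have "bounded (dist_support (localise R T))" by (rule bounded_subset[OF bounded_cball])
    moreover have "closed (dist_support (localise R T))"
      unfolding dist_support_def by (intro closed_Compl open_Union) auto
    ultimately show ?thesis by (simp add: compact_eq_bounded_closed)
  qed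
  ultimately show ?thesis by (simp add: E'_def)
qed

section \<open>Total boundedness of bounded sets in weighted norms\<close>

text \<open>
  The Lipschitz constant depends on \<open>f\<close> only through the integrals of its first derivatives.
\<close>

lemma corr_lipschitz:
  fixes f k :: "'n::finite cfun"
  assumes f: "f \<in> D_L1" and k: "weight k" "\<And>x. norm (k x) \<le> S"
  shows "norm (corr k f x - corr k f y) \<le> S * (norm (x - y) * (\<Sum>i\<in>UNIV. L1_norm (partial i f)))"
proof -
  have S0: "0 \<le> S" using k(2)[of 0] norm_ge_zero order_trans by blast
  let ?d = "\<lambda>z. f (z + (x - y)) - f z"
  have int: "integrable lborel (\<lambda>z. f (z + h))" for h by (rule integrable_translate[OF D_L1_integrable[OF f]])
  have "corr k f x - corr k f y = (LINT z|lborel. k z * f (z + x) - k z * f (z + y))"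
    unfolding corr_def by (rule Bochner_Integration.integral_diff[symmetric]) (intro weight_integrable k int)+
  also have "\<dots> = corr k ?d y" unfolding corr_def by (simp add: algebra_simps)
  finally have "norm (corr k f x - corr k f y) = norm (corr k ?d y)" by simp
  also have "\<dots> \<le> S * L1_norm ?d"
    by (rule norm_corr_le_bound[OF _ k]) (intro Bochner_Integration.integrable_diff int D_L1_integrable f)
  also have "\<dots> \<le> S * (norm (x - y) * (\<Sum>i\<in>UNIV. L1_norm (partial i f)))"
    by (rule mult_left_mono[OF L1_translate_le_norm[OF f] S0])
  finally show ?thesis .
qed

lemma floor_eq_imp_close:
  fixes z w :: complex
  assumes "0 < s" "\<lfloor>Re z / s\<rfloor> = \<lfloor>Re w / s\<rfloor>" "\<lfloor>Im z / s\<rfloor> = \<lfloor>Im w / s\<rfloor>"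
  shows "norm (z - w) \<le> 2 * s"
proof -
  have *: "\<bar>a - b\<bar> \<le> s" if "\<lfloor>a / s\<rfloor> = \<lfloor>b / s\<rfloor>" for a b
  proof -
    have "\<bar>a / s - b / s\<bar> \<le> 1" using that by linarith
    then have "\<bar>(a - b) / s\<bar> \<le> 1" by (simp add: diff_divide_distrib)
    then show ?thesis using assms(1) by (simp add: abs_divide)
  qed
  have "norm (z - w) \<le> \<bar>Re (z - w)\<bar> + \<bar>Im (z - w)\<bar>" by (rule cmod_le)
  then show ?thesis using *[OF assms(2)] *[OF assms(3)] by simp
qed

text \<open>
  A quantitative form of the theorem of Kolmogorov and Riesz. The colour of \<open>f\<close> records the values of its
  mollification at the points of a finite net, rounded to multiples of \<open>s\<close>. Finite colourings, unlike finite nets, are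
  easily combined: for several derivatives at once one takes the tuple of the colours.
\<close>

lemma finite_colouring_L1:
  fixes g :: "'n::finite cfun" and B :: "'n cfun set"
  assumes g: "g \<in> C0" and B: "B \<subseteq> D_L1" and a: "\<And>f. f \<in> B \<Longrightarrow> L1_norm f \<le> a"
    and b: "\<And>f. f \<in> B \<Longrightarrow> (\<Sum>i\<in>UNIV. L1_norm (partial i f)) \<le> b" and e: "0 < e"
    and a0: "0 \<le> a" and b0: "0 \<le> b"
  shows "\<exists>c :: 'n cfun \<Rightarrow> real ^ 'n \<Rightarrow> int \<times> int. finite (c ` B) \<and>
    (\<forall>f\<in>B. \<forall>h\<in>B. c f = c h \<longrightarrow> L1_norm (\<lambda>x. g x * (f x - h x)) \<le> e)"
proof -
  obtain G where G: "0 < G" "\<And>x. norm (g x) \<le> G" using C0_bounded[OF g] by blast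
  note gw = C0_weight[OF g]
  \<comment> \<open>the error budget: \<open>e / 6\<close> for each of the two mollifications, \<open>e / 3\<close> inside the ball and \<open>e / 3\<close> outside\<close>
  define d where "d = e / (6 * G * (b + 1))"
  have d: "0 < d" unfolding d_def using e G(1) b0 by simp
  obtain k where k: "mollifier d (k :: 'n cfun)" using ex_mollifier[OF d] by blast
  note kw = mollifier_weight[OF k]
  have ki: "integrable lborel k" "L1_norm k = 1" using k by (auto simp: mollifier_def)
  obtain S where S: "0 < S" "\<And>x. norm (k x) \<le> S" using weight_bound[OF kw] by blast
  define M where "M f = corr k f" for f
  define e1 where "e1 = e / (6 * (a + 1))"
  have e1: "0 < e1" unfolding e1_def using e a0 by simp
  have "(g \<longlongrightarrow> 0) at_infinity" using g by (simp add: C0_def)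
  from tendstoD[OF this e1] obtain R where R: "\<And>x. R \<le> norm x \<Longrightarrow> norm (g x) \<le> e1"
    unfolding eventually_at_infinity by (auto intro: less_imp_le)
  define V where "V = measure lborel (cball (0 :: real ^ 'n) R)"
  have V: "0 \<le> V" unfolding V_def by simp
  define \<eta> where "\<eta> = e / (3 * G * (V + 1))"
  have \<eta>: "0 < \<eta>" unfolding \<eta>_def using e G(1) V by simp
  \<comment> \<open>moving to a net point costs \<open>\<eta> / 4\<close> for each function, and rounding costs \<open>2 s = \<eta> / 2\<close>\<close>
  define \<rho> where "\<rho> = \<eta> / (4 * (S * b + 1))"
  have Sb: "0 \<le> S * b" using S(1) b0 by simp
  have \<rho>: "0 < \<rho>" unfolding \<rho>_def using \<eta> Sb by simp
  have "seq_compact (cball (0 :: real ^ 'n) R)" by (simp add: compact_imp_seq_compact)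
  then have "\<exists>X. finite X \<and> X \<subseteq> cball (0 :: real ^ 'n) R \<and> cball (0 :: real ^ 'n) R \<subseteq> (\<Union>x\<in>X. ball x \<rho>)"
    using seq_compact_imp_totally_bounded \<rho> by blast
  then obtain X where X: "finite X" "X \<subseteq> cball (0 :: real ^ 'n) R" "cball (0 :: real ^ 'n) R \<subseteq> (\<Union>x\<in>X. ball x \<rho>)"
    by (elim exE conjE)
  define s where "s = \<eta> / 4"
  have s: "0 < s" unfolding s_def using \<eta> by simp
  define c where "c f = (\<lambda>x. if x \<in> X then (\<lfloor>Re (M f x) / s\<rfloor>, \<lfloor>Im (M f x) / s\<rfloor>) else (0, 0))" for f
  define L where "L = \<lceil>S * a / s\<rceil> + 1"
  have "c ` B \<subseteq> {h. \<forall>x. (x \<in> X \<longrightarrow> h x \<in> {- L..L} \<times> {- L..L}) \<and> (x \<notin> X \<longrightarrow> h x = (0, 0))}"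
  proof
    fix h assume "h \<in> c ` B"
    then obtain f where f: "f \<in> B" "h = c f" by blast
    have "norm (M f x) \<le> S * a" for x
    proof -
      have "f \<in> D_L1" using f B by blast
      then have "norm (M f x) \<le> S * L1_norm f"
        unfolding M_def by (intro norm_corr_le_bound D_L1_integrable kw S)
      then show ?thesis using mult_left_mono[OF a[OF f(1)], of S] S(1) by linarith
    qed
    then have "\<bar>Re (M f x)\<bar> \<le> S * a" "\<bar>Im (M f x)\<bar> \<le> S * a" for x
      using abs_Re_le_cmod abs_Im_le_cmod order_trans by blast+
    then have q: "\<bar>Re (M f x) / s\<bar> \<le> S * a / s" "\<bar>Im (M f x) / s\<bar> \<le> S * a / s" for x
      using s by (auto simp: abs_divide intro!: divide_right_mono)
    have fl: "\<lfloor>t\<rfloor> \<in> {- L..L}" if "\<bar>t\<bar> \<le> S * a / s" for t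
      using that unfolding L_def by (auto simp: abs_le_iff) linarith+
    show "h \<in> {h. \<forall>x. (x \<in> X \<longrightarrow> h x \<in> {- L..L} \<times> {- L..L}) \<and> (x \<notin> X \<longrightarrow> h x = (0, 0))}"
      using fl[OF q(1)] fl[OF q(2)] unfolding f(2) c_def by simp
  qed
  then have fin: "finite (c ` B)"
    by (rule finite_subset) (intro finite_set_of_finite_funs X(1) finite_cartesian_product finite_atLeastAtMost_int)
  have "L1_norm (\<lambda>x. g x * (f x - h x)) \<le> e" if fB: "f \<in> B" and hB: "h \<in> B" and ch: "c f = c h" for f h
  proof -
    have f: "f \<in> D_L1" and h: "h \<in> D_L1" using fB hB B by auto
    have sm: "smooth (M f)" "smooth (M h)" unfolding M_def by (intro smooth_corr f h kw)+
    have Mi: "integrable lborel (M f)" "integrable lborel (M h)"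
      unfolding M_def by (intro L1_norm_corr_le kw ki f h)+
    have close: "norm (M f x - M h x) \<le> \<eta>" if x: "norm x \<le> R" for x
    proof -
      have "x \<in> cball 0 R" using x by simp
      then obtain y where y: "y \<in> X" "dist y x < \<rho>" using X(3) by force
      have lip: "norm (M u x - M u y) \<le> \<eta> / 4" if u: "u \<in> B" for u
      proof -
        have "norm (M u x - M u y) \<le> S * (norm (x - y) * (\<Sum>i\<in>UNIV. L1_norm (partial i u)))"
          unfolding M_def using u B by (intro corr_lipschitz kw S) auto
        also have "\<dots> \<le> S * (\<rho> * b)"
          using y(2) S(1) \<rho> b[OF u]
          by (intro mult_left_mono mult_mono sum_nonneg L1_norm_nonneg) (auto simp: dist_norm norm_minus_commute)
        also have "\<dots> = \<rho> * (S * b)" by simp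
        also have "\<dots> \<le> \<rho> * (S * b + 1)" using \<rho> by simp
        also have "\<dots> = \<eta> / 4"
        proof -
          have "\<eta> / (4 * t) * t = \<eta> / 4" if "t \<noteq> 0" for t using that by simp
          moreover have "S * b + 1 \<noteq> 0" using Sb by linarith
          ultimately show ?thesis unfolding \<rho>_def by blast
        qed
        finally show ?thesis .
      qed
      have "c f y = c h y" using ch by simp
      then have "norm (M f y - M h y) \<le> 2 * s"
        using y(1) s by (intro floor_eq_imp_close) (auto simp: c_def)
      moreover have "norm (M f x - M h x) \<le> norm (M f x - M f y) + norm (M f y - M h y) + norm (M h x - M h y)"
        using norm_triangle_ineq[of "M f x - M f y" "M f y - M h x"] norm_triangle_ineq[of "M f y - M h y" "M h y - M h x"]
        by (simp add: norm_minus_commute)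
      ultimately show ?thesis using lip[OF fB] lip[OF hB] unfolding s_def by linarith
    qed
    have appr: "L1_norm (\<lambda>x. g x * (u x - M u x)) \<le> e / 6" if u: "u \<in> B" for u
    proof -
      have uD: "u \<in> D_L1" using u B by blast
      have "integrable lborel (\<lambda>x. u x - M u x)"
        unfolding M_def by (intro Bochner_Integration.integrable_diff L1_norm_corr_le D_L1_integrable kw ki uD)
      then have "L1_norm (\<lambda>x. g x * (u x - M u x)) \<le> G * L1_norm (\<lambda>x. u x - M u x)"
        using gw G(2) by (intro L1_norm_mult_le) (auto simp: weight_def)
      also have "\<dots> \<le> G * (d * b)"
      proof (rule mult_left_mono)
        have "L1_norm (\<lambda>x. u x - M u x) \<le> d * (\<Sum>i\<in>UNIV. L1_norm (partial i u))"
          unfolding M_def using d by (intro mollifier_approx k uD) simp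
        also have "\<dots> \<le> d * b" using d b[OF u] by (intro mult_left_mono) auto
        finally show "L1_norm (\<lambda>x. u x - M u x) \<le> d * b" .
      qed (use G in simp)
      also have "\<dots> = d * (G * b)" by simp
      also have "\<dots> \<le> d * (G * (b + 1))" using d G(1) by (intro mult_left_mono) auto
      also have "\<dots> = e / 6"
      proof -
        have "e / (6 * G * t) * (G * t) = e / 6" if "t \<noteq> 0" for t using that G(1) by (simp add: field_simps)
        then show ?thesis unfolding d_def using b0 by simp
      qed
      finally show ?thesis .
    qed
    have mid: "L1_norm (\<lambda>x. g x * (M f x - M h x)) \<le> 2 * e / 3"
    proof -
      have ci: "integrable lborel (\<lambda>x. indicator (cball (0 :: real ^ 'n) R) x :: real)"
        by (intro integrable_real_indicator emeasure_bounded_finite) auto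
      have "L1_norm (\<lambda>x. g x * (M f x - M h x)) \<le> (LINT x|lborel. G * \<eta> * indicator (cball 0 R) x + e1 * norm (M f x - M h x))"
        unfolding L1_norm_def
      proof (rule integral_mono)
        show "integrable lborel (\<lambda>x. norm (g x * (M f x - M h x)))"
          by (intro integrable_norm weight_integrable gw Bochner_Integration.integrable_diff Mi)
        show "integrable lborel (\<lambda>x. G * \<eta> * indicator (cball 0 R) x + e1 * norm (M f x - M h x))"
          by (intro Bochner_Integration.integrable_add integrable_mult_right ci integrable_norm Bochner_Integration.integrable_diff Mi)
        fix x :: "real ^ 'n"
        show "norm (g x * (M f x - M h x)) \<le> G * \<eta> * indicator (cball 0 R) x + e1 * norm (M f x - M h x)"
        proof (cases "norm x \<le> R")
          case True
          have "norm (g x) * norm (M f x - M h x) \<le> G * \<eta>"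
            using G close[OF True] by (intro mult_mono) auto
          moreover have "0 \<le> e1 * norm (M f x - M h x)" using e1 by simp
          ultimately show ?thesis using True by (simp add: norm_mult)
        next
          case False
          have "norm (g x) * norm (M f x - M h x) \<le> e1 * norm (M f x - M h x)"
            using R[of x] False by (intro mult_right_mono) auto
          then show ?thesis using False by (simp add: norm_mult)
        qed
      qed
      also have "\<dots> = G * \<eta> * V + e1 * L1_norm (\<lambda>x. M f x - M h x)"
        unfolding V_def L1_norm_def using ci Mi
        by (subst Bochner_Integration.integral_add)
          (auto intro!: integrable_norm Bochner_Integration.integrable_diff)
      also have "\<dots> \<le> G * \<eta> * (V + 1) + e1 * (2 * (a + 1))"
      proof (intro add_mono mult_left_mono)
        have "L1_norm (\<lambda>x. M f x - M h x) = L1_norm (\<lambda>x. M f x + (- 1) * M h x)" by simp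
        also have "\<dots> \<le> L1_norm (M f) + L1_norm (\<lambda>x. (- 1) * M h x)"
          by (intro L1_norm_add integrable_mult_right Mi)
        also have "L1_norm (\<lambda>x. (- 1) * M h x) = L1_norm (M h)" by (subst L1_norm_scale) simp
        also have "L1_norm (M f) + L1_norm (M h) \<le> a + a"
        proof (intro add_mono)
          show "L1_norm (M f) \<le> a" using L1_norm_corr_le(2)[OF kw ki(1) f] ki(2) a[OF fB] by (simp add: M_def)
          show "L1_norm (M h) \<le> a" using L1_norm_corr_le(2)[OF kw ki(1) h] ki(2) a[OF hB] by (simp add: M_def)
        qed
        finally show "L1_norm (\<lambda>x. M f x - M h x) \<le> 2 * (a + 1)" by simp
      qed (use G(1) \<eta> e1 in auto)
      also have "\<dots> = 2 * e / 3"
      proof -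
        have 1: "G * (e / (3 * G * t)) * t = e / 3" if "t \<noteq> 0" for t
          using that G(1) by (simp add: field_simps)
        have 2: "e / (6 * t) * (2 * t) = e / 3" if "t \<noteq> 0" for t
          using that by (simp add: field_simps)
        have "G * \<eta> * (V + 1) = e / 3" unfolding \<eta>_def by (rule 1) (use V in linarith)
        moreover have "e1 * (2 * (a + 1)) = e / 3" unfolding e1_def by (rule 2) (use a0 in linarith)
        ultimately show ?thesis by simp
      qed
      finally show ?thesis .
    qed
    have i1: "integrable lborel (\<lambda>x. g x * (u x - M u x))" if "u \<in> D_L1" for u
      unfolding M_def by (intro weight_integrable gw Bochner_Integration.integrable_diff L1_norm_corr_le D_L1_integrable kw ki that)
    have i2: "integrable lborel (\<lambda>x. g x * (M f x - M h x))"
      by (intro weight_integrable gw Bochner_Integration.integrable_diff Mi)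
    have "L1_norm (\<lambda>x. g x * (f x - h x)) = L1_norm (\<lambda>x. (g x * (f x - M f x) + g x * (M f x - M h x)) + (- 1) * (g x * (h x - M h x)))"
      by (simp add: algebra_simps)
    also have "\<dots> \<le> L1_norm (\<lambda>x. g x * (f x - M f x) + g x * (M f x - M h x)) + L1_norm (\<lambda>x. (- 1) * (g x * (h x - M h x)))"
      by (intro L1_norm_add Bochner_Integration.integrable_add integrable_mult_right i1 i2 f h)
    also have "\<dots> \<le> (L1_norm (\<lambda>x. g x * (f x - M f x)) + L1_norm (\<lambda>x. g x * (M f x - M h x))) + L1_norm (\<lambda>x. g x * (h x - M h x))"
      using L1_norm_add[OF i1[OF f] i2] L1_norm_scale[of "- 1" "\<lambda>x. g x * (h x - M h x)"] by simp
    also have "\<dots> \<le> (e / 6 + 2 * e / 3) + e / 6" by (intro add_mono appr mid fB hB)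
    finally show ?thesis by simp
  qed
  then show ?thesis using fin by (intro exI[of _ c]) blast
qed

lemma bounded_set_totally_bounded:
  fixes g :: "'n::finite cfun" and B :: "'n cfun set"
  assumes g: "g \<in> C0" and B: "bounded_set B" and e: "0 < e"
  obtains F where "finite F" "F \<subseteq> B" "\<And>f. f \<in> B \<Longrightarrow> \<exists>h\<in>F. wnorm g m (\<lambda>x. f x - h x) \<le> e"
proof -
  have BD: "B \<subseteq> D_L1" using B by (simp add: bounded_set_def)
  have "\<exists>c :: 'n cfun \<Rightarrow> real ^ 'n \<Rightarrow> int \<times> int. finite (c ` (ders is ` B)) \<and>
    (\<forall>f\<in>ders is ` B. \<forall>h\<in>ders is ` B. c f = c h \<longrightarrow> L1_norm (\<lambda>x. g x * (f x - h x)) \<le> e)" for "is"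
  proof -
    obtain b where b: "\<And>f. f \<in> B \<Longrightarrow> dnorm (Suc (length is)) f \<le> b"
      using B unfolding bounded_set_def by blast
    show ?thesis
    proof (rule finite_colouring_L1[where a = "\<bar>b\<bar>" and b = "CARD('n) * \<bar>b\<bar>"])
      show "L1_norm f \<le> \<bar>b\<bar>" if fB: "f \<in> ders is ` B" for f
      proof -
        obtain u where u: "u \<in> B" "f = ders is u" using fB by blast
        have "L1_norm f \<le> dnorm (Suc (length is)) u"
          unfolding u(2) by (rule wnorm_ge_1) (use u BD D_L1_smooth in auto)
        then show ?thesis using b[OF u(1)] by linarith
      qed
      show "(\<Sum>i\<in>UNIV. L1_norm (partial i f)) \<le> CARD('n) * \<bar>b\<bar>" if fB: "f \<in> ders is ` B" for f
      proof -
        obtain u where u: "u \<in> B" "f = ders is u" using fB by blast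
        have "L1_norm (partial i f) \<le> \<bar>b\<bar>" for i
        proof -
          have "L1_norm (ders (i # is) u) \<le> dnorm (Suc (length is)) u"
            by (rule wnorm_ge_1) (use u BD D_L1_smooth in auto)
          then show ?thesis using b[OF u(1)] by (simp add: u(2))
        qed
        then show ?thesis using sum_bounded_above[of UNIV "\<lambda>i. L1_norm (partial i f)" "\<bar>b\<bar>"] by simp
      qed
    qed (use g BD D_L1_ders e in auto)
  qed
  then have "\<forall>is. \<exists>c :: 'n cfun \<Rightarrow> real ^ 'n \<Rightarrow> int \<times> int. finite (c ` (ders is ` B)) \<and>
    (\<forall>f\<in>ders is ` B. \<forall>h\<in>ders is ` B. c f = c h \<longrightarrow> L1_norm (\<lambda>x. g x * (f x - h x)) \<le> e)" by (rule allI)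
  from choice[OF this] obtain c :: "'n list \<Rightarrow> 'n cfun \<Rightarrow> real ^ 'n \<Rightarrow> int \<times> int" where
    c0: "\<forall>is. finite (c is ` (ders is ` B)) \<and>
      (\<forall>f\<in>ders is ` B. \<forall>h\<in>ders is ` B. c is f = c is h \<longrightarrow> L1_norm (\<lambda>x. g x * (f x - h x)) \<le> e)" ..
  have c: "finite (c is ` (ders is ` B))"
    "f \<in> ders is ` B \<Longrightarrow> h \<in> ders is ` B \<Longrightarrow> c is f = c is h \<Longrightarrow> L1_norm (\<lambda>x. g x * (f x - h x)) \<le> e" for "is" f h
    using c0 by blast+
  define C where "C f = (\<lambda>is\<in>words m. c is (ders is f))" for f
  have "C ` B \<subseteq> PiE (words m) (\<lambda>is. c is ` (ders is ` B))" unfolding C_def by auto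
  then have finC: "finite (C ` B)" by (rule finite_subset) (intro finite_PiE finite_words c(1))
  define F where "F = inv_into B C ` (C ` B)"
  have "finite F" unfolding F_def using finC by simp
  moreover have "F \<subseteq> B" unfolding F_def by (auto intro: inv_into_into)
  moreover have "\<exists>h\<in>F. wnorm g m (\<lambda>x. f x - h x) \<le> e" if f: "f \<in> B" for f
  proof
    let ?h = "inv_into B C (C f)"
    show "?h \<in> F" unfolding F_def using f by blast
    have h: "?h \<in> B" using f by (auto intro: inv_into_into)
    have Ch: "C ?h = C f" using f_inv_into_f[of "C f" C B] f by blast
    show "wnorm g m (\<lambda>x. f x - ?h x) \<le> e"
    proof (rule wnorm_le)
      fix "is" :: "'n list" assume is_: "is \<in> words m"
      have "C ?h is = C f is" using Ch by simp
      then have eq: "c is (ders is f) = c is (ders is ?h)" unfolding C_def using is_ by simp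
      have "smooth f" "smooth ?h" using f h BD D_L1_smooth by auto
      then show "L1_norm (\<lambda>x. g x * ders is (\<lambda>x. f x - ?h x) x) \<le> e"
        using c(2)[OF _ _ eq] f h by (simp add: ders_diff)
    qed
  qed
  ultimately show ?thesis using that by blast
qed

section \<open>Polars of weighted norms\<close>

definition polar_of :: "'n::finite cfun \<Rightarrow> nat \<Rightarrow> 'n functional set" where
  "polar_of g m = {T \<in> B'. \<forall>f\<in>D_L1. norm (T f) \<le> wnorm g m f}"

lemma polar_ofI:
  fixes T :: "'n::finite functional"
  assumes g: "weight g"
    and lin: "\<And>f h a b. f \<in> D_L1 \<Longrightarrow> h \<in> D_L1 \<Longrightarrow> T (\<lambda>t. a * f t + b * h t) = a * T f + b * T h"
    and off: "\<And>f. f \<notin> D_L1 \<Longrightarrow> T f = 0"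
    and bound: "\<And>f. f \<in> D_L1 \<Longrightarrow> norm (T f) \<le> wnorm g m f"
  shows "T \<in> polar_of g m"
proof -
  obtain A where A: "0 < A" "\<And>x. norm (g x) \<le> A" using weight_bound[OF g] by blast
  have "T \<in> B'"
    by (rule B'I[OF lin off order_trans[OF bound wnorm_le_unweighted[OF g A(2)]]])
  then show ?thesis using bound by (simp add: polar_of_def)
qed

lemma polar_of_absolutely_convex:
  assumes g: "weight g"
  shows "absolutely_convex (polar_of g m)"
  unfolding absolutely_convex_def
proof (intro ballI allI impI)
  fix S T a b assume S: "S \<in> polar_of g m" and T: "T \<in> polar_of g m" and ab: "norm (a :: complex) + norm (b :: complex) \<le> 1"
  have "(\<lambda>f. a * S f + b * T f) \<in> B'"
    using S T subspace_B' unfolding polar_of_def subspace_fun_def by blast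
  moreover have "norm (a * S f + b * T f) \<le> wnorm g m f" if f: "f \<in> D_L1" for f
  proof -
    have "norm (a * S f + b * T f) \<le> norm a * norm (S f) + norm b * norm (T f)"
      using norm_triangle_ineq[of "a * S f" "b * T f"] by (simp add: norm_mult)
    also have "\<dots> \<le> norm a * wnorm g m f + norm b * wnorm g m f"
      using S T f unfolding polar_of_def by (intro add_mono mult_left_mono) auto
    also have "\<dots> = (norm a + norm b) * wnorm g m f" by (simp add: algebra_simps)
    also have "\<dots> \<le> 1 * wnorm g m f"
      by (rule mult_right_mono[OF ab wnorm_nonneg[OF D_L1_smooth[OF f]]])
    finally show ?thesis by simp
  qed
  ultimately show "(\<lambda>f. a * S f + b * T f) \<in> polar_of g m" by (simp add: polar_of_def)
qed

lemma polar_of_subset_B'_dot: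
  fixes g :: "'n::finite cfun"
  assumes g: "g \<in> C0"
  shows "polar_of g m \<subseteq> B'_dot"
proof
  fix T assume T: "T \<in> polar_of g m"
  then have TB: "T \<in> B'" and Tp: "\<And>f. f \<in> D_L1 \<Longrightarrow> norm (T f) \<le> wnorm g m f" by (auto simp: polar_of_def)
  have "\<exists>S\<in>E'. S \<in> U" if U: "openin B'_topology U" "T \<in> U" for U
  proof -
    obtain Q r where Q: "finite Q" "Q \<subseteq> {sup_on B | B. bounded_set B}" "0 < r"
      and sub: "{S \<in> B'. \<forall>q\<in>Q. q (\<lambda>f. S f - T f) < r} \<subseteq> U"
      by (rule openin_seminorm_topology_nhd[OF subspace_B' _ U[unfolded B'_topology_eq]]) (use sup_on_seminorm in blast)
    have "\<exists>c. 0 \<le> c \<and> (\<forall>d S. 0 \<le> d \<longrightarrow> (\<forall>f\<in>D_L1. norm (S f) \<le> d * dnorm m f) \<longrightarrow> q S \<le> d * c)" if q: "q \<in> Q" for q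
    proof -
      obtain B where B: "q = sup_on B" "bounded_set B" using q Q(2) by blast
      then obtain c where c: "\<And>f. f \<in> B \<Longrightarrow> dnorm m f \<le> c" unfolding bounded_set_def by blast
      have "q S \<le> d * \<bar>c\<bar>" if d: "0 \<le> d" and S: "\<forall>f\<in>D_L1. norm (S f) \<le> d * dnorm m f" for d S
        unfolding B(1)
      proof (rule sup_on_least[OF B(2)])
        fix f assume f: "f \<in> B"
        then have "norm (S f) \<le> d * dnorm m f" using S B(2) unfolding bounded_set_def by blast
        also have "\<dots> \<le> d * \<bar>c\<bar>" using c[OF f] by (intro mult_left_mono d) simp
        finally show "norm (S f) \<le> d * \<bar>c\<bar>" .
      qed
      then show ?thesis by (intro exI[of _ "\<bar>c\<bar>"]) simp
    qed
    then have "\<forall>q\<in>Q. \<exists>c. 0 \<le> c \<and> (\<forall>d S. 0 \<le> d \<longrightarrow> (\<forall>f\<in>D_L1. norm (S f) \<le> d * dnorm m f) \<longrightarrow> q S \<le> d * c)" by simp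
    from bchoice[OF this] obtain cq where cq0: "\<forall>q\<in>Q. 0 \<le> cq q \<and> (\<forall>d S. 0 \<le> d \<longrightarrow> (\<forall>f\<in>D_L1. norm (S f) \<le> d * dnorm m f) \<longrightarrow> q S \<le> d * cq q)" ..
    have cq: "0 \<le> cq q" "0 \<le> d \<Longrightarrow> (\<forall>f\<in>D_L1. norm (S f) \<le> d * dnorm m f) \<Longrightarrow> q S \<le> d * cq q"
      if "q \<in> Q" for q d S
      using bspec[OF cq0 that] by simp_all
    define c where "c = (\<Sum>q\<in>Q. cq q)"
    have c0: "0 \<le> c" unfolding c_def by (rule sum_nonneg) (rule cq(1))
    obtain C where C: "0 < C" "\<And>g f R e. weight g \<Longrightarrow> f \<in> D_L1 \<Longrightarrow> 1 \<le> R \<Longrightarrow> (\<And>x :: real ^ 'n. R \<le> norm x \<Longrightarrow> norm (g x) \<le> e) \<Longrightarrow> 0 \<le> e \<Longrightarrow>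
       wnorm g m (tail R f) \<le> C * e * dnorm m f"
      by (rule wnorm_tail_le[where m = m]) blast
    define e where "e = r / (2 * C * (c + 1))"
    have e: "0 < e" unfolding e_def using Q(3) C(1) c0 by simp
    have "(g \<longlongrightarrow> 0) at_infinity" using g by (simp add: C0_def)
    from tendstoD[OF this e] obtain R0 where R0: "\<And>x. R0 \<le> norm x \<Longrightarrow> norm (g x) \<le> e"
      unfolding eventually_at_infinity by (auto intro: less_imp_le)
    define R where "R = max 1 R0"
    have R: "1 \<le> R" "\<And>x. R \<le> norm x \<Longrightarrow> norm (g x) \<le> e" using R0 by (auto simp: R_def)
    define S where "S = localise R T"
    have SE: "S \<in> E'" unfolding S_def by (rule localise_E'[OF TB R(1)])
    have "q (\<lambda>f. S f - T f) < r" if q: "q \<in> Q" for q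
    proof -
      have "q (\<lambda>f. S f - T f) \<le> C * e * cq q"
      proof (rule cq(2)[OF q], goal_cases)
        case 1
        then show ?case using C(1) e by simp
      next
        case 2
        show ?case
        proof
        fix f :: "'n cfun" assume fD: "f \<in> D_L1"
        have cf: "(cut R f) \<in> D_L1" using R(1) by (intro D_L1_mult bdd_smooth_cutoff fD) simp
        have df: "(tail R f) \<in> D_L1" using R(1) by (intro D_L1_mult bdd_smooth_one_minus_cutoff fD) simp
        have "(tail R f) = (\<lambda>x. f x - cutoff R x * f x)" by (simp add: algebra_simps)
        then have "T (tail R f) = - (S f - T f)"
          using B'_diff[OF TB fD cf] fD by (simp add: S_def localise_def)
        then have "norm (S f - T f) = norm (T (tail R f))" by (simp add: norm_minus_commute)
        also have "\<dots> \<le> wnorm g m (tail R f)" by (rule Tp[OF df])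
        also have "\<dots> \<le> C * e * dnorm m f"
          by (rule C(2)[OF C0_weight[OF g] fD R(1) R(2)]) (use e in auto)
        finally show "norm (S f - T f) \<le> C * e * dnorm m f" .
        qed
      qed
      also have "\<dots> \<le> C * e * c"
      proof (rule mult_left_mono)
        show "cq q \<le> c" unfolding c_def using q Q(1) cq(1) by (intro member_le_sum) auto
      qed (use C(1) e in simp)
      also have "C * e * c \<le> C * e * (c + 1)" using C(1) e by simp
      also have "\<dots> = r / 2"
      proof -
        have "C * (r / (2 * C * t)) * t = r / 2" if "t \<noteq> 0" for t using that C(1) by (simp add: field_simps)
        then show ?thesis unfolding e_def using c0 by simp
      qed
      also have "\<dots> < r" using Q(3) by simp
      finally show ?thesis .
    qed
    then have "S \<in> U" using sub SE unfolding E'_def by blast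
    then show ?thesis using SE by blast
  qed
  then show "T \<in> B'_dot"
    unfolding B'_dot_def in_closure_of topspace_B'_topology using TB by blast
qed

text \<open>
  The topology here is that of pointwise convergence. The polar is cut out by the closed linearity conditions
  from a product of discs, which is compact by Tychonoff.
\<close>

lemma polar_of_compact_pointwise:
  fixes g :: "'n::finite cfun"
  assumes g: "weight g"
  shows "compact (polar_of g m)"
proof -
  let ?V = "D_L1 :: 'n cfun set"
  define rad where "rad f = (if f \<in> ?V then wnorm g m f else 0)" for f
  define box where "box = (\<Pi>\<^sub>E f\<in>UNIV. cball (0 :: complex) (rad f))"
  define lin where "lin = (\<Inter>f\<in>?V. \<Inter>h\<in>?V. \<Inter>a. \<Inter>b. {T :: 'n functional. T (\<lambda>t. a * f t + b * h t) = a * T f + b * T h})"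
  have "compactin (product_topology (\<lambda>f. euclidean) UNIV) box"
    unfolding box_def compactin_PiE by simp
  then have "compact box" by (simp add: euclidean_product_topology)
  moreover have "closed lin"
    unfolding lin_def
    by (intro closed_INT ballI closed_Collect_eq continuous_intros continuous_on_product_coordinates)
  moreover have "polar_of g m = box \<inter> lin"
  proof
    show "polar_of g m \<subseteq> box \<inter> lin"
    proof
      fix T assume T: "T \<in> polar_of g m"
      then have TB: "T \<in> B'" by (simp add: polar_of_def)
      have "norm (T f) \<le> rad f" for f
        using T B'_off[OF TB, of f] by (auto simp: polar_of_def rad_def)
      then have "T \<in> box" by (simp add: box_def PiE_iff)
      moreover have "T \<in> lin" unfolding lin_def using B'_linear[OF TB] by blast
      ultimately show "T \<in> box \<inter> lin" by blast
    qed
    show "box \<inter> lin \<subseteq> polar_of g m"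
    proof
      fix T assume T: "T \<in> box \<inter> lin"
      then have r: "norm (T f) \<le> rad f" for f by (simp add: box_def PiE_iff)
      show "T \<in> polar_of g m"
      proof (rule polar_ofI[OF g])
        show "T (\<lambda>t. a * f t + b * h t) = a * T f + b * T h" if "f \<in> D_L1" "h \<in> D_L1" for f h a b
          using T that unfolding lin_def by blast
        show "T f = 0" if "f \<notin> D_L1" for f using r[of f] that by (simp add: rad_def)
        show "norm (T f) \<le> wnorm g m f" if "f \<in> D_L1" for f using r[of f] that by (simp add: rad_def)
      qed
    qed
  qed
  ultimately show ?thesis by (simp add: compact_Int_closed)
qed

text \<open>
  On the polar, \<open>wnorm g m\<close> controls all functionals at once. So it suffices to control them on a finite net of a
  bounded set, and the strong topology is that of pointwise convergence.
\<close>

lemma polar_of_compactin: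
  fixes g :: "'n::finite cfun"
  assumes g: "g \<in> C0"
  shows "compactin B'_dot_topology (polar_of g m)"
proof -
  let ?K = "polar_of g m"
  have KB: "?K \<subseteq> B'" by (auto simp: polar_of_def)
  have "continuous_map (top_of_set ?K) B'_topology id"
    unfolding B'_topology_eq seminorm_topology_def continuous_on_generated_topo_iff
  proof (intro conjI allI impI)
    fix U :: "'n functional set"
    assume "U \<in> {{S \<in> B'. p (\<lambda>t. S t - T t) < e} |p T e. p \<in> {sup_on B |B. bounded_set B} \<and> T \<in> B' \<and> 0 < e}"
    then obtain B T0 e where U: "U = {S \<in> B'. sup_on B (\<lambda>t. S t - T0 t) < e}" and B: "bounded_set B" and T0: "T0 \<in> B'" and e: "0 < e"
      by blast
    have BD: "B \<subseteq> D_L1" using B by (simp add: bounded_set_def)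
    have "openin (top_of_set ?K) (id -` U \<inter> ?K)"
    proof (subst openin_subopen, intro ballI)
      fix T1 assume T1: "T1 \<in> id -` U \<inter> ?K"
      then have T1K: "T1 \<in> ?K" and T1e: "sup_on B (\<lambda>t. T1 t - T0 t) < e" by (auto simp: U)
      \<comment> \<open>three of these parts suffice: two for the distance to the net and one at the net points\<close>
      define d where "d = (e - sup_on B (\<lambda>t. T1 t - T0 t)) / 4"
      have d: "0 < d" unfolding d_def using T1e by simp
      obtain F where F: "finite F" "F \<subseteq> B" "\<And>f. f \<in> B \<Longrightarrow> \<exists>h\<in>F. wnorm g m (\<lambda>x. f x - h x) \<le> d"
        using bounded_set_totally_bounded[OF g B d, of m] by blast
      define W where "W = ?K \<inter> (\<Inter>h\<in>F. {T. norm (T h - T1 h) < d})"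
      have "open (\<Inter>h\<in>F. {T :: 'n functional. norm (T h - T1 h) < d})"
        by (intro open_INT F(1) ballI open_Collect_less continuous_intros continuous_on_product_coordinates)
      then have "openin (top_of_set ?K) W" unfolding W_def by (rule openin_open_Int)
      moreover have "T1 \<in> W" unfolding W_def using T1K d by simp
      moreover have "W \<subseteq> id -` U \<inter> ?K"
      proof
        fix T assume T: "T \<in> W"
        then have TK: "T \<in> ?K" unfolding W_def by blast
        have TB: "T \<in> B'" and T1B: "T1 \<in> B'" using TK T1K KB by auto
        have "sup_on B (\<lambda>t. T t - T1 t) \<le> 3 * d"
        proof (rule sup_on_least[OF B])
          fix f assume f: "f \<in> B"
          then obtain h where h: "h \<in> F" "wnorm g m (\<lambda>x. f x - h x) \<le> d" using F(3) by blast
          have fD: "f \<in> D_L1" and hD: "h \<in> D_L1" using f h(1) F(2) BD by auto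
          have split: "S f = S (\<lambda>x. f x - h x) + S h" and small: "norm (S (\<lambda>x. f x - h x)) \<le> d" if "S \<in> ?K" for S
          proof -
            have "S \<in> B'" using that KB by blast
            then show "S f = S (\<lambda>x. f x - h x) + S h" using B'_diff[of S f h] fD hD by simp
            show "norm (S (\<lambda>x. f x - h x)) \<le> d"
              using that D_L1_diff[OF fD hD] h(2) unfolding polar_of_def by fastforce
          qed
          have Th: "norm (T h - T1 h) < d" using T h(1) unfolding W_def by blast
          have "T f - T1 f = T (\<lambda>x. f x - h x) - T1 (\<lambda>x. f x - h x) + (T h - T1 h)"
            using split[OF TK] split[OF T1K] by simp
          then have "norm (T f - T1 f) \<le> norm (T (\<lambda>x. f x - h x)) + norm (T1 (\<lambda>x. f x - h x)) + norm (T h - T1 h)"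
            using norm_triangle_ineq[of "T (\<lambda>x. f x - h x) - T1 (\<lambda>x. f x - h x)" "T h - T1 h"]
              norm_triangle_ineq4[of "T (\<lambda>x. f x - h x)" "T1 (\<lambda>x. f x - h x)"] by simp
          then show "norm (T f - T1 f) \<le> 3 * d" using small[OF TK] small[OF T1K] Th by linarith
        qed
        moreover have "sup_on B (\<lambda>t. T t - T0 t) \<le> sup_on B (\<lambda>t. T t - T1 t) + sup_on B (\<lambda>t. T1 t - T0 t)"
          by (rule seminorm_on_triangle[OF subspace_B' sup_on_seminorm[OF B] T0 T1B TB])
        ultimately have "sup_on B (\<lambda>t. T t - T0 t) < e" using d unfolding d_def by simp
        then show "T \<in> id -` U \<inter> ?K" using TK TB by (simp add: U)
      qed
      ultimately show "\<exists>S. openin (top_of_set ?K) S \<and> T1 \<in> S \<and> S \<subseteq> id -` U \<inter> ?K" by blast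
    qed
    then show "openin (top_of_set ?K) (id -` U \<inter> topspace (top_of_set ?K))" by simp
  next
    have "?K \<subseteq> topspace B'_topology" using KB by (simp add: topspace_B'_topology)
    then show "id ` topspace (top_of_set ?K) \<subseteq> \<Union> {{S \<in> B'. p (\<lambda>t. S t - T t) < e} |p T e. p \<in> {sup_on B |B. bounded_set B} \<and> T \<in> B' \<and> 0 < e}"
      unfolding B'_topology_eq seminorm_topology_def topology_generated_by_topspace by simp
  qed
  then have "continuous_map (top_of_set ?K) B'_dot_topology id"
    unfolding B'_dot_topology_def using polar_of_subset_B'_dot[OF g, of m] by (auto simp: continuous_map_in_subtopology)
  moreover have "compactin (top_of_set ?K) ?K"
    using polar_of_compact_pointwise[OF C0_weight[OF g], of m] by (simp add: compactin_subtopology compactin_euclidean_iff)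
  ultimately have "compactin B'_dot_topology (id ` ?K)" by (intro image_compactin)
  then show ?thesis by simp
qed

lemma polar_of_nonempty: "weight g \<Longrightarrow> (\<lambda>f. 0) \<in> polar_of g m"
  by (rule polar_ofI) (auto intro: wnorm_nonneg D_L1_smooth)

text \<open>
  Integrate a derivative of maximal weighted norm against its conjugate phase.
\<close>

lemma wnorm_le_sup_polar:
  fixes g :: "'n::finite cfun"
  assumes g: "weight g" and f: "f \<in> D_L1"
  shows "wnorm g m f \<le> (SUP T\<in>polar_of g m. norm (T f))"
proof -
  obtain "is" where is_: "is \<in> words m" "wnorm g m f = L1_norm (\<lambda>x. g x * ders is f x)"
    using wnorm_attained[OF D_L1_smooth[OF f]] by blast
  define v where "v x = g x * ders is f x" for x
  define w where "w x = cnj (v x) / of_real (norm (v x))" for x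
  have vm: "v \<in> borel_measurable borel"
    unfolding v_def[abs_def] using integrable_weighted[OF g f, of "is"] by auto
  have "(\<lambda>x. cnj (v x)) \<in> borel_measurable borel"
    by (rule measurable_compose[OF vm borel_measurable_continuous_onI]) (auto intro!: continuous_intros)
  then have wm: "w \<in> borel_measurable borel" unfolding w_def[abs_def] using vm by measurable
  have w1: "norm (w x) \<le> 1" for x by (cases "v x = 0") (auto simp: w_def norm_divide)
  have ww: "weight w" unfolding weight_def using wm w1 by (auto simp: bounded_iff)
  define T where "T h = (if h \<in> D_L1 then LINT x|lborel. w x * (g x * ders is h x) else 0)" for h
  have int: "integrable lborel (\<lambda>x. w x * (g x * ders is h x))" if "h \<in> D_L1" for h
    by (rule weight_integrable[OF ww integrable_weighted[OF g that]])
  have "T \<in> polar_of g m"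
  proof (rule polar_ofI[OF g])
    fix h k :: "'n cfun" and a b assume h: "h \<in> D_L1" and k: "k \<in> D_L1"
    have "(\<lambda>t. a * h t + b * k t) \<in> D_L1" using h k subspace_D_L1 unfolding subspace_fun_def by blast
    then have "T (\<lambda>t. a * h t + b * k t) = (LINT x|lborel. a * (w x * (g x * ders is h x)) + b * (w x * (g x * ders is k x)))"
      by (simp add: T_def ders_lincomb[OF D_L1_smooth[OF h] D_L1_smooth[OF k]] algebra_simps)
    also have "\<dots> = a * T h + b * T k"
      using int[OF h] int[OF k] h k by (subst Bochner_Integration.integral_add) (auto simp: T_def)
    finally show "T (\<lambda>t. a * h t + b * k t) = a * T h + b * T k" .
  next
    fix h :: "'n cfun" assume h: "h \<in> D_L1"
    have "norm (T h) \<le> L1_norm (\<lambda>x. w x * (g x * ders is h x))"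
      using h integral_norm_bound[of lborel "\<lambda>x. w x * (g x * ders is h x)"] by (simp add: T_def L1_norm_def)
    also have "\<dots> \<le> 1 * L1_norm (\<lambda>x. g x * ders is h x)"
      by (rule L1_norm_mult_le[OF integrable_weighted[OF g h] w1 wm])
    also have "\<dots> \<le> wnorm g m h" using wnorm_ge[OF D_L1_smooth[OF h] is_(1), of g] by simp
    finally show "norm (T h) \<le> wnorm g m h" .
  qed (simp add: T_def)
  moreover have "norm (T f) = wnorm g m f"
  proof -
    have "w x * v x = of_real (norm (v x))" for x
    proof (cases "v x = 0")
      case False
      have "cnj (v x) * v x = of_real ((norm (v x))\<^sup>2)"
        by (metis complex_norm_square mult.commute of_real_power)
      moreover have "w x * v x = (cnj (v x) * v x) / of_real (norm (v x))" by (simp add: w_def)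
      ultimately show ?thesis using False by (simp add: power2_eq_square)
    qed simp
    then have "T f = of_real (L1_norm v)" using f by (simp add: T_def v_def[symmetric] L1_norm_def)
    then show ?thesis using is_(2) L1_norm_nonneg[of v] by (simp add: v_def[abs_def])
  qed
  moreover have "bdd_above ((\<lambda>T. norm (T f)) ` polar_of g m)"
    using f by (intro bdd_aboveI2[of _ _ "wnorm g m f"]) (simp add: polar_of_def)
  ultimately show ?thesis by (metis cSUP_upper)
qed

section \<open>Compactly supported functionals\<close>

lemma test_functions_mult:
  assumes u: "smooth u" and f: "f \<in> test_functions"
  shows "(\<lambda>x. u x * f x) \<in> test_functions" "fun_support (\<lambda>x. u x * f x) \<subseteq> fun_support f"
proof -
  have c: "compact (fun_support f)" and s: "smooth f" using f by (auto simp: test_functions_def)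
  show sub: "fun_support (\<lambda>x. u x * f x) \<subseteq> fun_support f"
  proof (rule fun_support_subset)
    show "u x * f x = 0" if "x \<notin> fun_support f" for x using that fun_support_superset by fastforce
  qed (simp add: fun_support_def)
  have "compact (fun_support f \<inter> fun_support (\<lambda>x. u x * f x))"
    by (rule compact_Int_closed[OF c]) (simp add: fun_support_def)
  then have "compact (fun_support (\<lambda>x. u x * f x))" using sub by (simp add: Int_absorb1)
  then show "(\<lambda>x. u x * f x) \<in> test_functions" using u s by (simp add: test_functions_def smooth_mult)
qed

text \<open>
  A partition of unity by peeling off one ball at a time: with a cutoff \<open>u\<close> for that ball, \<open>u f\<close> lives in the doubled
  ball, and \<open>(1 - u) f\<close> in the union of the remaining ones.
\<close>

lemma null_on_finite_union:
  fixes S :: "'n::finite functional"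
  assumes S: "S \<in> B'" and X: "finite X"
    and null: "\<And>x f. x \<in> X \<Longrightarrow> f \<in> test_functions \<Longrightarrow> fun_support f \<subseteq> cball x (2 * r x) \<Longrightarrow> S f = 0"
    and r: "\<And>x. x \<in> X \<Longrightarrow> 0 < r x"
    and f: "f \<in> test_functions" "fun_support f \<subseteq> (\<Union>x\<in>X. ball x (r x))"
  shows "S f = 0"
  using X null r f
proof (induction X arbitrary: f rule: finite_induct)
  case empty
  have "f x = 0" for x using empty.prems(4) fun_support_superset[of f x] by blast
  then have "f = (\<lambda>x. 0)" by (rule ext)
  then show ?case using B'_0[OF S] by simp
next
  case (insert x X)
  define u where "u y = (cutoff (r x) (y - x) :: complex)" for y
  have rx: "0 < r x" using insert.prems(2) by simp
  have su: "smooth u"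
    unfolding u_def[abs_def] using smooth_affine(1)[OF smooth_cutoff, of "r x" "- x" 1] by simp
  have s1u: "smooth (\<lambda>y. 1 - u y)" by (intro smooth_diff smooth_const su)
  note t1 = test_functions_mult[OF su insert.prems(3)] and t2 = test_functions_mult[OF s1u insert.prems(3)]
  have "fun_support (\<lambda>y. u y * f y) \<subseteq> cball x (2 * r x)"
  proof (rule fun_support_subset)
    show "u y * f y = 0" if "y \<notin> cball x (2 * r x)" for y
    proof -
      have "2 * r x \<le> norm (y - x)" using that by (simp add: dist_norm norm_minus_commute)
      then show ?thesis by (simp add: u_def cutoff_eq_0[OF rx])
    qed
  qed simp
  then have 1: "S (\<lambda>y. u y * f y) = 0" by (rule insert.prems(1)[OF insertI1 t1(1)])
  have "fun_support (\<lambda>y. (1 - u y) * f y) \<subseteq> - ball x (r x)"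
  proof (rule fun_support_subset)
    show "(1 - u y) * f y = 0" if "y \<notin> - ball x (r x)" for y
    proof -
      have "norm (y - x) \<le> r x" using that by (simp add: dist_norm norm_minus_commute)
      then show ?thesis by (simp add: u_def cutoff_eq_1[OF rx])
    qed
  qed (simp add: closed_Compl)
  then have "fun_support (\<lambda>y. (1 - u y) * f y) \<subseteq> (\<Union>x\<in>X. ball x (r x))"
    using t2(2) insert.prems(4) by blast
  then have 2: "S (\<lambda>y. (1 - u y) * f y) = 0"
  proof (rule insert.IH[OF _ _ t2(1), rotated 2])
    show "S h = 0" if "z \<in> X" "h \<in> test_functions" "fun_support h \<subseteq> cball z (2 * r z)" for z h
      by (rule insert.prems(1)[OF insertI2[OF that(1)] that(2,3)])
    show "0 < r z" if "z \<in> X" for z by (rule insert.prems(2)[OF insertI2[OF that]])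
  qed
  have "S (\<lambda>y. u y * f y + (1 - u y) * f y) = S (\<lambda>y. u y * f y) + S (\<lambda>y. (1 - u y) * f y)"
    by (rule B'_add[OF S]) (intro test_functions_D_L1 t1 t2)+
  then show ?case using 1 2 by (simp add: algebra_simps)
qed

lemma null_off_dist_support:
  fixes S :: "'n::finite functional"
  assumes S: "S \<in> B'" and f: "f \<in> test_functions" "fun_support f \<inter> dist_support S = {}"
  shows "S f = 0"
proof -
  define N where "N U \<longleftrightarrow> (\<forall>f\<in>test_functions. fun_support f \<subseteq> U \<longrightarrow> S f = 0)" for U
  have "\<exists>r>0. N (cball x (2 * r))" if x: "x \<in> fun_support f" for x
  proof -
    have "x \<in> \<Union>{U. open U \<and> (\<forall>f\<in>test_functions. fun_support f \<subseteq> U \<longrightarrow> S f = 0)}"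
      using f(2) x unfolding dist_support_def by blast
    then obtain U where U: "open U" "N U" "x \<in> U" unfolding N_def by blast
    obtain e where e: "0 < e" "cball x e \<subseteq> U" using U(1,3) open_contains_cball by blast
    have "cball x (2 * (e / 2)) \<subseteq> U" using e by simp
    then have "N (cball x (2 * (e / 2)))" using U(2) unfolding N_def by blast
    then show ?thesis using e(1) by (intro exI[of _ "e / 2"]) simp
  qed
  then have "\<forall>x\<in>fun_support f. \<exists>r. 0 < r \<and> N (cball x (2 * r))" by blast
  from bchoice[OF this] obtain r where r: "\<forall>x\<in>fun_support f. 0 < r x \<and> N (cball x (2 * r x))" ..
  have "compact (fun_support f)" using f(1) by (simp add: test_functions_def)
  then obtain X where X: "X \<subseteq> fun_support f" "finite X" "fun_support f \<subseteq> (\<Union>x\<in>X. ball x (r x))"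
  proof (rule compactE_image)
    show "fun_support f \<subseteq> (\<Union>x\<in>fun_support f. ball x (r x))" using r by (auto intro: centre_in_ball[THEN iffD2])
  qed auto
  show ?thesis
  proof (rule null_on_finite_union[OF S X(2) _ _ f(1) X(3)])
    fix x assume x: "x \<in> X"
    then have rx: "0 < r x \<and> N (cball x (2 * r x))" using r X(1) by blast
    show "0 < r x" using rx by blast
    show "S h = 0" if "h \<in> test_functions" "fun_support h \<subseteq> cball x (2 * r x)" for h
      using conjunct2[OF rx] that unfolding N_def by blast
  qed
qed

lemma wnorm_le_sum: "wnorm g m f \<le> (\<Sum>is\<in>words m. L1_norm (\<lambda>x. g x * ders is f x))"
  by (rule wnorm_le) (rule member_le_sum[OF _ L1_norm_nonneg finite_words])

text \<open>
  The tail is bounded by the derivatives of \<open>f\<close> on \<open>|x| \<ge> k\<close>, to which dominated convergence applies.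
\<close>

lemma cutoff_converges:
  fixes f :: "'n::finite cfun"
  assumes f: "f \<in> D_L1" and e: "0 < e"
  shows "\<exists>R0\<ge>1. \<forall>R\<ge>R0. dnorm m (tail R f) \<le> e"
proof -
  define J where "J k x = (indicator {y :: real ^ 'n. real k \<le> norm y} x :: complex)" for k :: nat and x
  have Jw: "weight (J k)" for k
  proof -
    have "bounded (range (J k))" unfolding J_def by (auto simp: bounded_iff indicator_def intro!: exI[of _ 1])
    moreover have "J k \<in> borel_measurable borel" unfolding J_def[abs_def] by measurable
    ultimately show ?thesis by (simp add: weight_def)
  qed
  obtain A where A: "0 < A" "\<And>R is x. 1 \<le> R \<Longrightarrow> is \<in> words m \<Longrightarrow> norm (ders is (\<lambda>x. 1 - cutoff R x) (x :: real ^ 'n)) \<le> A"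
    by (rule one_minus_cutoff_bound[where m = m]) blast
  define C where "C = 2 ^ m * A * card (words m :: 'n list set)"
  have C: "0 < C" unfolding C_def using A(1) card_words_pos[where 'n = 'n and m = m] by simp
  have "(\<lambda>k. L1_norm (\<lambda>x. J k x * ders is f x)) \<longlonglongrightarrow> (LINT x|(lborel :: (real ^ 'n) measure). 0)" for "is"
    unfolding L1_norm_def
  proof (rule integral_dominated_convergence[where w = "\<lambda>x. norm (ders is f x)"])
    show "integrable lborel (\<lambda>x. norm (ders is f x))" by (intro integrable_norm D_L1_integrable_ders f)
    show "(\<lambda>x. norm (J k x * ders is f x)) \<in> borel_measurable lborel" for k
      using integrable_weighted[OF Jw f, of k "is"] by auto
    show "AE x in lborel. (\<lambda>k. norm (J k x * ders is f x)) \<longlonglongrightarrow> 0"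
    proof (rule AE_I2)
      fix x :: "real ^ 'n"
      have "\<forall>\<^sub>F k in sequentially. norm (J k x * ders is f x) = 0"
        unfolding eventually_sequentially
      proof (intro exI allI impI)
        fix k assume "Suc (nat \<lceil>norm x\<rceil>) \<le> k"
        then have "norm x < real k" by linarith
        then show "norm (J k x * ders is f x) = 0" by (simp add: J_def)
      qed
      then show "(\<lambda>k. norm (J k x * ders is f x)) \<longlonglongrightarrow> 0" by (rule tendsto_eventually)
    qed
    show "AE x in lborel. norm (norm (J k x * ders is f x)) \<le> norm (ders is f x)" for k
      by (rule AE_I2) (simp add: J_def norm_mult indicator_def)
  qed auto
  then have "(\<lambda>k. \<Sum>is\<in>words m. L1_norm (\<lambda>x. J k x * ders is f x)) \<longlonglongrightarrow> (\<Sum>is\<in>(words m :: 'n list set). 0)"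
    by (intro tendsto_sum) simp
  then have "(\<lambda>k. \<Sum>is\<in>(words m :: 'n list set). L1_norm (\<lambda>x. J k x * ders is f x)) \<longlonglongrightarrow> 0" by simp
  then have "\<forall>\<^sub>F k in sequentially. (\<Sum>is\<in>(words m :: 'n list set). L1_norm (\<lambda>x. J k x * ders is f x)) < e / C"
    by (rule order_tendstoD(2)) (use e C in simp)
  then obtain k0 where k0: "\<And>k. k0 \<le> k \<Longrightarrow> (\<Sum>is\<in>(words m :: 'n list set). L1_norm (\<lambda>x. J k x * ders is f x)) < e / C"
    unfolding eventually_sequentially by blast
  define k where "k = Suc k0"
  have k: "(\<Sum>is\<in>(words m :: 'n list set). L1_norm (\<lambda>x. J k x * ders is f x)) < e / C" unfolding k_def by (rule k0) simp
  have "dnorm m (tail R f) \<le> e" if R: "real k \<le> R" for R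
  proof -
    have R1: "1 \<le> R" using R unfolding k_def by simp
    have "dnorm m (tail R f) \<le> C * wnorm (J k) m f"
      unfolding C_def
    proof (rule wnorm_mult_le[OF weight_const Jw f bdd_smooth_one_minus_cutoff])
      show "norm (1 :: complex) \<le> norm (J k x)" if "x \<in> fun_support (\<lambda>x. 1 - cutoff R x)" for x
        using that fun_support_one_minus_cutoff[of R] R1 R by (auto simp: J_def)
    qed (use A R1 in auto)
    also have "\<dots> \<le> C * (e / C)"
      using order_trans[OF wnorm_le_sum less_imp_le[OF k]] C by (intro mult_left_mono) auto
    finally show ?thesis using C by simp
  qed
  then show ?thesis by (intro exI[of _ "real k"]) (simp add: k_def)
qed

lemma B'_cutoff_converges:
  assumes T: "T \<in> B'" and f: "f \<in> D_L1" and e: "0 < e"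
  shows "\<exists>R0\<ge>1. \<forall>R\<ge>R0. norm (T (tail R f)) \<le> e"
proof -
  obtain m C where C: "0 < C" "\<And>f. f \<in> D_L1 \<Longrightarrow> norm (T f) \<le> C * dnorm m f" using B'_bound[OF T] by blast
  obtain R0 where R0: "1 \<le> R0" "\<And>R. R0 \<le> R \<Longrightarrow> dnorm m (tail R f) \<le> e / C"
    using cutoff_converges[OF f, of "e / C" m] e C(1) by auto
  have "norm (T (tail R f)) \<le> e" if R: "R0 \<le> R" for R
  proof -
    have "norm (T (tail R f)) \<le> C * dnorm m (tail R f)"
      using R R0(1) by (intro C(2) D_L1_mult bdd_smooth_one_minus_cutoff f) simp
    also have "\<dots> \<le> C * (e / C)" using R0(2)[OF R] C(1) by (intro mult_left_mono) auto
    finally show ?thesis using C(1) by simp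
  qed
  then show ?thesis using R0(1) by blast
qed

text \<open>
  A function vanishing near the support need not have compact support itself; it is the limit of its cutoffs,
  which are test functions.
\<close>

lemma E'_kills_tails:
  fixes S :: "'n::finite functional"
  assumes S: "S \<in> E'"
  shows "\<exists>R0\<ge>1. \<forall>R\<ge>R0. \<forall>f\<in>D_L1. S (tail R f) = 0"
proof -
  have SB: "S \<in> B'" and c: "compact (dist_support S)" using S by (auto simp: E'_def)
  obtain r where r: "\<And>x. x \<in> dist_support S \<Longrightarrow> norm x \<le> r"
    using compact_imp_bounded[OF c] unfolding bounded_iff by blast
  define R0 where "R0 = max 1 (r + 1)"
  have "S (tail R f) = 0" if R: "R0 \<le> R" and f: "f \<in> D_L1" for R f
  proof -
    have R1: "1 \<le> R" "r < R" using R unfolding R0_def by auto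
    define h where "h x = (1 - cutoff R x) * f x" for x
    have h: "h \<in> D_L1" unfolding h_def[abs_def] using R1 by (intro D_L1_mult bdd_smooth_one_minus_cutoff f) simp
    have cut0: "S (cut Q h) = 0" if Q: "0 < Q" for Q
    proof (rule null_off_dist_support[OF SB])
      have sh: "smooth h" by (rule D_L1_smooth[OF h])
      have "(\<lambda>x. h x * cutoff Q x) \<in> test_functions" by (rule test_functions_mult[OF sh cutoff_test[OF Q]])
      then show "(cut Q h) \<in> test_functions" by (simp add: mult.commute)
      have "fun_support (cut Q h) \<subseteq> {x. R \<le> norm x}"
      proof (rule fun_support_subset)
        show "closed {x :: real ^ 'n. R \<le> norm x}" by (simp add: closed_Collect_le continuous_on_norm_id)
        show "cutoff Q x * h x = 0" if "x \<notin> {x. R \<le> norm x}" for x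
          using that R1 by (simp add: h_def cutoff_eq_1)
      qed
      then show "fun_support (cut Q h) \<inter> dist_support S = {}"
        using r R1(2) by fastforce
    qed
    have "norm (S h) \<le> 0"
    proof (rule field_le_epsilon)
      fix e :: real assume e: "0 < e"
      obtain Q where Q: "1 \<le> Q" "norm (S (tail Q h)) \<le> e"
        using B'_cutoff_converges[OF SB h e] by blast
      have ch: "(cut Q h) \<in> D_L1" using Q(1) by (intro D_L1_mult bdd_smooth_cutoff h) simp
      have "(tail Q h) = (\<lambda>x. h x - cutoff Q x * h x)" by (simp add: algebra_simps)
      then have "S (tail Q h) = S h - S (cut Q h)"
        using B'_diff[OF SB h ch] by simp
      then show "norm (S h) \<le> 0 + e" using Q cut0[of Q] by simp
    qed
    then show ?thesis unfolding h_def[abs_def] by simp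
  qed
  then show ?thesis by (intro exI[of _ R0]) (auto simp: R0_def)
qed

section \<open>Compact sets of functionals\<close>

text \<open>
  Scaling to the unit ball of \<open>p\<close>; the scaling factor is taken slightly too small, which covers the zeros of \<open>p\<close>.
\<close>

lemma homogeneous_bound:
  assumes p: "seminorm_on D_L1 p" and q: "seminorm_on D_L1 q" and e: "0 \<le> e"
    and le: "\<And>f. f \<in> D_L1 \<Longrightarrow> p f \<le> 1 \<Longrightarrow> q f \<le> e" and f: "f \<in> D_L1"
  shows "q f \<le> e * p f"
proof (rule field_le_epsilon)
  fix d :: real assume d: "0 < d"
  define s where "s = p f + d / (e + 1)"
  have pf: "0 \<le> p f" by (rule seminorm_on_nonneg[OF subspace_D_L1 p f])
  have de: "0 < d / (e + 1)" using d e by simp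
  have s: "0 < s" "p f \<le> s" unfolding s_def using pf de by linarith+
  have "p (\<lambda>x. of_real (1 / s) * f x) = (1 / s) * p f" using seminorm_on_scale[OF p f, of "of_real (1 / s)"] s(1) by (simp add: norm_divide)
  also have "\<dots> \<le> 1" using s by simp
  finally have "q (\<lambda>x. of_real (1 / s) * f x) \<le> e" by (rule le[OF D_L1_scale[OF f]])
  then have "(1 / s) * q f \<le> e" using seminorm_on_scale[OF q f, of "of_real (1 / s)"] s(1) by (simp add: norm_divide)
  then have "q f \<le> e * s" using s(1) by (simp add: field_simps)
  also have "\<dots> = e * p f + e / (e + 1) * d" unfolding s_def by (simp add: algebra_simps)
  also have "e / (e + 1) * d \<le> 1 * d" using e d by (intro mult_right_mono) auto
  finally show "q f \<le> e * p f + d" by simp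
qed

lemma functional_seminorm:
  assumes T: "T \<in> B'"
  shows "seminorm_on D_L1 (\<lambda>f. norm (T f))"
  unfolding seminorm_on_def using B'_add[OF T] B'_scale[OF T] by (auto simp: norm_mult norm_triangle_ineq)

lemma compactin_B'_dot_iff: "compactin B'_dot_topology K \<longleftrightarrow> compactin B'_topology K \<and> K \<subseteq> B'_dot"
  unfolding B'_dot_topology_def compactin_subtopology by blast

lemma compactin_B'_subset: "compactin B'_topology K \<Longrightarrow> K \<subseteq> B'"
  using compactin_subset_topspace topspace_B'_topology by blast

lemma openin_sup_on_ball: "bounded_set B \<Longrightarrow> S \<in> B' \<Longrightarrow> 0 < e \<Longrightarrow> openin B'_topology {T \<in> B'. sup_on B (\<lambda>f. T f - S f) < e}"
  unfolding B'_topology_eq by (rule openin_seminorm_ball) auto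

text \<open>
  The balls of the seminorm \<open>sup_on B\<close> around the points of \<open>K\<close> form an open cover.
\<close>

lemma compact_finite_net:
  fixes K :: "'n::finite functional set"
  assumes K: "compactin B'_topology K" and B: "bounded_set B" and e: "0 < e"
  obtains F where "finite F" "F \<subseteq> K" "\<And>T f. T \<in> K \<Longrightarrow> \<exists>S\<in>F. \<forall>f\<in>B. norm (T f - S f) \<le> e"
proof -
  have KB: "K \<subseteq> B'" by (rule compactin_B'_subset[OF K])
  define U where "U S = {T \<in> B'. sup_on B (\<lambda>f. T f - S f) < e}" for S
  have op: "\<forall>V\<in>U ` K. openin B'_topology V"
    unfolding U_def using openin_sup_on_ball[OF B _ e] KB by blast
  have self: "S \<in> U S" if "S \<in> K" for S
  proof -
    have "sup_on B (\<lambda>f. S f - S f) \<le> 0" by (rule sup_on_least[OF B]) simp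
    then show ?thesis unfolding U_def using that KB e by auto
  qed
  have "K \<subseteq> \<Union> (U ` K)" using self by blast
  then obtain FF where FF: "finite FF" "FF \<subseteq> U ` K" "K \<subseteq> \<Union> FF"
    using K op unfolding compactin_def by meson
  obtain F where F: "F \<subseteq> K" "finite F" "FF = U ` F" using finite_subset_image[OF FF(1,2)] by blast
  have "\<exists>S\<in>F. \<forall>f\<in>B. norm (T f - S f) \<le> e" if T: "T \<in> K" for T
  proof -
    obtain S where S: "S \<in> F" "T \<in> U S" using FF(3) F(3) T by blast
    have TS: "(\<lambda>f. T f - S f) \<in> B'" using T S(1) F(1) KB by (intro subspace_fun_diff[OF subspace_B']) auto
    have "norm (T f - S f) \<le> e" if "f \<in> B" for f
      using sup_on_upper[OF B TS that] S(2) unfolding U_def by simp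
    then show ?thesis using S(1) by blast
  qed
  then show ?thesis using that F by blast
qed

text \<open>
  Otherwise some \<open>h\<^sub>k\<close> of norm at most \<open>1\<close> in order \<open>k\<close> satisfies \<open>|T\<^sub>k h\<^sub>k| > k\<close> for some \<open>T\<^sub>k\<close> in \<open>K\<close>. These \<open>h\<^sub>k\<close>
  form a bounded set, on which the compact set \<open>K\<close> is uniformly bounded.
\<close>

lemma compact_equicontinuous:
  fixes K :: "'n::finite functional set"
  assumes K: "compactin B'_topology K"
  shows "\<exists>m C. 0 < C \<and> (\<forall>T\<in>K. \<forall>f\<in>D_L1. norm (T f) \<le> C * dnorm m f)"
proof (rule ccontr)
  assume neg: "\<not> ?thesis"
  have KB: "K \<subseteq> B'" by (rule compactin_B'_subset[OF K])
  have "\<exists>T h. T \<in> K \<and> h \<in> D_L1 \<and> dnorm k h \<le> 1 \<and> real k < norm (T h)" for k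
  proof -
    have "\<not> (\<forall>T\<in>K. \<forall>f\<in>D_L1. norm (T f) \<le> real (Suc k) * dnorm k f)"
      using neg by (metis of_nat_0_less_iff zero_less_Suc)
    then obtain T f where T: "T \<in> K" and f: "f \<in> D_L1" and lt: "real (Suc k) * dnorm k f < norm (T f)"
      by (auto simp: not_le)
    define a where "a = norm (T f)"
    have "0 \<le> real (Suc k) * dnorm k f"
      by (intro mult_nonneg_nonneg wnorm_nonneg D_L1_smooth f) simp
    then have a: "0 < a" unfolding a_def using lt by linarith
    define s where "s = real (Suc k) / a"
    have s: "0 < s" unfolding s_def using a by simp
    have "dnorm k (\<lambda>x. of_real s * f x) = s * dnorm k f"
      using seminorm_on_scale[OF wnorm_seminorm[OF weight_const] f, of 1 k "of_real s"] s by simp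
    also have "\<dots> = (real (Suc k) * dnorm k f) / a" by (simp add: s_def)
    also have "\<dots> \<le> 1" using lt a unfolding a_def by (simp add: divide_le_eq)
    finally have "dnorm k (\<lambda>x. of_real s * f x) \<le> 1" .
    moreover have "norm (T (\<lambda>x. of_real s * f x)) = real (Suc k)"
    proof -
      have "T (\<lambda>x. of_real s * f x) = of_real s * T f" using B'_scale[of T f "of_real s"] T KB f by blast
      then have "norm (T (\<lambda>x. of_real s * f x)) = s * a" using s by (simp add: norm_mult a_def)
      then show ?thesis using a by (simp add: s_def)
    qed
    ultimately show ?thesis using T D_L1_scale[OF f] by (intro exI[of _ T] exI[of _ "\<lambda>x. of_real s * f x"]) simp
  qed
  then have "\<forall>k. \<exists>z. fst z \<in> K \<and> snd z \<in> D_L1 \<and> dnorm k (snd z) \<le> 1 \<and> real k < norm ((fst z) (snd z))"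
    by simp
  from choice[OF this] obtain z where z: "\<forall>k. fst (z k) \<in> K \<and> snd (z k) \<in> D_L1 \<and> dnorm k (snd (z k)) \<le> 1 \<and> real k < norm ((fst (z k)) (snd (z k)))" ..
  define T where "T k = fst (z k)" for k
  define h where "h k = snd (z k)" for k
  have TK: "T k \<in> K" and hD: "h k \<in> D_L1" and hn: "dnorm k (h k) \<le> 1" and big: "real k < norm (T k (h k))" for k
    using z unfolding T_def h_def by auto
  have B: "bounded_set (range h)"
    unfolding bounded_set_def
  proof (intro conjI allI)
    fix m
    have "dnorm m (h k) \<le> 1 + (\<Sum>j<m. dnorm m (h j))" for k
    proof (cases "k < m")
      case True
      then have "dnorm m (h k) \<le> (\<Sum>j<m. dnorm m (h j))"
        by (intro member_le_sum) (auto intro: wnorm_nonneg D_L1_smooth hD)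
      then show ?thesis by simp
    next
      case False
      then have "dnorm m (h k) \<le> dnorm k (h k)" by (intro wnorm_mono_order D_L1_smooth hD) simp
      moreover have "0 \<le> (\<Sum>j<m. dnorm m (h j))" by (intro sum_nonneg wnorm_nonneg D_L1_smooth hD)
      ultimately show ?thesis using hn[of k] by linarith
    qed
    then show "\<exists>c. \<forall>f\<in>range h. dnorm m f \<le> c" by blast
  qed (use hD in auto)
  obtain F where F: "finite F" "F \<subseteq> K" "\<And>T. T \<in> K \<Longrightarrow> \<exists>S\<in>F. \<forall>f\<in>range h. norm (T f - S f) \<le> 1"
    by (rule compact_finite_net[OF K B, of 1]) auto
  define b where "b = (\<Sum>S\<in>F. sup_on (range h) S)"
  obtain k where k: "1 + b < real k" using reals_Archimedean2 by blast
  obtain S where S: "S \<in> F" "norm (T k (h k) - S (h k)) \<le> 1" using F(3)[OF TK[of k]] by blast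
  have SB: "S \<in> B'" using S(1) F(2) KB by blast
  have "norm (S (h k)) \<le> sup_on (range h) S" by (rule sup_on_upper[OF B SB]) simp
  also have "\<dots> \<le> b"
    unfolding b_def using F KB by (intro member_le_sum S(1)) (auto intro!: sup_on_nonneg[OF B])
  finally have "norm (T k (h k)) \<le> 1 + b"
    using norm_triangle_sub[of "T k (h k)" "S (h k)"] S(2) by linarith
  then show False using big[of k] k by linarith
qed

text \<open>
  The tails of the elements of \<open>B\<close> form a bounded set themselves. On it, \<open>K\<close> is approximated by a finite subset, and
  each of its elements by one of \<open>E'\<close>, which vanishes on tails that are far out.
\<close>

lemma compact_tail_on_bounded:
  fixes K :: "'n::finite functional set"
  assumes K: "compactin B'_topology K" "K \<subseteq> B'_dot" and B: "bounded_set B" and e: "0 < e"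
  shows "\<exists>R0\<ge>1. \<forall>R\<ge>R0. \<forall>T\<in>K. \<forall>f\<in>B. norm (T (tail R f)) \<le> e"
proof -
  have BD: "B \<subseteq> D_L1" using B by (simp add: bounded_set_def)
  have KB: "K \<subseteq> B'" by (rule compactin_B'_subset[OF K(1)])
  define Bt where "Bt = {\<lambda>x. (1 - cutoff R x) * f x | R f. 1 \<le> R \<and> f \<in> B}"
  have Bt: "bounded_set Bt"
    unfolding bounded_set_def
  proof (intro conjI allI)
    show "Bt \<noteq> {}" using B unfolding Bt_def bounded_set_def by fastforce
    show "Bt \<subseteq> D_L1"
    proof
      fix h assume "h \<in> Bt"
      then obtain R f where Rf: "h = (tail R f)" "1 \<le> R" "f \<in> B" unfolding Bt_def by blast
      show "h \<in> D_L1"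
        unfolding Rf(1) by (rule D_L1_mult[OF bdd_smooth_one_minus_cutoff]) (use Rf BD in auto)
    qed
    fix m
    obtain C where C: "0 < C" "\<And>g f R e. weight g \<Longrightarrow> f \<in> D_L1 \<Longrightarrow> 1 \<le> R \<Longrightarrow> (\<And>x :: real ^ 'n. R \<le> norm x \<Longrightarrow> norm (g x) \<le> e) \<Longrightarrow> 0 \<le> e \<Longrightarrow>
       wnorm g m (tail R f) \<le> C * e * dnorm m f"
      by (rule wnorm_tail_le[where m = m]) blast
    obtain c where c: "\<And>f. f \<in> B \<Longrightarrow> dnorm m f \<le> c" using B unfolding bounded_set_def by blast
    have "dnorm m h \<le> C * c" if h: "h \<in> Bt" for h
    proof -
      obtain R f where Rf: "h = (tail R f)" "1 \<le> R" "f \<in> B" using h unfolding Bt_def by blast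
      have "dnorm m h \<le> C * 1 * dnorm m f"
        unfolding Rf(1) by (rule C(2)[OF weight_const _ Rf(2)]) (use Rf(3) BD in auto)
      also have "\<dots> \<le> C * c" using c[OF Rf(3)] C(1) by simp
      finally show ?thesis .
    qed
    then show "\<exists>c. \<forall>f\<in>Bt. dnorm m f \<le> c" by blast
  qed
  have e3: "0 < e / 2" using e by simp
  obtain F where F: "finite F" "F \<subseteq> K" "\<And>T. T \<in> K \<Longrightarrow> \<exists>S\<in>F. \<forall>f\<in>Bt. norm (T f - S f) \<le> e / 2"
    by (rule compact_finite_net[OF K(1) Bt e3]) auto
  have "\<exists>R0\<ge>1. \<forall>R\<ge>R0. \<forall>f\<in>B. norm (S (tail R f)) \<le> e / 2" if S: "S \<in> F" for S
  proof -
    have SB: "S \<in> B'" and Sd: "S \<in> B'_dot" using S F(2) KB K(2) by auto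
    define U where "U = {T \<in> B'. sup_on Bt (\<lambda>f. T f - S f) < e / 2}"
    have U1: "openin B'_topology U" unfolding U_def by (rule openin_sup_on_ball[OF Bt SB e3])
    have U2: "S \<in> U"
    proof -
      have "sup_on Bt (\<lambda>f. S f - S f) \<le> 0" by (rule sup_on_least[OF Bt]) simp
      then show ?thesis using SB e by (auto simp: U_def)
    qed
    have "\<forall>V. S \<in> V \<and> openin B'_topology V \<longrightarrow> (\<exists>y. y \<in> E' \<and> y \<in> V)"
      using Sd unfolding B'_dot_def in_closure_of by (rule conjunct2)
    from mp[OF spec[OF this] conjI[OF U2 U1]] obtain S' where S': "S' \<in> E'" "S' \<in> U" by (elim exE conjE)
    then have S'B: "S' \<in> B'" "sup_on Bt (\<lambda>f. S' f - S f) < e / 2" by (auto simp: U_def)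
    obtain R0 where R0: "1 \<le> R0" "\<And>R f. R0 \<le> R \<Longrightarrow> f \<in> D_L1 \<Longrightarrow> S' (tail R f) = 0"
      using E'_kills_tails[OF S'(1)] by blast
    have "norm (S (tail R f)) \<le> e / 2" if R: "R0 \<le> R" and f: "f \<in> B" for R f
    proof -
      let ?h = "\<lambda>x. (1 - cutoff R x) * f x"
      have hB: "?h \<in> Bt" unfolding Bt_def using R R0(1) f by force
      have "(\<lambda>f. S' f - S f) \<in> B'" by (rule subspace_fun_diff[OF subspace_B' S'B(1) SB])
      from sup_on_upper[OF Bt this hB] have "norm (S' ?h - S ?h) \<le> e / 2" using S'B(2) by simp
      then show ?thesis using R0(2)[OF R, of f] f BD by auto
    qed
    then show ?thesis using R0(1) by blast
  qed
  then have "\<forall>S\<in>F. \<exists>R0. 1 \<le> R0 \<and> (\<forall>R\<ge>R0. \<forall>f\<in>B. norm (S (tail R f)) \<le> e / 2)" by blast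
  from bchoice[OF this] obtain r where r: "\<forall>S\<in>F. 1 \<le> r S \<and> (\<forall>R\<ge>r S. \<forall>f\<in>B. norm (S (tail R f)) \<le> e / 2)" ..
  \<comment> \<open>a sum serves as an upper bound of finitely many radii\<close>
  define R0 where "R0 = 1 + (\<Sum>S\<in>F. r S)"
  have rsum: "r S \<le> R0" if "S \<in> F" for S
  proof -
    have "r S \<le> (\<Sum>S\<in>F. r S)" using r F(1) by (intro member_le_sum that) (auto intro: order_trans[OF zero_le_one])
    then show ?thesis unfolding R0_def by simp
  qed
  have R01: "1 \<le> R0" unfolding R0_def using r by (auto intro!: sum_nonneg intro: order_trans[OF zero_le_one])
  have "norm (T (tail R f)) \<le> e" if R: "R0 \<le> R" and T: "T \<in> K" and f: "f \<in> B" for R T f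
  proof -
    let ?h = "\<lambda>x. (1 - cutoff R x) * f x"
    have hB: "?h \<in> Bt" unfolding Bt_def using R R01 f by force
    obtain S where S: "S \<in> F" "\<forall>f\<in>Bt. norm (T f - S f) \<le> e / 2" using F(3)[OF T] by blast
    have "r S \<le> R" using rsum[OF S(1)] R by simp
    then have "norm (S ?h) \<le> e / 2" using bspec[OF r S(1)] f by blast
    moreover have "norm (T ?h - S ?h) \<le> e / 2" using bspec[OF S(2) hB] .
    ultimately show ?thesis using norm_triangle_sub[of "T ?h" "S ?h"] by linarith
  qed
  then show ?thesis using R01 by blast
qed

text \<open>
  A function of norm at most \<open>1\<close> in order \<open>m + 1\<close> is the sum of its mollification, which runs through a
  bounded set, and an error that is small in order \<open>m\<close>.
\<close>

lemma compact_tail: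
  fixes K :: "'n::finite functional set"
  assumes K: "compactin B'_topology K" "K \<subseteq> B'_dot"
    and C: "0 < C" "\<And>T f. T \<in> K \<Longrightarrow> f \<in> D_L1 \<Longrightarrow> norm (T f) \<le> C * dnorm m f" and e: "0 < e"
  shows "\<exists>R0\<ge>1. \<forall>R\<ge>R0. \<forall>T\<in>K. \<forall>f\<in>D_L1. norm (T (tail R f)) \<le> e * dnorm (Suc m) f"
proof -
  have KB: "K \<subseteq> B'" by (rule compactin_B'_subset[OF K(1)])
  obtain C' where C': "0 < C'" "\<And>g f R e. weight g \<Longrightarrow> f \<in> D_L1 \<Longrightarrow> 1 \<le> R \<Longrightarrow> (\<And>x :: real ^ 'n. R \<le> norm x \<Longrightarrow> norm (g x) \<le> e) \<Longrightarrow> 0 \<le> e \<Longrightarrow>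
       wnorm g m (tail R f) \<le> C' * e * dnorm m f"
    by (rule wnorm_tail_le[where m = m]) blast
  \<comment> \<open>half of \<open>e\<close> is left for the error of the mollification, multiplied by the constants of the cutoff and of the functionals\<close>
  define d where "d = e / (2 * C * C' * CARD('n))"
  have d: "0 < d" unfolding d_def using e C C' by simp
  obtain k where k: "mollifier d (k :: 'n cfun)" using ex_mollifier[OF d] by blast
  have ki: "integrable lborel k" "L1_norm k = 1" and kt: "k \<in> test_functions" using k by (auto simp: mollifier_def)
  have kb: "bdd_smooth k" by (rule test_functions_bdd_smooth[OF kt])
  note kw = mollifier_weight[OF k]
  define B where "B = corr k ` {f \<in> D_L1. dnorm (Suc m) f \<le> 1}"
  have B: "bounded_set B"
    unfolding bounded_set_def
  proof (intro conjI allI)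
    have "(\<lambda>x. 0) \<in> {f \<in> D_L1. wnorm (\<lambda>x :: real ^ 'n. 1) (Suc m) f \<le> 1}"
      using D_L1_zero by (simp add: seminorm_on_0[OF subspace_D_L1 wnorm_seminorm[OF weight_const]])
    then show "B \<noteq> {}" unfolding B_def by blast
    show "B \<subseteq> D_L1" unfolding B_def using corr_D_L1[OF kw ki(1)] by blast
    fix l
    have "dnorm l (corr k f) \<le> (\<Sum>is\<in>words l. L1_norm (ders (rev is) k))" if f: "f \<in> D_L1" "dnorm (Suc m) f \<le> 1" for f
    proof (rule wnorm_le)
      fix "is" :: "'n list" assume is_: "is \<in> words l"
      have dk: "weight (ders (rev is) k)" "integrable lborel (ders (rev is) k)"
        using bdd_smooth_weight[OF bdd_smooth_ders[OF kb]] D_L1_integrable_ders[OF test_functions_D_L1[OF kt]] by auto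
      have "L1_norm (\<lambda>x. 1 * ders is (corr k f) x) = L1_norm (corr (ders (rev is) k) f)"
        unfolding L1_norm_def by (simp add: smooth_corr(2)[OF f(1) kw] norm_corr_ders[OF kb f(1)])
      also have "\<dots> \<le> L1_norm f * L1_norm (ders (rev is) k)" by (rule L1_norm_corr_le(2)[OF dk f(1)])
      also have "\<dots> \<le> 1 * L1_norm (ders (rev is) k)"
        using wnorm_ge_1[OF D_L1_smooth[OF f(1)], of "[]" "Suc m"] f(2) by (intro mult_right_mono L1_norm_nonneg) simp
      also have "\<dots> \<le> (\<Sum>is\<in>words l. L1_norm (ders (rev is) k))"
        using member_le_sum[OF is_, of "\<lambda>is. L1_norm (ders (rev is) k)"] by (simp add: L1_norm_nonneg finite_words)
      finally show "L1_norm (\<lambda>x. 1 * ders is (corr k f) x) \<le> (\<Sum>is\<in>words l. L1_norm (ders (rev is) k))" .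
    qed
    then show "\<exists>c. \<forall>f\<in>B. dnorm l f \<le> c" unfolding B_def by blast
  qed
  have e2: "0 < e / 2" using e by simp
  obtain R0 where R0: "1 \<le> R0" "\<And>R T f. R0 \<le> R \<Longrightarrow> T \<in> K \<Longrightarrow> f \<in> B \<Longrightarrow> norm (T (tail R f)) \<le> e / 2"
    using compact_tail_on_bounded[OF K B e2] by blast
  have "norm (T (tail R f)) \<le> e * dnorm (Suc m) f"
    if R: "R0 \<le> R" and T: "T \<in> K" and f: "f \<in> D_L1" for R T f
  proof -
    have TB: "T \<in> B'" using T KB by blast
    have R1: "1 \<le> R" and Rp: "0 < R" using R R0(1) by auto
    note cm = D_L1_mult[OF bdd_smooth_one_minus_cutoff[OF Rp]]
    define q where "q h = norm (T (tail R h))" for h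
    have q: "seminorm_on D_L1 q"
      unfolding seminorm_on_def
    proof (intro conjI ballI allI)
      fix f h :: "'n cfun" assume f: "f \<in> D_L1" and h: "h \<in> D_L1"
      have "q (\<lambda>t. f t + h t) = norm (T (\<lambda>x. (1 - cutoff R x) * f x + (1 - cutoff R x) * h x))"
        by (simp add: q_def distrib_left)
      also have "\<dots> \<le> q f + q h"
        unfolding q_def by (rule seminorm_on_add[OF functional_seminorm[OF TB] cm[OF f] cm[OF h]])
      finally show "q (\<lambda>t. f t + h t) \<le> q f + q h" .
    next
      fix f :: "'n cfun" and c assume f: "f \<in> D_L1"
      have "q (\<lambda>t. c * f t) = norm (T (\<lambda>x. c * ((1 - cutoff R x) * f x)))"
        by (simp add: q_def mult.left_commute)
      also have "\<dots> = norm c * q f"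
        unfolding q_def by (rule seminorm_on_scale[OF functional_seminorm[OF TB] cm[OF f]])
      finally show "q (\<lambda>t. c * f t) = norm c * q f" .
    qed
    have "q f \<le> e * dnorm (Suc m) f"
    proof (rule homogeneous_bound[OF wnorm_seminorm[OF weight_const] q _ _ f])
      fix h :: "'n cfun" assume h: "h \<in> D_L1" "dnorm (Suc m) h \<le> 1"
      have Mh: "corr k h \<in> D_L1" by (rule corr_D_L1[OF kw ki(1) h(1)])
      have dh: "(\<lambda>x. h x - corr k h x) \<in> D_L1" by (rule D_L1_diff[OF h(1) Mh])
      have appr: "dnorm m (\<lambda>x. h x - corr k h x) \<le> d * CARD('n)"
      proof (rule wnorm_le)
        fix "is" :: "'n list" assume is_: "is \<in> words m"
        have "L1_norm (\<lambda>x. 1 * ders is (\<lambda>x. h x - corr k h x) x) = L1_norm (\<lambda>x. ders is h x - corr k (ders is h) x)"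
          by (simp add: ders_diff D_L1_smooth h Mh smooth_corr(2)[OF h(1) kw])
        also have "\<dots> \<le> d * (\<Sum>i\<in>UNIV. L1_norm (partial i (ders is h)))"
          by (rule mollifier_approx[OF k D_L1_ders[OF h(1)]]) (use d in simp)
        also have "\<dots> \<le> d * (\<Sum>i\<in>(UNIV :: 'n set). 1)"
        proof (intro mult_left_mono sum_mono)
          fix i
          show "L1_norm (partial i (ders is h)) \<le> 1"
            using wnorm_ge_1[OF D_L1_smooth[OF h(1)], of "i # is" "Suc m"] is_ h(2) by simp
        qed (use d in simp)
        finally show "L1_norm (\<lambda>x. 1 * ders is (\<lambda>x. h x - corr k h x) x) \<le> d * CARD('n)" by simp
      qed
      have "q h = norm (T (\<lambda>x. (1 - cutoff R x) * (h x - corr k h x) + (1 - cutoff R x) * corr k h x))"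
        by (simp add: q_def distrib_left[symmetric])
      also have "\<dots> \<le> norm (T (\<lambda>x. (1 - cutoff R x) * (h x - corr k h x))) + norm (T (\<lambda>x. (1 - cutoff R x) * corr k h x))"
        by (rule seminorm_on_add[OF functional_seminorm[OF TB] cm[OF dh] cm[OF Mh]])
      also have "\<dots> \<le> e / 2 + e / 2"
      proof (rule add_mono)
        have "norm (T (\<lambda>x. (1 - cutoff R x) * (h x - corr k h x))) \<le> C * dnorm m (\<lambda>x. (1 - cutoff R x) * (h x - corr k h x))"
          by (rule C(2)[OF T cm[OF dh]])
        also have "\<dots> \<le> C * (C' * 1 * dnorm m (\<lambda>x. h x - corr k h x))"
          using C(1) by (intro mult_left_mono C'(2) weight_const dh R1) auto
        also have "\<dots> \<le> C * (C' * 1 * (d * CARD('n)))"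
          using C(1) C'(1) by (intro mult_left_mono appr) auto
        also have "\<dots> = e / 2" unfolding d_def using C(1) C'(1) by (simp add: field_simps)
        finally show "norm (T (\<lambda>x. (1 - cutoff R x) * (h x - corr k h x))) \<le> e / 2" .
        have "corr k h \<in> B" unfolding B_def using h by blast
        then show "norm (T (\<lambda>x. (1 - cutoff R x) * corr k h x)) \<le> e / 2" by (rule R0(2)[OF R T])
      qed
      finally show "q h \<le> e" by simp
    qed (use e in simp)
    then show ?thesis by (simp add: q_def)
  qed
  then show ?thesis using R0(1) by blast
qed

lemma wnorm_weight_mono:
  assumes "weight g2" "weight g1" "f \<in> D_L1" "\<And>x. norm (g1 x) \<le> norm (g2 x)"
  shows "wnorm g1 m f \<le> wnorm g2 m f"
proof (rule wnorm_le)
  fix "is" :: "'a list" assume is_: "is \<in> words m"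
  have "(\<lambda>x. g1 x * ders is f x) \<in> borel_measurable borel" using integrable_weighted[OF assms(2,3), of "is"] by auto
  then have "L1_norm (\<lambda>x. g1 x * ders is f x) \<le> L1_norm (\<lambda>x. g2 x * ders is f x)"
    by (rule L1_norm_mono[OF integrable_weighted[OF assms(1,3)]]) (simp add: norm_mult mult_right_mono assms(4))
  also have "\<dots> \<le> wnorm g2 m f" by (rule wnorm_ge[OF D_L1_smooth[OF assms(3)] is_])
  finally show "L1_norm (\<lambda>x. g1 x * ders is f x) \<le> wnorm g2 m f" .
qed

lemma wnorm_weight_scale:
  assumes "smooth f"
  shows "wnorm (\<lambda>x. c * g x) m f \<le> norm c * wnorm g m f"
proof (rule wnorm_le)
  fix "is" :: "'a list" assume is_: "is \<in> words m"
  have "L1_norm (\<lambda>x. c * g x * ders is f x) = norm c * L1_norm (\<lambda>x. g x * ders is f x)"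
    using L1_norm_scale[of c "\<lambda>x. g x * ders is f x"] by (simp add: mult.assoc)
  also have "\<dots> \<le> norm c * wnorm g m f" by (intro mult_left_mono wnorm_ge assms is_) simp
  finally show "L1_norm (\<lambda>x. c * g x * ders is f x) \<le> norm c * wnorm g m f" .
qed

section \<open>Domination of compact sets by a weight\<close>

lemma cutoff_sequence_bound:
  fixes T :: "'n::finite functional"
  assumes T: "T \<in> B'" and f: "f \<in> D_L1" and R: "filterlim R at_top sequentially"
    and le: "\<And>k. norm (T (cut (R k) f)) \<le> c"
  shows "norm (T f) \<le> c"
proof (rule field_le_epsilon)
  fix e :: real assume e: "0 < e"
  obtain R0 where R0: "1 \<le> R0" "\<And>Q. R0 \<le> Q \<Longrightarrow> norm (T (tail Q f)) \<le> e"
    using B'_cutoff_converges[OF T f e] by blast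
  obtain k where k: "R0 \<le> R k"
    using R unfolding filterlim_at_top eventually_sequentially by blast
  have Rp: "0 < R k" using k R0(1) by simp
  have "T (\<lambda>x. cutoff (R k) x * f x + (1 - cutoff (R k) x) * f x) = T (cut (R k) f) + T (tail (R k) f)"
    by (rule B'_add[OF T]) (intro D_L1_mult bdd_smooth_cutoff bdd_smooth_one_minus_cutoff Rp f)+
  then have "T f = T (cut (R k) f) + T (tail (R k) f)" by (simp add: algebra_simps)
  then show "norm (T f) \<le> c + e"
    using norm_triangle_ineq[of "T (cut (R k) f)" "T (tail (R k) f)"] le[of k] R0(2)[OF k] by simp
qed

text \<open>
  Let \<open>l x\<close> be the first \<open>k\<close> such that the ball of radius \<open>2 R k\<close> contains \<open>x\<close>. The step function \<open>2\<^sup>-\<^sup>l\<^sup>x\<close> vanishes at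
  infinity, hence has a continuous majorant in \<open>C0\<close>.
\<close>

lemma ex_step_weight:
  fixes R :: "nat \<Rightarrow> real"
  assumes mono: "\<And>k. 2 * R k \<le> R (Suc k)" and R0: "1 \<le> R 0"
  obtains b :: "real ^ 'n::finite \<Rightarrow> real" where "(\<lambda>x. of_real (b x)) \<in> C0"
    "\<And>k x. norm x \<le> 2 * R k \<Longrightarrow> 1 \<le> 2 ^ k * b x"
proof -
  have Rge: "2 ^ k \<le> R k" for k
  proof (induction k)
    case (Suc k)
    then show ?case using mono[of k] by simp
  qed (use R0 in simp)
  have incR: "incseq R"
  proof (rule incseq_SucI)
    fix k
    have "0 \<le> R k" using Rge[of k] by (rule order_trans[rotated]) simp
    then show "R k \<le> R (Suc k)" using mono[of k] by linarith
  qed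
  define l where "l x = (LEAST k. norm x \<le> 2 * R k)" for x :: "real ^ 'n"
  define a where "a x = (1 / 2 :: real) ^ l x" for x :: "real ^ 'n"
  have ex: "\<exists>k. norm x \<le> 2 * R k" for x :: "real ^ 'n"
  proof -
    obtain k :: nat where k: "norm x < real k" using reals_Archimedean2 by blast
    have "real k \<le> 2 ^ k" using of_nat_less_two_power[of k, where 'a = real] by linarith
    then have "norm x \<le> 2 * R k" using k Rge[of k] by linarith
    then show ?thesis by blast
  qed
  have "(a \<longlongrightarrow> 0) at_infinity"
  proof (rule tendstoI)
    fix e :: real assume "0 < e"
    then obtain k where k: "(1 / 2) ^ k < e" using real_arch_pow_inv[of e "1 / 2"] by auto
    have "dist (a x) 0 < e" if x: "2 * R k + 1 \<le> norm x" for x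
    proof -
      have "k \<le> l x"
      proof (rule ccontr)
        assume "\<not> k \<le> l x"
        then have "R (l x) \<le> R k" using incR by (simp add: incseq_def)
        moreover have "norm x \<le> 2 * R (l x)" unfolding l_def by (rule LeastI_ex[OF ex])
        ultimately show False using x by linarith
      qed
      then have "(1 / 2 :: real) ^ l x \<le> (1 / 2) ^ k" by (intro power_decreasing) auto
      then have "a x < e" using k unfolding a_def by linarith
      then show ?thesis by (simp add: a_def)
    qed
    then show "\<forall>\<^sub>F x in at_infinity. dist (a x) 0 < e" unfolding eventually_at_infinity by blast
  qed
  then obtain b where b: "continuous_on UNIV b" "(b \<longlongrightarrow> 0) at_infinity" "\<And>x. a x \<le> b x"
    by (rule ex_slow_majorant[where a = a and A = 1, rotated 2]) (auto simp: a_def power_le_one)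
  have "(\<lambda>x. complex_of_real (b x)) \<in> C0"
    unfolding C0_def using b(1) tendsto_of_real[OF b(2), where 'a = complex] by (auto intro: continuous_intros)
  moreover have "1 \<le> 2 ^ k * b x" if "norm x \<le> 2 * R k" for k x
  proof -
    have "l x \<le> k" unfolding l_def by (rule Least_le[of "\<lambda>k. norm x \<le> 2 * R k", OF that])
    then have "(1 / 2 :: real) ^ k \<le> a x" unfolding a_def by (intro power_decreasing) auto
    then have "2 ^ k * (1 / 2 :: real) ^ k \<le> 2 ^ k * b x" using b(3)[of x] by (intro mult_left_mono) auto
    then show ?thesis by (simp add: power_mult_distrib[symmetric])
  qed
  ultimately show ?thesis using that by blast
qed

text \<open>
  With radii \<open>R k\<close> that at least double, the differences \<open>u k\<close> of successive cutoffs sum up to a cutoff. For \<open>k \<ge> 2\<close>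
  the piece \<open>u k * f\<close> is its own tail beyond \<open>R (k - 2)\<close>, so \<open>K\<close> sees it with a factor \<open>4\<^sup>-\<^sup>k\<close>, up to a constant; and it
  lives where the weight is at least \<open>2\<^sup>-\<^sup>k\<close>. What remains is a geometric series.
\<close>

lemma compact_dominated:
  fixes K :: "'n::finite functional set"
  assumes K: "compactin B'_dot_topology K"
  shows "\<exists>g\<in>C0. \<exists>m C. \<forall>T\<in>K. \<forall>f\<in>D_L1. norm (T f) \<le> C * wnorm g m f"
proof -
  have K1: "compactin B'_topology K" and K2: "K \<subseteq> B'_dot" using K by (auto simp: compactin_B'_dot_iff)
  have KB: "K \<subseteq> B'" by (rule compactin_B'_subset[OF K1])
  obtain m C where C: "0 < C" "\<And>T f. T \<in> K \<Longrightarrow> f \<in> D_L1 \<Longrightarrow> norm (T f) \<le> C * dnorm m f"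
    using compact_equicontinuous[OF K1] by blast
  define P where "P k Q \<longleftrightarrow> 1 \<le> Q \<and> (\<forall>T\<in>K. \<forall>f\<in>D_L1. norm (T (tail Q f)) \<le> (1 / 4) ^ k * dnorm (Suc m) f)" for k Q
  have exP: "\<exists>Q0. \<forall>Q\<ge>Q0. P k Q" for k
  proof -
    have "\<exists>Q0\<ge>1. \<forall>Q\<ge>Q0. \<forall>T\<in>K. \<forall>f\<in>D_L1. norm (T (tail Q f)) \<le> (1 / 4) ^ k * dnorm (Suc m) f"
    proof (rule compact_tail[OF K1 K2 C(1)])
      show "norm (T f) \<le> C * dnorm m f" if "T \<in> K" "f \<in> D_L1" for T f by (rule C(2)[OF that])
    qed simp
    then obtain Q0 where "1 \<le> Q0"
      "\<forall>Q\<ge>Q0. \<forall>T\<in>K. \<forall>f\<in>D_L1. norm (T (tail Q f)) \<le> (1 / 4) ^ k * dnorm (Suc m) f" by blast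
    then show ?thesis unfolding P_def by (intro exI[of _ Q0]) auto
  qed
  have "\<exists>R :: nat \<Rightarrow> real. \<forall>k. P k (R k) \<and> 2 * R k \<le> R (Suc k)"
  proof (rule dependent_nat_choice[where P = P and Q = "\<lambda>k x y. 2 * x \<le> y"])
    show "\<exists>x. P 0 x" using exP[of 0] by blast
    show "\<exists>y. P (Suc k) y \<and> 2 * x \<le> y" for x k
    proof -
      obtain Q0 where "\<forall>Q\<ge>Q0. P (Suc k) Q" using exP[of "Suc k"] by blast
      then show ?thesis by (intro exI[of _ "max Q0 (2 * x)"]) simp
    qed
  qed
  then obtain R :: "nat \<Rightarrow> real" where R: "\<And>k. P k (R k)" "\<And>k. 2 * R k \<le> R (Suc k)" by blast
  have R1: "1 \<le> R k" for k using R(1) by (simp add: P_def)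
  have Rp: "0 < R k" for k using R1[of k] by simp
  have tail: "norm (T (tail (R k) f)) \<le> (1 / 4) ^ k * dnorm (Suc m) f" if "T \<in> K" "f \<in> D_L1" for k T f
    using R(1)[of k] that by (simp add: P_def)
  obtain b :: "real ^ 'n \<Rightarrow> real" where b: "(\<lambda>x. of_real (b x)) \<in> C0" "\<And>k x. norm x \<le> 2 * R k \<Longrightarrow> 1 \<le> 2 ^ k * b x"
    using ex_step_weight[of R, OF R(2) R1] by blast
  define g where "g x = complex_of_real (b x)" for x
  have gC: "g \<in> C0" unfolding g_def[abs_def] by (rule b(1))
  note gw = C0_weight[OF gC]
  define u where "u k x = (if k = 0 then cutoff (R 0) x else cutoff (R k) x - cutoff (R (k - 1)) x)" for k and x :: "real ^ 'n"
  have ub: "bdd_smooth (u k)" for k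
    unfolding u_def[abs_def] by (cases "k = 0") (auto intro!: bdd_smooth_diff bdd_smooth_cutoff Rp)
  have usum: "(\<Sum>j\<le>k. u j x) = cutoff (R k) x" for k x
    by (induction k) (simp_all add: u_def)
  obtain A where A: "0 < A" "\<And>R is x. 1 \<le> R \<Longrightarrow> is \<in> words (Suc m) \<Longrightarrow> norm (ders is (cutoff R) (x :: real ^ 'n)) \<le> A"
    by (rule cutoff_bound[where m = "Suc m"]) blast
  have uA: "norm (ders is (u k) x) \<le> 2 * A" if is_: "is \<in> words (Suc m)" for k "is" x
  proof (cases "k = 0")
    case True
    then have "u k = cutoff (R 0)" by (simp add: u_def fun_eq_iff)
    then show ?thesis using A(2)[OF R1 is_, of 0 x] A(1) by simp
  next
    case False
    then have "u k = (\<lambda>x. cutoff (R k) x - cutoff (R (k - 1)) x)" by (simp add: u_def fun_eq_iff)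
    then have "ders is (u k) x = ders is (cutoff (R k)) x - ders is (cutoff (R (k - 1))) x"
      by (simp add: ders_diff smooth_cutoff)
    then show ?thesis
      using A(2)[OF R1 is_, of k x] A(2)[OF R1 is_, of "k - 1" x]
        norm_triangle_ineq4[of "ders is (cutoff (R k)) x" "ders is (cutoff (R (k - 1))) x"] by simp
  qed
  have incR: "R (k - 1) \<le> R k" for k using R(2)[of "k - 1"] Rp[of "k - 1"] by (cases k) simp_all
  have usupp: "fun_support (u k) \<subseteq> cball 0 (2 * R k)" for k
  proof (rule fun_support_subset)
    show "u k x = 0" if "x \<notin> cball 0 (2 * R k)" for x
    proof -
      have "2 * R k \<le> norm x" using that by simp
      moreover have "2 * R (k - 1) \<le> norm x" using calculation incR[of k] by linarith
      ultimately show ?thesis by (simp add: u_def cutoff_eq_0 Rp)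
    qed
  qed simp
  \<comment> \<open>the constant of \<open>wnorm_mult_le\<close> for the pieces\<close>
  define E where "E = 2 ^ Suc m * (2 * A) * card (words (Suc m) :: 'n list set)"
  have E: "0 < E" unfolding E_def using A(1) card_words_pos[where 'n = 'n and m = "Suc m"] by simp
  have piece_norm: "dnorm (Suc m) (\<lambda>x. u k x * f x) \<le> E * 2 ^ k * wnorm g (Suc m) f" if f: "f \<in> D_L1" for k f
  proof -
    have w: "weight (\<lambda>x. 2 ^ k * g x)"
    proof -
      have "(\<lambda>x. 2 ^ k * g x) \<in> C0"
        using gC unfolding C0_def by (auto intro!: continuous_intros tendsto_mult_right_zero)
      then show ?thesis by (rule C0_weight)
    qed
    have "dnorm (Suc m) (\<lambda>x. u k x * f x) \<le> E * wnorm (\<lambda>x. 2 ^ k * g x) (Suc m) f"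
      unfolding E_def
    proof (rule wnorm_mult_le[OF weight_const w f ub uA])
      fix x assume "x \<in> fun_support (u k)"
      then have "norm x \<le> 2 * R k" using usupp[of k] by auto
      from b(2)[OF this] show "norm (1 :: complex) \<le> norm (2 ^ k * g x)"
        by (simp add: g_def norm_mult norm_power) (smt (verit) mult_left_mono zero_le_power)
    qed
    also have "\<dots> \<le> E * (2 ^ k * wnorm g (Suc m) f)"
      using wnorm_weight_scale[OF D_L1_smooth[OF f], of "2 ^ k" g "Suc m"] E by (intro mult_left_mono) (simp_all add: norm_power)
    finally show ?thesis by (simp add: mult.assoc)
  qed
  have piece: "norm (T (\<lambda>x. u k x * f x)) \<le> 16 * (C + 1) * (1 / 4) ^ k * dnorm (Suc m) (\<lambda>x. u k x * f x)" if T: "T \<in> K" and f: "f \<in> D_L1" for T f k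
  proof -
    have uf: "(\<lambda>x. u k x * f x) \<in> D_L1" by (rule D_L1_mult[OF ub f])
    let ?w = "dnorm (Suc m) (\<lambda>x. u k x * f x)"
    have w0: "0 \<le> ?w" by (rule wnorm_nonneg[OF D_L1_smooth[OF uf]])
    show ?thesis
    \<comment> \<open>the first two pieces are bounded by equicontinuity; the factor \<open>16 = 4\<^sup>2\<close> absorbs the shift by two indices\<close>
    proof (cases "k < 2")
      case True
      then have "(1 / 4 :: real) ^ 2 \<le> (1 / 4) ^ k" by (intro power_decreasing) auto
      then have "1 \<le> 16 * (1 / 4 :: real) ^ k" by (simp add: power2_eq_square)
      have "norm (T (\<lambda>x. u k x * f x)) \<le> C * dnorm m (\<lambda>x. u k x * f x)" by (rule C(2)[OF T uf])
      also have "\<dots> \<le> (C + 1) * ?w"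
        using C(1) w0 by (intro mult_mono wnorm_mono_order D_L1_smooth uf wnorm_nonneg) auto
      also have "\<dots> \<le> (C + 1) * ?w * (16 * (1 / 4) ^ k)"
        using mult_left_mono[OF \<open>1 \<le> 16 * (1 / 4 :: real) ^ k\<close>, of "(C + 1) * ?w"] C(1) w0 by simp
      finally show ?thesis by (simp add: algebra_simps)
    next
      case False
      \<comment> \<open>where \<open>u k\<close> does not vanish, \<open>|x| > R (j + 1) \<ge> 2 R j\<close>, so that the cutoff at \<open>R j\<close> is \<open>0\<close>\<close>
      define j where "j = k - 2"
      have k: "k = Suc (Suc j)" unfolding j_def using False by simp
      have "(1 - cutoff (R j) x) * (u k x * f x) = u k x * f x" for x
      proof (cases "norm x \<le> R (Suc j)")
        case True
        moreover have "norm x \<le> R (Suc (Suc j))" using True incR[of "Suc (Suc j)"] by simp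
        ultimately have "u k x = 0" by (simp add: u_def k cutoff_eq_1 Rp)
        then show ?thesis by simp
      next
        case False
        then have "2 * R j \<le> norm x" using R(2)[of j] by linarith
        then show ?thesis by (simp add: cutoff_eq_0 Rp)
      qed
      then have "(\<lambda>x. (1 - cutoff (R j) x) * (u k x * f x)) = (\<lambda>x. u k x * f x)" by (rule ext)
      then have "norm (T (\<lambda>x. u k x * f x)) \<le> (1 / 4) ^ j * ?w" using tail[OF T uf, of j] by simp
      also have "(1 / 4 :: real) ^ j = 16 * (1 / 4) ^ k" unfolding k by simp
      also have "16 * (1 / 4) ^ k * ?w \<le> (C + 1) * (16 * (1 / 4) ^ k * ?w)"
      proof -
        have "0 \<le> C * (16 * (1 / 4) ^ k * ?w)" using C(1) w0 by (intro mult_nonneg_nonneg) auto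
        then show ?thesis by (simp add: algebra_simps)
      qed
      finally show ?thesis by (simp add: algebra_simps)
    qed
  qed
  have "norm (T f) \<le> 32 * (C + 1) * E * wnorm g (Suc m) f" if T: "T \<in> K" and f: "f \<in> D_L1" for T f
  proof (rule cutoff_sequence_bound[OF _ f])
    show TB: "T \<in> B'" using T KB by blast
    have Rge: "real k \<le> R k" for k
    proof (induction k)
      case (Suc k)
      then show ?case using R(2)[of k] R1[of k] by simp
    qed (use Rp[of 0] in simp)
    show "filterlim R at_top sequentially"
      by (rule filterlim_at_top_mono[OF filterlim_real_sequentially]) (use Rge in simp)
    fix k
    define W where "W = 16 * (C + 1) * E * wnorm g (Suc m) f"
    have W0: "0 \<le> W" unfolding W_def using C(1) E by (intro mult_nonneg_nonneg wnorm_nonneg D_L1_smooth f) auto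
    have Tsum: "T (\<lambda>x. (\<Sum>j\<le>k. u j x) * f x) = (\<Sum>j\<le>k. T (\<lambda>x. u j x * f x))" for k
    proof (induction k)
      case (Suc k)
      have "(\<lambda>x. (\<Sum>j\<le>k. u j x) * f x) \<in> D_L1" unfolding usum by (intro D_L1_mult bdd_smooth_cutoff Rp f)
      from B'_add[OF TB this D_L1_mult[OF ub f, of "Suc k"]] show ?case using Suc by (simp add: distrib_right)
    qed simp
    have "norm (T (\<lambda>x. u j x * f x)) \<le> W * (1 / 2) ^ j" for j
    proof -
      have "norm (T (\<lambda>x. u j x * f x)) \<le> 16 * (C + 1) * (1 / 4) ^ j * (E * 2 ^ j * wnorm g (Suc m) f)"
        using C(1) by (intro order_trans[OF piece[OF T f] mult_left_mono[OF piece_norm[OF f]]]) simp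
      also have "\<dots> = W * ((1 / 4) ^ j * 2 ^ j)" by (simp add: W_def)
      also have "(1 / 4 :: real) ^ j * 2 ^ j = (1 / 2) ^ j" by (simp add: power_mult_distrib[symmetric])
      finally show ?thesis .
    qed
    then have "norm (T (cut (R k) f)) \<le> (\<Sum>j\<le>k. W * (1 / 2) ^ j)"
      unfolding usum[symmetric] Tsum by (intro order_trans[OF norm_sum sum_mono])
    also have "\<dots> = W * (\<Sum>j\<le>k. (1 / 2) ^ j)" by (simp add: sum_distrib_left)
    also have "\<dots> \<le> W * 2"
    proof (rule mult_left_mono[OF _ W0])
      have "(\<Sum>j\<le>k. (1 / 2 :: real) ^ j) = 2 - (1 / 2) ^ k" by (induction k) simp_all
      then show "(\<Sum>j\<le>k. (1 / 2 :: real) ^ j) \<le> 2" by simp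
    qed
    also have "W * 2 = 32 * (C + 1) * E * wnorm g (Suc m) f" by (simp add: W_def algebra_simps)
    finally show "norm (T (cut (R k) f)) \<le> 32 * (C + 1) * E * wnorm g (Suc m) f" .
  qed
  then show ?thesis using gC by blast
qed

section \<open>Comparison of the topologies\<close>

text \<open>
  Equicontinuity makes the suprema finite.
\<close>

lemma kappa_seminorm:
  fixes K :: "'n::finite functional set"
  assumes K: "compactin B'_dot_topology K" "K \<noteq> {}"
  shows "seminorm_on D_L1 (\<lambda>f. SUP T\<in>K. norm (T f))"
    and "f \<in> D_L1 \<Longrightarrow> T \<in> K \<Longrightarrow> norm (T f) \<le> (SUP T\<in>K. norm (T f))"
proof -
  have K1: "compactin B'_topology K" using K(1) by (simp add: compactin_B'_dot_iff)
  have KB: "K \<subseteq> B'" by (rule compactin_B'_subset[OF K1])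
  obtain m C where C: "\<And>T f. T \<in> K \<Longrightarrow> f \<in> D_L1 \<Longrightarrow> norm (T f) \<le> C * dnorm m f"
    using compact_equicontinuous[OF K1] by blast
  have bdd: "bdd_above ((\<lambda>T. norm (T f)) ` K)" if "f \<in> D_L1" for f
    using C[OF _ that] by (intro bdd_aboveI2)
  have up: "norm (T f) \<le> (SUP T\<in>K. norm (T f))" if "f \<in> D_L1" "T \<in> K" for f T
    by (rule cSUP_upper[OF that(2) bdd[OF that(1)]])
  then show "f \<in> D_L1 \<Longrightarrow> T \<in> K \<Longrightarrow> norm (T f) \<le> (SUP T\<in>K. norm (T f))" .
  have scale: "norm (T (\<lambda>t. c * f t)) = norm c * norm (T f)" if "f \<in> D_L1" "T \<in> K" for f c T
    using B'_scale[of T f c] that KB by (auto simp: norm_mult)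
  have scale_le: "(SUP T\<in>K. norm (T (\<lambda>t. c * f t))) \<le> norm c * (SUP T\<in>K. norm (T f))" if f: "f \<in> D_L1" for f c
    by (rule cSUP_least[OF K(2)]) (simp add: scale[OF f] up[OF f] mult_left_mono)
  show "seminorm_on D_L1 (\<lambda>f. SUP T\<in>K. norm (T f))"
    unfolding seminorm_on_def
  proof (intro conjI ballI allI)
    fix f h :: "'n cfun" assume f: "f \<in> D_L1" and h: "h \<in> D_L1"
    show "(SUP T\<in>K. norm (T (\<lambda>t. f t + h t))) \<le> (SUP T\<in>K. norm (T f)) + (SUP T\<in>K. norm (T h))"
    proof (rule cSUP_least[OF K(2)])
      fix T assume T: "T \<in> K"
      then have "T \<in> B'" using KB by blast
      then have "norm (T (\<lambda>t. f t + h t)) \<le> norm (T f) + norm (T h)"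
        using B'_add[of T f h] f h norm_triangle_ineq[of "T f" "T h"] by simp
      then show "norm (T (\<lambda>t. f t + h t)) \<le> (SUP T\<in>K. norm (T f)) + (SUP T\<in>K. norm (T h))"
        using up[OF f T] up[OF h T] by linarith
    qed
  next
    fix f :: "'n cfun" and c assume f: "f \<in> D_L1"
    show "(SUP T\<in>K. norm (T (\<lambda>t. c * f t))) = norm c * (SUP T\<in>K. norm (T f))"
    proof (cases "c = 0")
      case True
      obtain T where "T \<in> K" using K(2) by blast
      from up[OF D_L1_scale[OF f, of 0] this] have "0 \<le> (SUP T\<in>K. norm (T (\<lambda>t. 0 * f t)))"
        by (rule order_trans[OF norm_ge_zero])
      then show ?thesis using scale_le[OF f, of 0] True by simp
    next
      case False
      have "(SUP T\<in>K. norm (T f)) \<le> (SUP T\<in>K. norm (T (\<lambda>t. c * f t))) / norm c"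
      proof (rule cSUP_least[OF K(2)])
        fix T assume T: "T \<in> K"
        have "norm c * norm (T f) \<le> (SUP T\<in>K. norm (T (\<lambda>t. c * f t)))"
          using up[OF D_L1_scale[OF f, of c] T] scale[OF f T, of c] by simp
        then show "norm (T f) \<le> (SUP T\<in>K. norm (T (\<lambda>t. c * f t))) / norm c"
          using False by (simp add: pos_le_divide_eq mult.commute)
      qed
      then have "norm c * (SUP T\<in>K. norm (T f)) \<le> (SUP T\<in>K. norm (T (\<lambda>t. c * f t)))"
        using False by (simp add: pos_le_divide_eq mult.commute)
      then show ?thesis using scale_le[OF f, of c] by linarith
    qed
  qed
qed

lemma zero_C0: "(\<lambda>x. 0) \<in> C0"
  unfolding C0_def by simp

lemma kappa_eq_wnorm_topology:
  "kappa_topology (D_L1 :: 'n::finite cfun set) B'_dot_topology = seminorm_topology D_L1 {wnorm g m | g m. g \<in> C0}"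
  unfolding kappa_topology_def
proof (rule seminorm_topology_eqI[OF subspace_D_L1])
  let ?P = "{(\<lambda>f. SUP T\<in>K. norm (T f)) | K :: 'n functional set. K \<noteq> {} \<and> absolutely_convex K \<and> compactin B'_dot_topology K}"
  let ?Q = "{wnorm g m | g m. g \<in> (C0 :: 'n cfun set)}"
  have polar: "(\<lambda>f. SUP T\<in>polar_of g m. norm (T f)) \<in> ?P" if g: "g \<in> C0" for g m
    using polar_of_nonempty[OF C0_weight[OF g]] polar_of_absolutely_convex[OF C0_weight[OF g]] polar_of_compactin[OF g] by blast
  show "seminorm_on D_L1 p" if "p \<in> ?P" for p using that kappa_seminorm(1) by blast
  show "seminorm_on D_L1 q" if "q \<in> ?Q" for q using that wnorm_seminorm[OF C0_weight] by blast
  show "?P \<noteq> {}" using polar[OF zero_C0] by blast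
  show "?Q \<noteq> {}" using zero_C0 by blast
  show "\<exists>Q0 C. finite Q0 \<and> Q0 \<subseteq> ?Q \<and> (\<forall>f\<in>D_L1. p f \<le> C * (\<Sum>q\<in>Q0. q f))" if p: "p \<in> ?P" for p
  proof -
    obtain K where K: "p = (\<lambda>f. SUP T\<in>K. norm (T f))" "K \<noteq> {}" "compactin B'_dot_topology K" using p by blast
    obtain g m C where g: "g \<in> C0" and C: "\<forall>T\<in>K. \<forall>f\<in>D_L1. norm (T f) \<le> C * wnorm g m f"
      using compact_dominated[OF K(3)] by blast
    have "p f \<le> C * (\<Sum>q\<in>{wnorm g m}. q f)" if f: "f \<in> D_L1" for f
      unfolding K(1) using C f K(2) by (intro cSUP_least) auto
    then show ?thesis using g by (intro exI[of _ "{wnorm g m}"] exI[of _ C]) auto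
  qed
  show "\<exists>P0 C. finite P0 \<and> P0 \<subseteq> ?P \<and> (\<forall>f\<in>D_L1. q f \<le> C * (\<Sum>p\<in>P0. p f))" if q: "q \<in> ?Q" for q
  proof -
    obtain g m where g: "q = wnorm g m" "g \<in> C0" using q by blast
    have "q f \<le> 1 * (\<Sum>p\<in>{\<lambda>f. SUP T\<in>polar_of g m. norm (T f)}. p f)" if "f \<in> D_L1" for f
      using wnorm_le_sup_polar[OF C0_weight[OF g(2)] that, of m] by (simp add: g(1))
    then show ?thesis
      using polar[OF g(2), of m] by (intro exI[of _ "{\<lambda>f. SUP T\<in>polar_of g m. norm (T f)}"] exI[of _ 1]) blast
  qed
qed

lemma laplacian_lincomb:
  assumes "smooth f" "smooth h"
  shows "laplacian (\<lambda>x. a * f x + b * h x) = (\<lambda>x. a * laplacian f x + b * laplacian h x)"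
  using ders_lincomb[OF assms, of "[i, i]" a b for i]
  by (simp add: laplacian_def[abs_def] fun_eq_iff sum.distrib sum_distrib_left)

lemma one_minus_laplacian_lincomb:
  assumes "smooth f" "smooth h"
  shows "one_minus_laplacian (\<lambda>x. a * f x + b * h x) = (\<lambda>x. a * one_minus_laplacian f x + b * one_minus_laplacian h x)"
  by (simp add: one_minus_laplacian_def fun_eq_iff laplacian_lincomb[OF assms] algebra_simps)

lemma one_minus_laplacian_pow_lincomb:
  assumes "f \<in> D_L1" "h \<in> D_L1"
  shows "(one_minus_laplacian ^^ k) (\<lambda>x. a * f x + b * h x) = (\<lambda>x. a * (one_minus_laplacian ^^ k) f x + b * (one_minus_laplacian ^^ k) h x)"
proof (induction k)
  case (Suc k)
  have "smooth ((one_minus_laplacian ^^ k) f)" "smooth ((one_minus_laplacian ^^ k) h)"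
    by (intro D_L1_smooth one_minus_laplacian_pow_D_L1 assms)+
  then show ?case by (simp add: Suc one_minus_laplacian_lincomb)
qed simp

lemma one_minus_laplacian_seminorm:
  fixes g :: "'n::finite cfun"
  assumes g: "weight g"
  shows "seminorm_on D_L1 (\<lambda>f. L1_norm (\<lambda>x. g x * (one_minus_laplacian ^^ m) f x))"
  unfolding seminorm_on_def
proof (intro conjI ballI allI)
  fix f h :: "'n cfun" assume f: "f \<in> D_L1" and h: "h \<in> D_L1"
  have int: "integrable lborel (\<lambda>x. g x * (one_minus_laplacian ^^ m) f x)" if "f \<in> D_L1" for f
    by (intro weight_integrable g D_L1_integrable one_minus_laplacian_pow_D_L1 that)
  have "(one_minus_laplacian ^^ m) (\<lambda>t. f t + h t) = (\<lambda>x. (one_minus_laplacian ^^ m) f x + (one_minus_laplacian ^^ m) h x)"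
    using one_minus_laplacian_pow_lincomb[OF f h, of m 1 1] by simp
  then show "L1_norm (\<lambda>x. g x * (one_minus_laplacian ^^ m) (\<lambda>t. f t + h t) x) \<le>
      L1_norm (\<lambda>x. g x * (one_minus_laplacian ^^ m) f x) + L1_norm (\<lambda>x. g x * (one_minus_laplacian ^^ m) h x)"
    using L1_norm_add[OF int[OF f] int[OF h]] by (simp add: distrib_left)
next
  fix f :: "'n cfun" and c assume f: "f \<in> D_L1"
  have "(one_minus_laplacian ^^ m) (\<lambda>t. c * f t) = (\<lambda>x. c * (one_minus_laplacian ^^ m) f x)"
    using one_minus_laplacian_pow_lincomb[OF f f, of m c 0] by simp
  then show "L1_norm (\<lambda>x. g x * (one_minus_laplacian ^^ m) (\<lambda>t. c * f t) x) = norm c * L1_norm (\<lambda>x. g x * (one_minus_laplacian ^^ m) f x)"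
    using L1_norm_scale[of c "\<lambda>x. g x * (one_minus_laplacian ^^ m) f x"] by (simp add: mult.left_commute)
qed

lemma laplacian_topology_eq_wnorm_topology:
  "seminorm_topology (D_L1 :: 'n::finite cfun set) {(\<lambda>f. L1_norm (\<lambda>x. g x * (one_minus_laplacian ^^ m) f x)) | g m. g \<in> C0}
    = seminorm_topology D_L1 {wnorm g m | g m. g \<in> C0}"
proof (rule seminorm_topology_eqI[OF subspace_D_L1])
  let ?P = "{(\<lambda>f. L1_norm (\<lambda>x. g x * (one_minus_laplacian ^^ m) f x)) | g m. g \<in> (C0 :: 'n cfun set)}"
  let ?Q = "{wnorm g m | g m. g \<in> (C0 :: 'n cfun set)}"
  show "seminorm_on D_L1 p" if "p \<in> ?P" for p using that one_minus_laplacian_seminorm[OF C0_weight] by blast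
  show "seminorm_on D_L1 q" if "q \<in> ?Q" for q using that wnorm_seminorm[OF C0_weight] by blast
  show "?P \<noteq> {}" "?Q \<noteq> {}" using zero_C0 by blast+
  show "\<exists>Q0 C. finite Q0 \<and> Q0 \<subseteq> ?Q \<and> (\<forall>f\<in>D_L1. p f \<le> C * (\<Sum>q\<in>Q0. q f))" if p: "p \<in> ?P" for p
  proof -
    obtain g m where g: "p = (\<lambda>f. L1_norm (\<lambda>x. g x * (one_minus_laplacian ^^ m) f x))" "g \<in> C0" using p by blast
    obtain C where C: "\<forall>f\<in>D_L1. L1_norm (\<lambda>x. g x * (one_minus_laplacian ^^ m) f x) \<le> C * wnorm g (2 * m) f"
      using one_minus_laplacian_pow_le[OF C0_weight[OF g(2)], of m] by blast
    show ?thesis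
      by (rule exI[of _ "{wnorm g (2 * m)}"], rule exI[of _ C]) (use C g in auto)
  qed
  show "\<exists>P0 C. finite P0 \<and> P0 \<subseteq> ?P \<and> (\<forall>f\<in>D_L1. q f \<le> C * (\<Sum>p\<in>P0. p f))" if q: "q \<in> ?Q" for q
  proof -
    obtain g m where g: "q = wnorm g m" "g \<in> C0" using q by blast
    obtain A where A: "0 < A" "\<And>x. norm (g x) \<le> A" using C0_bounded[OF g(2)] by blast
    have "((\<lambda>x. norm (g x)) \<longlongrightarrow> 0) at_infinity" using g(2) unfolding C0_def by (auto intro: tendsto_norm_zero)
    then obtain b where b: "continuous_on UNIV b" "(b \<longlongrightarrow> 0) at_infinity" "\<And>x. norm (g x) \<le> b x" "\<And>x. b x \<le> A"
      "\<And>x h. b (x + h) \<le> (1 + norm h) * b x"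
      by (rule ex_slow_majorant[where a = "\<lambda>x. norm (g x)" and A = A, rotated 2]) (use A in auto)
    have b0: "0 \<le> b x" for x by (rule order_trans[OF norm_ge_zero b(3)])
    have sb: "slow_weight b"
      unfolding slow_weight_def using b b0 by (auto intro: borel_measurable_continuous_onI)
    define G where "G x = complex_of_real (b x)" for x
    have GC: "G \<in> C0"
      unfolding C0_def G_def using b(1) tendsto_of_real[OF b(2), where 'a = complex] by (auto intro: continuous_intros)
    define E where "E k = (\<lambda>f. L1_norm (\<lambda>x. G x * (one_minus_laplacian ^^ k) f x))" for k
    obtain C where C: "\<forall>f\<in>D_L1. wnorm G m f \<le> C * (\<Sum>k\<le>m. E k f)"
      using weighted_elliptic[OF sb, of m] unfolding E_def G_def by blast
    have EP: "E k \<in> ?P" for k unfolding E_def using GC by blast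
    have "q f \<le> (\<bar>C\<bar> * real (Suc m)) * (\<Sum>p\<in>E ` {..m}. p f)" if f: "f \<in> D_L1" for f
    proof -
      have E0: "0 \<le> E k f" for k unfolding E_def by (rule L1_norm_nonneg)
      have "q f \<le> wnorm G m f"
        unfolding g(1) by (rule wnorm_weight_mono[OF C0_weight[OF GC] C0_weight[OF g(2)] f])
          (use b(3) b0 in \<open>simp add: G_def\<close>)
      also have "\<dots> \<le> \<bar>C\<bar> * (\<Sum>k\<le>m. E k f)"
        using C f E0 by (intro order_trans[OF bspec[OF C f] mult_right_mono] sum_nonneg) auto
      also have "\<dots> \<le> \<bar>C\<bar> * (\<Sum>k\<le>m. (\<Sum>p\<in>E ` {..m}. p f))"
      proof (intro mult_left_mono sum_mono)
        fix k assume "k \<in> {..m}"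
        then show "E k f \<le> (\<Sum>p\<in>E ` {..m}. p f)"
          by (intro member_le_sum[of "E k" "E ` {..m}" "\<lambda>p. p f"]) (auto simp: E0)
      qed simp
      finally show ?thesis by simp
    qed
    then show ?thesis using EP by (intro exI[of _ "E ` {..m}"] exI[of _ "\<bar>C\<bar> * real (Suc m)"]) blast
  qed
qed

theorem proposition8:
  shows "kappa_topology (D_L1 :: (real ^ 'n::finite \<Rightarrow> complex) set) B'_dot_topology =
           seminorm_topology D_L1
             {(\<lambda>\<phi>. L1_norm (\<lambda>x. g x * (one_minus_laplacian ^^ m) \<phi> x)) | g m. g \<in> C0}
       \<and> kappa_topology (D_L1 :: (real ^ 'n \<Rightarrow> complex) set) B'_dot_topology =
           seminorm_topology D_L1
             {(\<lambda>\<phi>. SUP \<alpha>\<in>mindex_le m. L1_norm (\<lambda>x. g x * mpartial \<alpha> \<phi> x)) | g m. g \<in> C0}"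
  using kappa_eq_wnorm_topology[where 'n = 'n] laplacian_topology_eq_wnorm_topology[where 'n = 'n]
  by (simp add: wnorm_def[abs_def])

end
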